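(* Let $d \ge 1$ be an integer. (1) If $b, c \in C^1(I,\mathbb{R}^d)$, then there exist $\beta, \gamma \in \overline{\Gamma}$ realising the infimum $$\inf_{\beta,\gamma \in \overline{\Gamma}} \operatorname{dist}(b\circ\beta, c\circ\gamma).$$ (2) If $d \ge 2$, there exists a pair of Lipschitz curves $b, c : I \to \mathbb{R}^d$ for which the infimum $$\inf_{\beta,\gamma \in \overline{\Gamma}} \operatorname{dist}(b\circ\beta, c\circ\gamma)$$ is not realised by any pair of reparametrisations $\beta,\gamma \in \overline{\Gamma}$.
   Context: $I=[0,1]$. For an absolutely continuous curve $c : I \to \mathbb{R}^d$ its square root velocity function is $R(c) = \frac{c'}{\sqrt{|c'|}}$, with the convention $R(c)(t)=0$ if $c'(t)=0$; it lies in $L^2(I,\mathbb{R}^d)$. For absolutely continuous curves $b,c$ set $\operatorname{dist}(b,c) = \|R(b)-R(c)\|_{L^2}$. $\overline{\Gamma}$ is the semigroup (under composition) of all weakly increasing, surjective, absolutely continuous maps $\gamma : I \to I$ (so $\gamma(0)=0$, $\gamma(1)=1$, $\gamma' \ge 0$ a.e.). *)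

theory Defs
  imports "HOL-Analysis.Analysis"
begin

text \<open>A curve on the unit interval is a total function on the reals of which only the
  restriction to \<open>{0..1}\<close> matters: every notion below depends on that restriction alone
  (derivatives are taken within \<open>{0..1}\<close>, hence are one-sided at the endpoints).\<close>

text \<open>The usual \<open>\<epsilon>\<close>-\<open>\<delta>\<close> notion: a division \<open>D division_of T\<close> is a finite family of compact
  intervals \<open>K = {Inf K..Sup K}\<close> with disjoint interiors and union \<open>T\<close>.
  (The library's \<open>absolutely_continuous\<close> is about measures.)\<close>

definition abs_cont_on :: "real set \<Rightarrow> (real \<Rightarrow> 'a::metric_space) \<Rightarrow> bool" where
  "abs_cont_on S f \<longleftrightarrow>
     (\<forall>\<epsilon>>0. \<exists>\<delta>>0. \<forall>D T. D division_of T \<and> T \<subseteq> S \<and> (\<Sum>K\<in>D. Sup K - Inf K) < \<delta>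
        \<longrightarrow> (\<Sum>K\<in>D. dist (f (Inf K)) (f (Sup K))) < \<epsilon>)"

text \<open>The library's \<open>C1_differentiable_on\<close> would ask for two-sided derivatives at 0 and 1.\<close>

definition C1_curve :: "(real \<Rightarrow> 'a::real_normed_vector) \<Rightarrow> bool" where
  "C1_curve c \<longleftrightarrow>
     (\<exists>c'. (\<forall>t\<in>{0..1}. (c has_vector_derivative c' t) (at t within {0..1})) \<and>
           continuous_on {0..1} c')"

definition Lipschitz_curve :: "(real \<Rightarrow> 'a::metric_space) \<Rightarrow> bool" where
  "Lipschitz_curve c \<longleftrightarrow> (\<exists>L. L-lipschitz_on {0..1} c)"

text \<open>Square root velocity function. For absolutely continuous \<open>c\<close> the points without
  derivative, where \<open>vector_derivative\<close> is unspecified, form a null set.\<close>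

definition srv :: "(real \<Rightarrow> 'a::real_normed_vector) \<Rightarrow> real \<Rightarrow> 'a" where
  "srv c t = (let v = vector_derivative c (at t within {0..1})
              in if v = 0 then 0 else v /\<^sub>R sqrt (norm v))"

text \<open>The \<open>L\<^sup>2\<close> distance of square root velocity functions; meaningful for absolutely
  continuous \<open>b\<close> and \<open>c\<close>, for which the integrand is integrable.\<close>

definition srv_dist :: "(real \<Rightarrow> 'a::real_normed_vector) \<Rightarrow> (real \<Rightarrow> 'a) \<Rightarrow> real" where
  "srv_dist b c = sqrt (LINT t:{0..1}|lebesgue. (norm (srv b t - srv c t))\<^sup>2)"

definition Gamma_bar :: "(real \<Rightarrow> real) set" where
  "Gamma_bar = {\<gamma>. mono_on {0..1} \<gamma> \<and> \<gamma> ` {0..1} = {0..1} \<and> abs_cont_on {0..1} \<gamma>}"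

text \<open>The infimum of the theorem is over a nonempty family that is bounded below, so the
  conditionally complete \<open>INF\<close> on the reals is the genuine infimum.\<close>

lemma id_in_Gamma_bar: "id \<in> Gamma_bar"
proof -
  have "(\<Sum>K\<in>D. dist (Inf K) (Sup K)) = (\<Sum>K\<in>D. Sup K - Inf K)"
    if D: "D division_of T" for D and T :: "real set"
  proof (rule sum.cong)
    fix K assume "K \<in> D"
    obtain a b where "K = cbox a b" "K \<noteq> {}"
      using division_ofD(3,4)[OF D] \<open>K \<in> D\<close> by metis
    then show "dist (Inf K) (Sup K) = Sup K - Inf K"
      by (auto simp: dist_real_def)
  qed simp
  then have "abs_cont_on {0..1} (id :: real \<Rightarrow> real)"
    by (auto simp: abs_cont_on_def)
  then show ?thesis
    by (auto simp: Gamma_bar_def monotone_on_def)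
qed

lemma bdd_below_srv_dist: "bdd_below ((\<lambda>(\<beta>, \<gamma>). srv_dist (b \<circ> \<beta>) (c \<circ> \<gamma>)) ` A)"
  by (rule bdd_belowI[of _ 0])
    (auto simp: srv_dist_def set_lebesgue_integral_def intro!: Bochner_Integration.integral_nonneg)

end

theory Submission
  imports Defs "HOL-Complex_Analysis.Great_Picard"
begin

text \<open>
Write \<open>q v = v / sqrt |v|\<close>. For absolutely continuous reparametrisations, expanding the square and the
invariance of length give
\<open>dist (b \<circ> \<beta>) (c \<circ> \<gamma>)\<^sup>2 = length b + length c - 2 J(\<beta>,\<gamma>)\<close> with
\<open>J(\<beta>,\<gamma>) = \<integral> \<phi>(\<beta>,\<gamma>) sqrt(\<beta>' \<gamma>')\<close> and \<open>\<phi>(x,y) = q (b' x) \<bullet> q (c' y)\<close>. Minimising the distance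
means maximising \<open>J\<close>.

For \<open>C\<^sup>1\<close> curves \<open>\<phi>\<close> is continuous. Pairs can be reparametrised jointly so that \<open>(\<beta> + \<gamma>)/2\<close> is the
identity; then \<open>\<beta>\<close> and \<open>\<gamma>\<close> are 2-Lipschitz and a maximising sequence converges uniformly
along a subsequence (\<open>gain_attains_maximum\<close>). The functional with \<open>\<phi>\<close> replaced by its positive part is upper
semicontinuous: by Cauchy-Schwarz, \<open>J\<close> is below the discrete sums of
\<open>\<phi>\<^sup>+ sqrt(\<Delta>\<beta> \<Delta>\<gamma>)\<close> up to a uniform error (\<open>gain_le_upper_sum\<close>), and along a fixed pair these sums converge to
the integral (\<open>upper_sum_tendsto\<close>). So the limit pair attains the supremum for the positive part of \<open>\<phi>\<close>.
Where \<open>\<phi> < 0\<close> along that pair, it is altered so that \<open>\<beta>\<close> and \<open>\<gamma>\<close> move one after the other; there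
\<open>\<beta>' \<gamma>' = 0\<close>, and the altered pair attains the same value for \<open>\<phi>\<close> itself (\<open>gain_remove_negative\<close>).

For Lipschitz curves \<open>\<phi>\<close> may be discontinuous, and the last step can fail because every good
pair has to pass through the set where \<open>\<phi> < 0\<close>. Let \<open>V\<close> be open, of small measure, containing the rationals.
Both curves have velocity \<open>u\<close> on \<open>V\<close>, and velocities \<open>v\<close> and \<open>-v\<close> off \<open>V\<close>, where \<open>u\<close> and \<open>v\<close> are
orthonormal. Then \<open>J\<close> is at most the measure of \<open>V\<close> in the unit interval. This bound is approached by
using the diagonal only on large closed subsets of \<open>V\<close> (\<open>almost_optimal\<close>). Equality would force
\<open>\<beta> = \<gamma>\<close> and at the same time that \<open>v\<close> and \<open>-v\<close> are never matched, which is impossible since the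
complement of \<open>V\<close> is not null (\<open>not_attained\<close>).

Both parts rest on the fact that a monotone absolutely continuous function is differentiable almost everywhere
and is the integral of its derivative (\<open>mono_abs_cont_has_ac_derivative\<close>, \<open>Lebesgue_differentiation\<close>).
\<close>

section \<open>Differentiation of absolutely continuous functions\<close>

text \<open>The measure \<open>N\<close> with density \<open>h\<close> gives \<open>E\<close> mass 0, so \<open>E\<close> lies in an open set \<open>V\<close> with small
\<open>N\<close>-mass. Points of \<open>E\<close> where the quotient stays above \<open>\<epsilon>\<close> are Vitali covered by intervals
in \<open>V\<close> whose length is at most \<open>1/\<epsilon>\<close> times their \<open>N\<close>-mass; a disjoint subfamily covers almost all
of these points and has total length at most \<open>N(V)/\<epsilon>\<close>.\<close>

lemma AE_small_density_quotient:
  fixes h :: "real \<Rightarrow> real"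
  assumes h: "integrable lborel h" and nn: "\<And>x. 0 \<le> h x"
    and E: "E \<in> sets borel" and zero: "\<And>x. x \<in> E \<Longrightarrow> h x = 0"
  shows "AE x in lborel. x \<in> E \<longrightarrow> (\<forall>\<epsilon>>0. \<exists>\<delta>>0. \<forall>a b. a \<le> x \<and> x \<le> b \<and> a < b \<and> b - a < \<delta> \<longrightarrow>
           (LINT t:{a..b}|lborel. h t) \<le> \<epsilon> * (b - a))"
proof -
  have hm [measurable]: "h \<in> borel_measurable borel" 
    using borel_measurable_integrable[OF h] by simp
  define N where "N = density lborel (\<lambda>x. ennreal (h x))"
  have setsN [simp, measurable_cong]: "sets N = sets borel" by (simp add: N_def)
  have spaceN [simp]: "space N = UNIV" by (simp add: N_def)
  have N_eq: "emeasure N A = (\<integral>\<^sup>+x. ennreal (h x) * indicator A x \<partial>lborel)" if "A \<in> sets borel" for A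
    using that by (simp add: N_def emeasure_density)
  have finN: "emeasure N UNIV \<noteq> \<infinity>"
    using h nn by (simp add: N_eq integrable_iff_bounded)
  have N_Icc: "emeasure N {a..b} = ennreal (LINT t:{a..b}|lborel. h t)" for a b
  proof -
    have "integrable lborel (\<lambda>t. indicator {a..b} t * h t)"
      using integrable_mult_indicator[of "{a..b}" lborel h] h by simp
    then show ?thesis
      by (simp add: N_eq set_lebesgue_integral_def nn ennreal_mult' ennreal_indicator[symmetric]
          mult.commute flip: nn_integral_eq_integral)
  qed
  have "emeasure N E = (\<integral>\<^sup>+(x::real). 0 \<partial>lborel)"
    unfolding N_eq[OF E] by (intro nn_integral_cong) (auto simp: zero indicator_def)
  then have NE: "emeasure N E = 0" by simp
  define Bad where "Bad \<epsilon> = {x \<in> E. \<forall>\<delta>>0. \<exists>a b. a \<le> x \<and> x \<le> b \<and> a < b \<and> b - a < \<delta> \<and>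
      \<epsilon> * (b - a) < (LINT t:{a..b}|lborel. h t)}" for \<epsilon> :: real
  have neg: "negligible (Bad \<epsilon>)" if eps: "\<epsilon> > 0" for \<epsilon>
    unfolding negligible_outer_le
  proof (intro allI impI)
    fix e :: real assume e: "e > 0"
    have "(INF U\<in>{U. E \<subseteq> U \<and> open U}. emeasure N U) < ennreal (e * \<epsilon>)"
      using outer_regular[of N E] finN E NE e eps by simp
    then obtain V where V: "E \<subseteq> V" "open V" "emeasure N V < ennreal (e * \<epsilon>)"
      by (auto simp: INF_less_iff)
    define K where "K = {(c, r). 0 < r \<and> cball c r \<subseteq> V \<and> ennreal (\<epsilon> * (2 * r)) \<le> emeasure N (cball c r)}"
    obtain C where C: "countable C" "C \<subseteq> K"
      and dis: "pairwise (\<lambda>i j. disjnt (cball (fst i) (snd i)) (cball (fst j) (snd j))) C"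
      and cov: "negligible (Bad \<epsilon> - (\<Union>i\<in>C. cball (fst i) (snd i)))"
    proof (rule Vitali_covering_theorem_cballs[of K snd "Bad \<epsilon>" fst])
      show "0 < snd i" if "i \<in> K" for i using that by (auto simp: K_def)
      fix x d :: real assume x: "x \<in> Bad \<epsilon>" and d: "0 < d"
      then have "x \<in> V" using V by (auto simp: Bad_def)
      then obtain d' where d': "d' > 0" "ball x d' \<subseteq> V"
        using V(2) by (meson openE)
      obtain a b where ab: "a \<le> x" "x \<le> b" "a < b" "b - a < min d d'"
        "\<epsilon> * (b - a) < (LINT t:{a..b}|lborel. h t)"
        using x d d' unfolding Bad_def by (force dest: spec[of _ "min d d'"])
      let ?c = "(a + b) / 2" and ?r = "(b - a) / 2"
      have cb: "cball ?c ?r = {a..b}" 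
        by (auto simp: cball_eq_atLeastAtMost field_simps)
      have "(?c, ?r) \<in> K"
      proof -
        have "{a..b} \<subseteq> ball x d'" using ab by (auto simp: dist_real_def)
        then show ?thesis
          using ab d' by (auto simp: K_def cb N_Icc intro!: ennreal_leI) (simp add: algebra_simps)
      qed
      moreover have "x \<in> cball ?c ?r" using ab by (simp add: cb)
      ultimately show "\<exists>i. i \<in> K \<and> x \<in> cball (fst i) (snd i) \<and> snd i < d"
        using ab by (intro exI[of _ "(?c, ?r)"]) auto
    qed
    let ?U = "\<Union>i\<in>C. cball (fst i) (snd i)"
    have dj: "disjoint_family_on (\<lambda>i. cball (fst i) (snd i)) C"
      using dis by (auto simp: disjoint_family_on_def pairwise_def disjnt_def)
    have "emeasure lborel ?U = (\<integral>\<^sup>+i. emeasure lborel (cball (fst i) (snd i)) \<partial>count_space C)"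
      using C dj by (intro emeasure_UN_countable) auto
    also have "\<dots> \<le> (\<integral>\<^sup>+i. ennreal (1/\<epsilon>) * emeasure N (cball (fst i) (snd i)) \<partial>count_space C)"
    proof (rule nn_integral_mono)
      fix i assume "i \<in> space (count_space C)"
      then have i: "0 < snd i" "ennreal (\<epsilon> * (2 * snd i)) \<le> emeasure N (cball (fst i) (snd i))"
        using C by (auto simp: K_def)
      have "emeasure lborel (cball (fst i) (snd i)) = ennreal (1/\<epsilon>) * ennreal (\<epsilon> * (2 * snd i))"
        using i eps by (simp add: cball_eq_atLeastAtMost ennreal_mult[symmetric])
      also have "\<dots> \<le> ennreal (1/\<epsilon>) * emeasure N (cball (fst i) (snd i))"
        using i by (intro mult_left_mono) auto
      finally show "emeasure lborel (cball (fst i) (snd i)) \<le> \<dots>" .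
    qed
    also have "\<dots> = ennreal (1/\<epsilon>) * emeasure N ?U"
      using C dj by (subst emeasure_UN_countable) (auto simp: nn_integral_cmult)
    also have "\<dots> \<le> ennreal (1/\<epsilon>) * emeasure N V"
    proof (intro mult_left_mono emeasure_mono UN_least)
      show "cball (fst i) (snd i) \<subseteq> V" if "i \<in> C" for i
      proof -
        have "i \<in> K" using C that by blast
        then show ?thesis by (simp add: K_def case_prod_beta)
      qed
    qed (use V in auto)
    also have "\<dots> \<le> ennreal (1/\<epsilon>) * ennreal (e * \<epsilon>)"
      using V by (intro mult_left_mono) auto
    also have "\<dots> = ennreal e"
      using e eps by (simp add: ennreal_mult[symmetric])
    finally have U: "emeasure lborel ?U \<le> ennreal e" .
    have Um: "?U \<in> sets borel" using C by (intro sets.countable_UN') auto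
    have UL: "?U \<in> lmeasurable"
      using le_less_trans[OF U ennreal_less_top] Um by (intro fmeasurableI) auto
    let ?T = "?U \<union> (Bad \<epsilon> - ?U)"
    have "measure lebesgue ?T = measure lebesgue ?U"
      by (rule measure_Un_null_set) (use UL cov in \<open>auto simp: negligible_iff_null_sets\<close>)
    also have "\<dots> \<le> e" 
      using U Um e by (simp add: measure_def enn2real_leI)
    finally have "measure lebesgue ?T \<le> e" .
    moreover have "?T \<in> lmeasurable" 
      by (intro fmeasurable.Un UL negligible_imp_measurable cov)
    ultimately show "\<exists>T. Bad \<epsilon> \<subseteq> T \<and> T \<in> lmeasurable \<and> measure lebesgue T \<le> e"
      by (intro exI[of _ ?T]) auto
  qed
  have "negligible (\<Union>k. Bad (1 / real (Suc k)))"
    by (intro negligible_countable_Union) (auto intro: neg)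
  then have "AE x in lebesgue. x \<notin> (\<Union>k. Bad (1 / real (Suc k)))"
    by (intro AE_not_in) (simp add: negligible_iff_null_sets)
  then have "AE x in lborel. x \<notin> (\<Union>k. Bad (1 / real (Suc k)))"
    using AE_completion_iff by blast
  then show ?thesis
  proof (rule AE_mp, intro AE_I2 impI allI)
    fix x \<epsilon> :: real assume x: "x \<notin> (\<Union>k. Bad (1 / real (Suc k)))" and xE: "x \<in> E" and e: "\<epsilon> > 0"
    obtain k where k: "1 / real (Suc k) < \<epsilon>" using nat_approx_posE[OF e] by auto
    have "x \<notin> Bad (1 / real (Suc k))" using x by blast
    then have "\<exists>\<delta>>0. \<forall>a b. a \<le> x \<and> x \<le> b \<and> a < b \<and> b - a < \<delta> \<longrightarrow> 
       \<not> 1 / real (Suc k) * (b - a) < (LINT t:{a..b}|lborel. h t)"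
      using xE unfolding Bad_def mem_Collect_eq by blast
    then obtain \<delta> where d: "\<delta> > 0" and dd: "\<And>a b. a \<le> x \<Longrightarrow> x \<le> b \<Longrightarrow> a < b \<Longrightarrow> b - a < \<delta> \<Longrightarrow> 
       (LINT t:{a..b}|lborel. h t) \<le> 1 / real (Suc k) * (b - a)"
      unfolding not_less by blast
    show "\<exists>\<delta>>0. \<forall>a b. a \<le> x \<and> x \<le> b \<and> a < b \<and> b - a < \<delta> \<longrightarrow>
           (LINT t:{a..b}|lborel. h t) \<le> \<epsilon> * (b - a)"
    proof (intro exI[of _ \<delta>] conjI d allI impI; elim conjE)
      fix a b assume "a \<le> x" "x \<le> b" "a < b" "b - a < \<delta>"
      then have "(LINT t:{a..b}|lborel. h t) \<le> 1 / real (Suc k) * (b - a)" by (rule dd)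
      also have "\<dots> \<le> \<epsilon> * (b - a)" using k \<open>a < b\<close> by (intro mult_right_mono) auto
      finally show "(LINT t:{a..b}|lborel. h t) \<le> \<epsilon> * (b - a)" .
    qed
  qed
qed


text \<open>Compare \<open>g\<close> with rational constants \<open>r\<close>. The function \<open>max 0 (g - r)\<close> vanishes on \<open>{g \<le> r}\<close>,
so at almost every point of that set its averages over shrinking intervals tend to 0, and the
averages of \<open>g\<close> are at most \<open>r\<close> in the limit; \<open>max 0 (r - g)\<close> gives the bound from below.
The averages are over all intervals containing \<open>x\<close>, not only those with \<open>x\<close> as an endpoint:
this form is what the difference quotients over a fixed grid need.\<close>

lemma Lebesgue_differentiation:
  fixes g :: "real \<Rightarrow> real"
  assumes g: "integrable lborel g"
  shows "AE x in lborel. x \<in> {0..1} \<longrightarrow> (\<forall>\<epsilon>>0. \<exists>\<delta>>0. \<forall>a b.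
           0 \<le> a \<and> a \<le> x \<and> x \<le> b \<and> b \<le> 1 \<and> a < b \<and> b - a < \<delta> \<longrightarrow>
           \<bar>(LINT t:{a..b}|lborel. g t) - g x * (b - a)\<bar> \<le> \<epsilon> * (b - a))"
proof -
  have gm [measurable]: "g \<in> borel_measurable borel" 
    using borel_measurable_integrable[OF g] by simp
  define up where "up r t = max 0 (g t - r) * indicator {0..1} t" for r t :: real
  define dn where "dn r t = max 0 (r - g t) * indicator {0..1} t" for r t :: real
  have const: "integrable lborel (\<lambda>t. r * indicator {0..1::real} t)" for r :: real
    by simp
  have [measurable]: "up r \<in> borel_measurable borel" "dn r \<in> borel_measurable borel" for r
    unfolding up_def[abs_def] dn_def[abs_def] by measurable
  have up_int: "integrable lborel (up r)" for r
  proof (rule Bochner_Integration.integrable_bound)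
    show "integrable lborel (\<lambda>t. \<bar>g t\<bar> + \<bar>r\<bar> * indicator {0..1} t)"
      using g const by (intro Bochner_Integration.integrable_add integrable_abs)
  qed (auto simp: up_def indicator_def)
  have dn_int: "integrable lborel (dn r)" for r
  proof (rule Bochner_Integration.integrable_bound)
    show "integrable lborel (\<lambda>t. \<bar>g t\<bar> + \<bar>r\<bar> * indicator {0..1} t)"
      using g const by (intro Bochner_Integration.integrable_add integrable_abs)
  qed (auto simp: dn_def indicator_def)
  have "AE x in lborel. \<forall>r\<in>\<rat>. x \<in> {x. g x \<le> r} \<longrightarrow> (\<forall>\<epsilon>>0. \<exists>\<delta>>0. \<forall>a b. a \<le> x \<and> x \<le> b \<and> a < b \<and> b - a < \<delta> \<longrightarrow>
           (LINT t:{a..b}|lborel. up r t) \<le> \<epsilon> * (b - a))"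
    by (intro AE_ball_countable' AE_small_density_quotient up_int countable_rat)
      (auto simp: up_def)
  moreover have "AE x in lborel. \<forall>r\<in>\<rat>. x \<in> {x. r \<le> g x} \<longrightarrow> (\<forall>\<epsilon>>0. \<exists>\<delta>>0. \<forall>a b. a \<le> x \<and> x \<le> b \<and> a < b \<and> b - a < \<delta> \<longrightarrow>
           (LINT t:{a..b}|lborel. dn r t) \<le> \<epsilon> * (b - a))"
    by (intro AE_ball_countable' AE_small_density_quotient dn_int countable_rat)
      (auto simp: dn_def)
  ultimately show ?thesis
  proof eventually_elim
    case (elim x)
    show ?case
    proof (intro allI impI)
      fix \<epsilon> :: real assume x: "x \<in> {0..1}" and e: "\<epsilon> > 0"
      obtain r where r: "r \<in> \<rat>" "g x < r" "r < g x + \<epsilon> / 2"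
        using Rats_dense_in_real[of "g x" "g x + \<epsilon> / 2"] e by auto
      obtain q where q: "q \<in> \<rat>" "g x - \<epsilon> / 2 < q" "q < g x"
        using Rats_dense_in_real[of "g x - \<epsilon> / 2" "g x"] e by auto
      have "\<exists>\<delta>>0. \<forall>a b. a \<le> x \<and> x \<le> b \<and> a < b \<and> b - a < \<delta> \<longrightarrow>
           (LINT t:{a..b}|lborel. up r t) \<le> \<epsilon> / 2 * (b - a)"
        by (rule elim(1)[rule_format]) (use r e in auto)
      then obtain d1 where d1: "d1 > 0" "\<And>a b. a \<le> x \<Longrightarrow> x \<le> b \<Longrightarrow> a < b \<Longrightarrow> b - a < d1 \<Longrightarrow>
           (LINT t:{a..b}|lborel. up r t) \<le> \<epsilon> / 2 * (b - a)" by blast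
      have "\<exists>\<delta>>0. \<forall>a b. a \<le> x \<and> x \<le> b \<and> a < b \<and> b - a < \<delta> \<longrightarrow>
           (LINT t:{a..b}|lborel. dn q t) \<le> \<epsilon> / 2 * (b - a)"
        by (rule elim(2)[rule_format]) (use q e in auto)
      then obtain d2 where d2: "d2 > 0" "\<And>a b. a \<le> x \<Longrightarrow> x \<le> b \<Longrightarrow> a < b \<Longrightarrow> b - a < d2 \<Longrightarrow>
           (LINT t:{a..b}|lborel. dn q t) \<le> \<epsilon> / 2 * (b - a)" by blast
      show "\<exists>\<delta>>0. \<forall>a b. 0 \<le> a \<and> a \<le> x \<and> x \<le> b \<and> b \<le> 1 \<and> a < b \<and> b - a < \<delta> \<longrightarrow>
           \<bar>(LINT t:{a..b}|lborel. g t) - g x * (b - a)\<bar> \<le> \<epsilon> * (b - a)"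
      proof (intro exI[of _ "min d1 d2"] conjI allI impI; (elim conjE)?)
        show "0 < min d1 d2" using d1 d2 by simp
        fix a b assume ab: "0 \<le> a" "a \<le> x" "x \<le> b" "b \<le> 1" "a < b" "b - a < min d1 d2"
        have si: "set_integrable lborel {a..b} k" if "integrable lborel k" for k :: "real \<Rightarrow> real"
          unfolding set_integrable_def using that by (intro integrable_mult_indicator) auto
        have sc: "set_integrable lborel {a..b} (\<lambda>t. c)" for c :: real
          unfolding set_integrable_def using integrable_real_indicator[of "{a..b}" lborel] ab by simp
        have ic: "(LINT t:{a..b}|lborel. c) = c * (b - a)" for c :: real
          using ab by (simp add: set_lebesgue_integral_def)
        have "(LINT t:{a..b}|lborel. g t) \<le> (LINT t:{a..b}|lborel. r + up r t)"
          by (rule set_integral_mono[OF si[OF g] set_integral_add(1)[OF sc si[OF up_int]]])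
            (use ab in \<open>auto simp: up_def\<close>)
        also have "\<dots> = r * (b - a) + (LINT t:{a..b}|lborel. up r t)"
          by (simp add: set_integral_add(2)[OF sc si[OF up_int]] ic)
        also have "\<dots> \<le> r * (b - a) + \<epsilon> / 2 * (b - a)"
          using d1(2)[of a b] ab by simp
        also have "\<dots> = (r + \<epsilon> / 2) * (b - a)" by (simp add: algebra_simps)
        also have "\<dots> \<le> (g x + \<epsilon>) * (b - a)"
          using r ab by (intro mult_right_mono) auto
        finally have 1: "(LINT t:{a..b}|lborel. g t) \<le> (g x + \<epsilon>) * (b - a)" .
        have "(g x - \<epsilon>) * (b - a) \<le> (q - \<epsilon> / 2) * (b - a)"
          using q ab by (intro mult_right_mono) auto
        also have "\<dots> = q * (b - a) - \<epsilon> / 2 * (b - a)" by (simp add: algebra_simps)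
        also have "\<dots> \<le> q * (b - a) - (LINT t:{a..b}|lborel. dn q t)"
          using d2(2)[of a b] ab by simp
        also have "\<dots> = (LINT t:{a..b}|lborel. q - dn q t)"
          by (simp add: set_integral_diff(2)[OF sc si[OF dn_int]] ic)
        also have "\<dots> \<le> (LINT t:{a..b}|lborel. g t)"
          by (rule set_integral_mono[OF set_integral_diff(1)[OF sc si[OF dn_int]] si[OF g]])
            (use ab in \<open>auto simp: dn_def\<close>)
        finally have 2: "(g x - \<epsilon>) * (b - a) \<le> (LINT t:{a..b}|lborel. g t)" .
        from 1 2 show "\<bar>(LINT t:{a..b}|lborel. g t) - g x * (b - a)\<bar> \<le> \<epsilon> * (b - a)"
          by (simp add: algebra_simps abs_le_iff)
      qed
    qed
  qed
qed

text \<open>A nonnegative function \<open>g\<close> whose indefinite integral is \<open>f\<close> on the unit interval. By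
\<open>Lebesgue_differentiation\<close> such a \<open>g\<close> is almost everywhere the derivative of \<open>f\<close>, so it serves
as a Borel measurable version of \<open>f'\<close>, everywhere defined.\<close>

definition ac_derivative :: "(real \<Rightarrow> real) \<Rightarrow> (real \<Rightarrow> real) \<Rightarrow> bool" where
  "ac_derivative f g \<longleftrightarrow> integrable lborel g \<and> (\<forall>x. 0 \<le> g x) \<and>
     (\<forall>a b. 0 \<le> a \<and> a \<le> b \<and> b \<le> 1 \<longrightarrow> (LINT t:{a..b}|lborel. g t) = f b - f a)"

lemma abs_cont_on_imp_continuous_on:
  fixes f :: "real \<Rightarrow> 'a::metric_space"
  assumes "abs_cont_on {0..1} f"
  shows "continuous_on {0..1} f"
  unfolding continuous_on_iff
proof (intro ballI allI impI)
  fix x e :: real assume x: "x \<in> {0..1}" and e: "e > 0"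
  obtain d where d: "d > 0" "\<And>D T. D division_of T \<Longrightarrow> T \<subseteq> {0..1} \<Longrightarrow> (\<Sum>K\<in>D. Sup K - Inf K) < d \<Longrightarrow>
     (\<Sum>K\<in>D. dist (f (Inf K)) (f (Sup K))) < e"
    using assms e unfolding abs_cont_on_def by metis
  have *: "dist (f a) (f b) < e" if "0 \<le> a" "a \<le> b" "b \<le> 1" "b - a < d" for a b
    using d(2)[of "{cbox a b}" "cbox a b"] that division_of_self[of a b]
    by (auto simp: box_ne_empty)
  show "\<exists>d>0. \<forall>x'\<in>{0..1}. dist x' x < d \<longrightarrow> dist (f x') (f x) < e"
  proof (intro exI[of _ d] conjI d(1) ballI impI)
    fix y assume y: "y \<in> {0..1}" "dist y x < d"
    show "dist (f y) (f x) < e"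
      using *[of x y] *[of y x] x y by (cases "x \<le> y") (auto simp: dist_real_def dist_commute)
  qed
qed

text \<open>The Stieltjes measure of \<open>f\<close> is absolutely continuous with respect to Lebesgue measure, and its
Radon-Nikodym density is the required function. To see the absolute continuity, cover a null set by
an open set of small measure. By inner regularity it is enough to bound the mass of its
compact subsets; each of them is covered by a finite division inside the open set,
and this is the situation to which \<open>abs_cont_on\<close> applies.\<close>

lemma mono_abs_cont_has_ac_derivative:
  assumes mono: "mono_on {0..1} f" and ac: "abs_cont_on {0..1} f"
  shows "\<exists>g. ac_derivative f g"
proof -
  have cont: "continuous_on {0..1} f" using abs_cont_on_imp_continuous_on[OF ac] .
  define F where "F x = f (max 0 (min 1 x))" for x
  have F_I: "F x = f x" if "0 \<le> x" "x \<le> 1" for x using that by (simp add: F_def)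
  have F_mono: "F x \<le> F y" if "x \<le> y" for x y
    unfolding F_def using that by (intro mono_onD[OF mono]) auto
  have F_cont: "continuous_on UNIV F"
    unfolding F_def by (intro continuous_on_compose2[OF cont] continuous_intros) auto
  have F_rc: "continuous (at_right a) F" for a
    using F_cont by (auto intro: continuous_within_subset simp: continuous_on_eq_continuous_within)
  note Icc = emeasure_interval_measure_Icc[OF _ F_mono F_cont]
  \<comment> \<open>Restricting to the unit interval makes the measure finite, as inner regularity requires.\<close>
  define N where "N = density (interval_measure F) (indicator {0..1})"
  have setsN [simp, measurable_cong]: "sets N = sets borel" by (simp add: N_def)
  have N_eq: "emeasure N A = emeasure (interval_measure F) ({0..1} \<inter> A)" if "A \<in> sets borel" for A
    using that unfolding N_def
    by (subst emeasure_density) (auto simp: indicator_inter_arith[symmetric])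
  have N_Icc: "emeasure N {a..b} = ennreal (f b - f a)" if "0 \<le> a" "a \<le> b" "b \<le> 1" for a b
    using that by (simp add: N_eq Icc F_I)
  have fin: "emeasure N (space N) \<noteq> \<infinity>"
  proof -
    have "space N = UNIV" by (simp add: N_def)
    then show ?thesis using N_eq[of UNIV] Icc[of 0 1] by simp
  qed
  have N_split: "emeasure N V = emeasure N (V \<inter> {0<..<1})" if "open V" for V
  proof -
    have null: "{0, 1} \<in> null_sets N"
    proof -
      have "{0} \<in> null_sets N" using N_Icc[of 0 0] by (auto simp: null_sets_def)
      moreover have "{1} \<in> null_sets N" using N_Icc[of 1 1] by (auto simp: null_sets_def)
      ultimately have "{0} \<union> {1} \<in> null_sets N" by (rule null_sets.Un)
      then show ?thesis by (simp add: insert_commute)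
    qed
    have "emeasure N V = emeasure N ({0..1} \<inter> V)"
      using that by (simp add: N_eq)
    also have "\<dots> \<le> emeasure N (V \<inter> {0<..<1} \<union> {0, 1})"
      using that by (intro emeasure_mono) auto
    also have "\<dots> = emeasure N (V \<inter> {0<..<1})"
      using that null by (intro emeasure_Un_null_set) auto
    finally have le: "emeasure N V \<le> emeasure N (V \<inter> {0<..<1})" .
    show ?thesis by (rule antisym[OF le emeasure_mono]) (use that in auto)
  qed
  have "absolutely_continuous lborel N"
    unfolding absolutely_continuous_def
  proof
    fix A assume A: "A \<in> null_sets (lborel :: real measure)"
    then have Ab: "A \<in> sets borel" by auto
    have small: "emeasure N A \<le> ennreal e" if e: "e > 0" for e
    proof -
      obtain d where d: "d > 0" "\<And>D T. D division_of T \<Longrightarrow> T \<subseteq> {0..1} \<Longrightarrow> (\<Sum>K\<in>D. Sup K - Inf K) < d \<Longrightarrow>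
         (\<Sum>K\<in>D. dist (f (Inf K)) (f (Sup K))) < e"
        using ac e unfolding abs_cont_on_def by metis
      obtain V where V: "open V" "A \<subseteq> V" "emeasure lborel (V - A) < d"
        using outer_regular_lborel[OF Ab d(1)] by blast
      have Vd: "emeasure lborel V < d"
        using V A by (simp add: emeasure_Diff_null_set)
      define W where "W = V \<inter> {0<..<1}"
      have W: "open W" using V by (auto simp: W_def)
      have Wd: "emeasure lborel W < d"
        using emeasure_mono[of W V lborel] V Vd by (auto simp: W_def)
      have K: "emeasure N K \<le> ennreal e" if K: "K \<subseteq> W" "compact K" for K
      proof -
        have "\<forall>x\<in>K. \<exists>a b. x \<in> box a b \<and> cbox a b \<subseteq> W"
          using K W by (meson open_contains_cbox subsetD)
        then obtain l u where lu: "\<And>x. x \<in> K \<Longrightarrow> x \<in> box (l x) (u x)" "\<And>x. x \<in> K \<Longrightarrow> cbox (l x) (u x) \<subseteq> W"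
          by metis
        obtain Q where Q: "Q \<subseteq> K" "finite Q" "K \<subseteq> (\<Union>x\<in>Q. box (l x) (u x))"
          by (rule compactE_image[OF K(2), of K "\<lambda>x. box (l x) (u x)"]) (use lu in blast)+
        obtain p where p: "p division_of (\<Union>((\<lambda>x. cbox (l x) (u x)) ` Q))"
          using elementary_unions_intervals[of "(\<lambda>x. cbox (l x) (u x)) ` Q"] Q(2) by blast
        let ?S = "\<Union>((\<lambda>x. cbox (l x) (u x)) ` Q)"
        have SW: "?S \<subseteq> W" using lu Q by blast
        have pI: "\<exists>a b. k = {a..b} \<and> 0 \<le> a \<and> a \<le> b \<and> b \<le> 1" if kp: "k \<in> p" for k
        proof -
          obtain a b where kab: "k = cbox a b" "k \<noteq> {}" "k \<subseteq> ?S"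
            using division_ofD(2,3,4)[OF p kp] by metis
          moreover from this have "k \<subseteq> W" "a \<in> k" "b \<in> k" using SW by (blast, auto)
          ultimately have "a \<le> b" "a \<in> W" "b \<in> W" by auto
          with kab(1) show ?thesis by (auto simp: W_def intro!: exI[of _ a] exI[of _ b])
        qed
        have "(\<Sum>k\<in>p. Sup k - Inf k) = (\<Sum>k\<in>p. measure lebesgue k)"
          by (rule sum.cong) (use pI in force)+
        also have "\<dots> = measure lebesgue ?S" using content_division[OF p] .
        also have "\<dots> < d"
        proof -
          have "emeasure lborel ?S \<le> emeasure lborel W"
            using SW W by (intro emeasure_mono) auto
          then have "emeasure lborel ?S < ennreal d" using Wd by simp
          moreover have "?S \<in> sets borel" using Q by (intro borel_closed closed_UN) auto
          moreover have "enn2real x < d" if "x < ennreal d" for x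
            using that by (cases x) (auto simp: ennreal_less_iff)
          ultimately show ?thesis by (simp add: measure_def)
        qed
        finally have "(\<Sum>k\<in>p. dist (f (Inf k)) (f (Sup k))) < e"
        proof (rule d(2)[OF p, rotated])
          have "W \<subseteq> {0..1}" by (auto simp: W_def)
          then show "?S \<subseteq> {0..1}" using SW by (rule order_trans[rotated])
        qed
        then have lt0: "(\<Sum>k\<in>p. dist (f (Inf k)) (f (Sup k))) < e" .
        have *: "dist (f (Inf k)) (f (Sup k)) = f (Sup k) - f (Inf k)" 
          "emeasure N k = ennreal (f (Sup k) - f (Inf k))" "0 \<le> f (Sup k) - f (Inf k)" if kp: "k \<in> p" for k
        proof -
          obtain a b where ab: "k = {a..b}" "0 \<le> a" "a \<le> b" "b \<le> 1" using pI[OF kp] by blast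
          have "f a \<le> f b" using ab by (intro mono_onD[OF mono]) auto
          then show "dist (f (Inf k)) (f (Sup k)) = f (Sup k) - f (Inf k)"
            "emeasure N k = ennreal (f (Sup k) - f (Inf k))" "0 \<le> f (Sup k) - f (Inf k)"
            using ab by (auto simp: dist_real_def N_Icc)
        qed
        have lt: "(\<Sum>k\<in>p. f (Sup k) - f (Inf k)) < e"
          using lt0 by (simp add: *(1) cong: sum.cong)
        have "(\<Sum>k\<in>p. emeasure N k) = (\<Sum>k\<in>p. ennreal (f (Sup k) - f (Inf k)))"
          by (intro sum.cong) (auto simp: *(2))
        also have "\<dots> = ennreal (\<Sum>k\<in>p. f (Sup k) - f (Inf k))"
          by (rule sum_ennreal) (rule *(3))
        finally have eq: "(\<Sum>k\<in>p. emeasure N k) = ennreal (\<Sum>k\<in>p. f (Sup k) - f (Inf k))" .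
        have p_sets: "k \<in> sets N" if "k \<in> p" for k using pI[OF that] by auto
        have "K \<subseteq> ?S" using Q(3) box_subset_cbox by blast
        then have "K \<subseteq> \<Union>p" using division_ofD(6)[OF p] by simp
        then have "emeasure N K \<le> emeasure N (\<Union>p)"
          using division_ofD(1)[OF p] p_sets by (intro emeasure_mono sets.finite_Union) auto
        also have "\<dots> \<le> (\<Sum>k\<in>p. emeasure N k)"
          using emeasure_subadditive_finite[of p "\<lambda>k. k" N] division_ofD(1)[OF p] p_sets by auto
        also have "\<dots> \<le> ennreal e" unfolding eq using lt by (intro ennreal_leI) auto
        finally show ?thesis .
      qed
      have "emeasure N A \<le> emeasure N V" using V by (intro emeasure_mono) auto
      also have "\<dots> = emeasure N W" using N_split[OF V(1)] by (simp add: W_def)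
      also have "\<dots> = (SUP K \<in> {K. K \<subseteq> W \<and> compact K}. emeasure N K)"
        using fin W by (intro inner_regular) auto
      also have "\<dots> \<le> ennreal e" using K by (intro SUP_least) auto
      finally show ?thesis .
    qed
    have "emeasure N A \<le> 0"
    proof (rule ennreal_le_epsilon)
      fix e :: real assume "0 < e" then show "emeasure N A \<le> 0 + ennreal e" using small by simp
    qed
    then show "A \<in> null_sets N" using Ab by (auto simp: null_sets_def)
  qed
  then obtain h where h: "h \<in> borel_measurable lborel" "density lborel h = N"
    using sigma_finite_measure.Radon_Nikodym[OF sigma_finite_lborel, of N] by auto
  have h_Icc: "(\<integral>\<^sup>+x. h x * indicator {a..b} x \<partial>lborel) = ennreal (f b - f a)" if "0 \<le> a" "a \<le> b" "b \<le> 1" for a b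
    using emeasure_density[OF h(1), of "{a..b}"] N_Icc[OF that] h(2) by simp
  define g where "g x = enn2real (h x * indicator {0..1} x)" for x
  have gm: "g \<in> borel_measurable lborel" unfolding g_def using h(1) by simp
  have "AE x in lborel. h x * indicator {0..1} x \<noteq> \<infinity>"
    using h_Icc[of 0 1] h(1) by (intro nn_integral_noteq_infinite) auto
  then have gh: "AE x in lborel. ennreal (g x) = h x * indicator {0..1} x"
    by eventually_elim (auto simp: g_def less_top)
  have g_Icc: "(\<integral>\<^sup>+x. ennreal (g x * indicator {a..b} x) \<partial>lborel) = ennreal (f b - f a)" if "0 \<le> a" "a \<le> b" "b \<le> 1" for a b
  proof -
    have "(\<integral>\<^sup>+x. ennreal (g x * indicator {a..b} x) \<partial>lborel) = (\<integral>\<^sup>+x. h x * indicator {a..b} x \<partial>lborel)"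
    proof (rule nn_integral_cong_AE)
      from gh show "AE x in lborel. ennreal (g x * indicator {a..b} x) = h x * indicator {a..b} x"
        by eventually_elim (use that in \<open>auto simp: indicator_def split: if_splits\<close>)
    qed
    then show ?thesis using h_Icc[OF that] by simp
  qed
  have gnn: "0 \<le> g x" for x by (simp add: g_def)
  have gout: "g x = g x * indicator {0..1} x" for x by (auto simp: g_def indicator_def)
  have "(\<integral>\<^sup>+x. ennreal (g x) \<partial>lborel) < \<infinity>"
    using g_Icc[of 0 1] gout by simp
  then have gi: "integrable lborel g"
    using gm gnn by (auto simp: integrable_iff_bounded)
  have "ac_derivative f g"
    unfolding ac_derivative_def
  proof (intro conjI allI impI gi gnn)
    fix a b :: real assume ab: "0 \<le> a \<and> a \<le> b \<and> b \<le> 1"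
    have "f a \<le> f b" using ab by (intro mono_onD[OF mono]) auto
    then show "(LINT t:{a..b}|lborel. g t) = f b - f a"
      using g_Icc[of a b] ab gnn gm unfolding set_lebesgue_integral_def
      by (subst integral_eq_nn_integral) (auto simp: mult.commute)
  qed
  then show ?thesis by blast
qed

lemma ac_derivative_interval:
  assumes "ac_derivative f g"
  shows "AE x in lborel. x \<in> {0..1} \<longrightarrow> (\<forall>\<epsilon>>0. \<exists>\<delta>>0. \<forall>a b.
           0 \<le> a \<and> a \<le> x \<and> x \<le> b \<and> b \<le> 1 \<and> a < b \<and> b - a < \<delta> \<longrightarrow>
           \<bar>f b - f a - g x * (b - a)\<bar> \<le> \<epsilon> * (b - a))"
proof -
  have "integrable lborel g" and eq: "\<And>a b. 0 \<le> a \<Longrightarrow> a \<le> b \<Longrightarrow> b \<le> 1 \<Longrightarrow> (LINT t:{a..b}|lborel. g t) = f b - f a"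
    using assms by (auto simp: ac_derivative_def)
  from Lebesgue_differentiation[OF this(1)] show ?thesis
    by eventually_elim (simp add: eq cong: conj_cong)
qed

lemma ac_derivative_has_derivative:
  assumes "ac_derivative f g"
  shows "AE x in lborel. x \<in> {0..1} \<longrightarrow> (f has_real_derivative g x) (at x within {0..1})"
  using ac_derivative_interval[OF assms]
proof eventually_elim
  case (elim x)
  show ?case
  proof
    assume x: "x \<in> {0..1}"
    show "(f has_real_derivative g x) (at x within {0..1})"
      unfolding has_field_derivative_def has_derivative_within_alt
    proof (intro conjI allI impI)
      show "bounded_linear ((*) (g x))" by (rule bounded_linear_mult_right)
      fix e :: real assume "e > 0"
      then obtain d where d: "d > 0" "\<And>a b. 0 \<le> a \<Longrightarrow> a \<le> x \<Longrightarrow> x \<le> b \<Longrightarrow> b \<le> 1 \<Longrightarrow> a < b \<Longrightarrow> b - a < d \<Longrightarrow>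
           \<bar>f b - f a - g x * (b - a)\<bar> \<le> e * (b - a)"
        using elim x by meson
      have "norm (f y - f x - g x * (y - x)) \<le> e * norm (y - x)" if y: "y \<in> {0..1}" "norm (y - x) < d" for y
      proof (cases "x < y")
        case True
        then show ?thesis using d(2)[of x y] x y by auto
      next
        case False
        show ?thesis
        proof (cases "y = x")
          case False
          with \<open>\<not> x < y\<close> have "\<bar>f x - f y - g x * (x - y)\<bar> \<le> e * (x - y)"
            using d(2)[of y x] x y by auto
          then show ?thesis using \<open>\<not> x < y\<close> by (simp add: abs_le_iff algebra_simps)
        qed simp
      qed
      then show "\<exists>d>0. \<forall>y\<in>{0..1}. norm (y - x) < d \<longrightarrow> norm (f y - f x - g x * (y - x)) \<le> e * norm (y - x)"
        using d(1) by blast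
    qed
  qed
qed

lemma ac_derivative_integrable: "ac_derivative f g \<Longrightarrow> integrable lborel g"
  and ac_derivative_nonneg: "ac_derivative f g \<Longrightarrow> 0 \<le> g x"
  and ac_derivative_integral: "ac_derivative f g \<Longrightarrow> 0 \<le> a \<Longrightarrow> a \<le> b \<Longrightarrow> b \<le> 1 \<Longrightarrow>
        (LINT t:{a..b}|lborel. g t) = f b - f a"
  by (auto simp: ac_derivative_def)

lemma ac_derivative_measurable [measurable_dest]: "ac_derivative f g \<Longrightarrow> g \<in> borel_measurable borel"
  using borel_measurable_integrable[OF ac_derivative_integrable] by simp

lemma set_integrable_lborel:
  fixes f :: "real \<Rightarrow> 'a::{banach, second_countable_topology}"
  assumes "integrable lborel f"
  shows "set_integrable lborel {a..b} f"
  unfolding set_integrable_def using assms by (intro integrable_mult_indicator) auto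

section \<open>Reparametrisations\<close>

text \<open>The composition is taken in this order because absolute continuity is not preserved by arbitrary
composition, whereas a Lipschitz outer function only rescales the sums.\<close>

lemma abs_cont_on_lipschitz_compose:
  fixes \<beta> :: "real \<Rightarrow> 'a::metric_space" and F :: "'a \<Rightarrow> 'b::metric_space"
  assumes ac: "abs_cont_on {0..1} \<beta>" and lip: "L-lipschitz_on S F" and im: "\<beta> ` {0..1} \<subseteq> S"
  shows "abs_cont_on {0..1} (F \<circ> \<beta>)"
  unfolding abs_cont_on_def
proof (intro allI impI)
  fix e :: real assume e: "e > 0"
  have L: "0 \<le> L" using lip by (rule lipschitz_on_nonneg)
  then have e': "e / (L + 1) > 0" using e by simp
  obtain d where d: "d > 0" "\<And>D T. D division_of T \<Longrightarrow> T \<subseteq> {0..1} \<Longrightarrow> (\<Sum>K\<in>D. Sup K - Inf K) < d \<Longrightarrow>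
     (\<Sum>K\<in>D. dist (\<beta> (Inf K)) (\<beta> (Sup K))) < e / (L + 1)"
    using ac e' unfolding abs_cont_on_def by metis
  show "\<exists>\<delta>>0. \<forall>D T. D division_of T \<and> T \<subseteq> {0..1} \<and> (\<Sum>K\<in>D. Sup K - Inf K) < \<delta> \<longrightarrow>
          (\<Sum>K\<in>D. dist ((F \<circ> \<beta>) (Inf K)) ((F \<circ> \<beta>) (Sup K))) < e"
  proof (intro exI[of _ d] conjI d(1) allI impI; elim conjE)
    fix D and T :: "real set" assume D: "D division_of T" "T \<subseteq> {0..1}" "(\<Sum>K\<in>D. Sup K - Inf K) < d"
    have "(\<Sum>K\<in>D. dist ((F \<circ> \<beta>) (Inf K)) ((F \<circ> \<beta>) (Sup K))) \<le> (\<Sum>K\<in>D. (L + 1) * dist (\<beta> (Inf K)) (\<beta> (Sup K)))"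
    proof (rule sum_mono)
      fix K assume K: "K \<in> D"
      obtain a b where "K = cbox a b" "K \<noteq> {}" "K \<subseteq> T"
        using division_ofD(2,3,4)[OF D(1) K] by metis
      moreover from this have "K \<subseteq> {0..1}" using D(2) by blast
      ultimately have "Inf K \<in> K" "Sup K \<in> K" "K \<subseteq> {0..1}" by auto
      then have "\<beta> (Inf K) \<in> S" "\<beta> (Sup K) \<in> S" using im by auto
      then have "dist (F (\<beta> (Inf K))) (F (\<beta> (Sup K))) \<le> L * dist (\<beta> (Inf K)) (\<beta> (Sup K))"
        using lip by (auto dest: lipschitz_onD)
      also have "\<dots> \<le> (L + 1) * dist (\<beta> (Inf K)) (\<beta> (Sup K))" by (intro mult_right_mono) auto
      finally show "dist ((F \<circ> \<beta>) (Inf K)) ((F \<circ> \<beta>) (Sup K)) \<le> \<dots>" by simp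
    qed
    also have "\<dots> < e"
      using d(2)[OF D] L by (simp add: sum_distrib_left[symmetric] pos_less_divide_eq mult.commute)
    finally show "(\<Sum>K\<in>D. dist ((F \<circ> \<beta>) (Inf K)) ((F \<circ> \<beta>) (Sup K))) < e" .
  qed
qed

lemma Gamma_barD:
  assumes "\<beta> \<in> Gamma_bar"
  shows Gamma_bar_mono: "mono_on {0..1} \<beta>" and Gamma_bar_ac: "abs_cont_on {0..1} \<beta>"
    and Gamma_bar_0: "\<beta> 0 = 0" and Gamma_bar_1: "\<beta> 1 = 1"
    and Gamma_bar_image: "\<beta> ` {0..1} = {0..1}"
    and Gamma_bar_range: "\<And>t. 0 \<le> t \<Longrightarrow> t \<le> 1 \<Longrightarrow> 0 \<le> \<beta> t \<and> \<beta> t \<le> 1"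
    and Gamma_bar_continuous: "continuous_on {0..1} \<beta>"
proof -
  show m: "mono_on {0..1} \<beta>" and ac: "abs_cont_on {0..1} \<beta>" and im: "\<beta> ` {0..1} = {0..1}"
    using assms by (auto simp: Gamma_bar_def)
  then show "continuous_on {0..1} \<beta>" by (intro abs_cont_on_imp_continuous_on)
  show r: "0 \<le> \<beta> t \<and> \<beta> t \<le> 1" if "0 \<le> t" "t \<le> 1" for t
  proof -
    have "\<beta> t \<in> \<beta> ` {0..1}" using that by auto
    then show ?thesis by (simp add: im)
  qed
  obtain s where "s \<in> {0..1}" "\<beta> s = 0" using im by (metis imageE atLeastAtMost_iff order_refl zero_le_one)
  then have "\<beta> 0 \<le> 0" using mono_onD[OF m, of 0 s] by auto
  then show "\<beta> 0 = 0" using r[of 0] by auto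
  obtain s where "s \<in> {0..1}" "\<beta> s = 1" using im by (metis imageE atLeastAtMost_iff order_refl zero_le_one)
  then have "1 \<le> \<beta> 1" using mono_onD[OF m, of s 1] by auto
  then show "\<beta> 1 = 1" using r[of 1] by auto
qed

lemma Gamma_barI:
  assumes m: "mono_on {0..1} \<beta>" and lip: "L-lipschitz_on {0..1} \<beta>" and 0: "\<beta> 0 = 0" and 1: "\<beta> 1 = 1"
  shows "\<beta> \<in> Gamma_bar"
proof -
  have "abs_cont_on {0..1} (id :: real \<Rightarrow> real)" using Gamma_bar_ac[OF id_in_Gamma_bar] .
  from abs_cont_on_lipschitz_compose[OF this lip] have ac: "abs_cont_on {0..1} \<beta>" by simp
  have "{0..1} \<subseteq> \<beta> ` {0..1}"
  proof
    fix y :: real assume "y \<in> {0..1}"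
    then show "y \<in> \<beta> ` {0..1}"
      using IVT'[of \<beta> 0 y 1] 0 1 abs_cont_on_imp_continuous_on[OF ac] by force
  qed
  moreover have "\<beta> ` {0..1} \<subseteq> {0..1}"
    using mono_onD[OF m, of 0] mono_onD[OF m, of _ 1] 0 1 by auto
  ultimately show ?thesis using m ac by (auto simp: Gamma_bar_def)
qed

lemma Gamma_bar_compose_ac_derivative:
  assumes \<beta>: "\<beta> \<in> Gamma_bar" and m: "mono_on {0..1} F" and lip: "L-lipschitz_on {0..1} F"
  shows "\<exists>g. ac_derivative (F \<circ> \<beta>) g"
proof (rule mono_abs_cont_has_ac_derivative)
  show "mono_on {0..1} (F \<circ> \<beta>)"
    using Gamma_bar_range[OF \<beta>] mono_onD[OF Gamma_bar_mono[OF \<beta>]]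
    by (intro mono_onI) (auto intro!: mono_onD[OF m])
  show "abs_cont_on {0..1} (F \<circ> \<beta>)"
    using Gamma_bar_image[OF \<beta>] by (intro abs_cont_on_lipschitz_compose[OF Gamma_bar_ac[OF \<beta>] lip]) auto
qed

lemma Gamma_bar_ac_derivative:
  assumes \<beta>: "\<beta> \<in> Gamma_bar"
  shows "\<exists>g. ac_derivative \<beta> g"
  using mono_abs_cont_has_ac_derivative[OF Gamma_bar_mono[OF \<beta>] Gamma_bar_ac[OF \<beta>]] .

lemma unit_interval_nontrivial: "t \<in> {0..1} \<Longrightarrow> at t within {0..1::real} \<noteq> bot"
  by (simp add: trivial_limit_within islimpt_Icc)

lemma derivative_unique_unit_interval:
  fixes f :: "real \<Rightarrow> real"
  assumes "(f has_real_derivative x) (at t within {0..1})" "(f has_real_derivative y) (at t within {0..1})"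
    and "t \<in> {0..1}"
  shows "x = y"
  using vector_derivative_unique_within[OF unit_interval_nontrivial[OF assms(3)], of f x y] assms(1,2)
  by (simp add: has_real_derivative_iff_has_vector_derivative)

section \<open>Square root velocities\<close>

text \<open>The pointwise map \<open>v \<mapsto> v / sqrt |v|\<close>, so that \<open>srv c\<close> is \<open>sqrt_vec\<close> of the derivative of \<open>c\<close>. Its
homogeneity of degree 1/2 is the reason why reparametrisation acts isometrically.\<close>

definition sqrt_vec :: "'a::real_normed_vector \<Rightarrow> 'a" where
  "sqrt_vec v = (if v = 0 then 0 else v /\<^sub>R sqrt (norm v))"

lemma srv_eq_sqrt_vec:
  assumes "(c has_vector_derivative v) (at t within {0..1})" "t \<in> {0..1}"
  shows "srv c t = sqrt_vec v"
  using vector_derivative_within_cbox[of 0 1 t c v] assms by (simp add: srv_def sqrt_vec_def)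

lemma norm_sqrt_vec: "norm (sqrt_vec v) = sqrt (norm v)"
  by (simp add: sqrt_vec_def real_div_sqrt divide_inverse_commute[symmetric])

lemma sqrt_vec_scaleR:
  assumes "0 \<le> p"
  shows "sqrt_vec (p *\<^sub>R v) = sqrt p *\<^sub>R sqrt_vec v"
proof (cases "p = 0 \<or> v = 0")
  case False
  then have "p > 0" using assms by auto
  moreover have "p / sqrt p = sqrt p" using real_div_sqrt[of p] assms by simp
  ultimately show ?thesis using False
    by (auto simp: sqrt_vec_def real_sqrt_mult field_simps)
qed (auto simp: sqrt_vec_def)

lemma continuous_sqrt_vec: "continuous_on UNIV (sqrt_vec :: 'a::real_normed_vector \<Rightarrow> 'a)"
proof -
  have "isCont sqrt_vec v" for v :: 'a
  proof (cases "v = 0")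
    case True
    have "((\<lambda>x::'a. norm (sqrt_vec x)) \<longlongrightarrow> sqrt (norm (0::'a))) (at 0)"
      unfolding norm_sqrt_vec by (intro tendsto_intros)
    then have "((sqrt_vec :: 'a \<Rightarrow> 'a) \<longlongrightarrow> 0) (at 0)"
      by (simp add: tendsto_norm_zero_iff)
    then show ?thesis using True by (simp add: isCont_def sqrt_vec_def[of 0])
  next
    case False
    have "isCont (\<lambda>x::'a. x /\<^sub>R sqrt (norm x)) v"
      using False by (intro continuous_intros) auto
    moreover have "eventually (\<lambda>x. x \<noteq> 0) (nhds v)"
      using False by (rule t1_space_nhds)
    then have "eventually (\<lambda>x. sqrt_vec x = x /\<^sub>R sqrt (norm x)) (nhds v)"
      by eventually_elim (simp add: sqrt_vec_def)
    ultimately show ?thesis using isCont_cong[of sqrt_vec "\<lambda>x. x /\<^sub>R sqrt (norm x)" v] by blast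
  qed
  then show ?thesis by (simp add: continuous_at_imp_continuous_on)
qed

text \<open>The square root velocities themselves need not be Borel measurable, since \<open>vector_derivative\<close> is
unspecified on a null set. Completeness of Lebesgue measure allows the integrand to be replaced by
any Borel function \<open>k\<close> that agrees with it almost everywhere.\<close>

lemma srv_dist_eq:
  fixes b c :: "real \<Rightarrow> 'a::real_normed_vector"
  assumes ae: "AE t in lborel. t \<in> {0..1} \<longrightarrow> (norm (srv b t - srv c t))\<^sup>2 = k t"
    and km: "(\<lambda>t. indicator {0..1} t * k t) \<in> borel_measurable borel"
  shows "srv_dist b c = sqrt (LINT t:{0..1}|lborel. k t)"
proof -
  let ?f = "\<lambda>t. indicator {0..1} t *\<^sub>R (norm (srv b t - srv c t))\<^sup>2"
  let ?k = "\<lambda>t. indicator {0..1} t *\<^sub>R k t :: real"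
  have km': "?k \<in> borel_measurable lborel" using km by simp
  have "AE t in lborel. ?k t = ?f t"
    using ae by eventually_elim (auto simp: indicator_def)
  then have ae': "AE t in lebesgue. ?k t = ?f t" by (rule AE_completion)
  have kml: "?k \<in> borel_measurable lebesgue" using km' by (rule measurable_completion)
  have fml: "?f \<in> borel_measurable lebesgue"
    using kml ae' by (rule borel_measurable_AE)
  have "(LINT t|lebesgue. ?f t) = (LINT t|lebesgue. ?k t)"
    by (rule integral_cong_AE) (use fml kml ae' in auto)
  also have "\<dots> = (LINT t|lborel. ?k t)"
    using km' by (rule integral_completion)
  finally show ?thesis by (simp add: srv_dist_def set_lebesgue_integral_def)
qed

section \<open>Separating the motions of two reparametrisations\<close>

lemma countable_isolated_points:
  fixes C :: "real set"
  shows "countable {t \<in> C. \<not> t islimpt C}"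
proof -
  let ?M = "{t \<in> C. \<not> t islimpt C}"
  have "\<exists>p\<in>\<rat>. \<exists>q\<in>\<rat>. p < t \<and> t < q \<and> C \<inter> {p<..<q} = {t}" if t: "t \<in> ?M" for t
  proof -
    have "\<exists>e>0. \<forall>x\<in>C. dist x t < e \<longrightarrow> x = t"
      using t unfolding islimpt_approachable by blast
    then obtain e where e: "e > 0" "\<And>x. x \<in> C \<Longrightarrow> dist x t < e \<Longrightarrow> x = t" by blast
    obtain p where p: "p \<in> \<rat>" "t - e < p" "p < t" using Rats_dense_in_real[of "t - e" t] e(1) by auto
    obtain q where q: "q \<in> \<rat>" "t < q" "q < t + e" using Rats_dense_in_real[of t "t + e"] e(1) by auto
    have "x = t" if "x \<in> C" "p < x" "x < q" for x
    proof (rule e(2)[OF that(1)])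
      show "dist x t < e" using that(2,3) p(2) q(3) by (simp add: dist_real_def abs_less_iff)
    qed
    moreover have "t \<in> C" using t by simp
    ultimately have "C \<inter> {p<..<q} = {t}" using p(3) q(2) 
      by (intro set_eqI) (metis IntD1 IntD2 IntI greaterThanLessThan_iff singletonD singletonI)
    then show ?thesis
      by (intro bexI[of _ p] bexI[of _ q] conjI p q)
  qed
  then have "\<forall>t\<in>?M. \<exists>r. fst r \<in> \<rat> \<and> snd r \<in> \<rat> \<and> C \<inter> {fst r<..<snd r} = {t}"
    unfolding split_paired_Ex fst_conv snd_conv by blast
  from bchoice[OF this] obtain r where
    "\<forall>t\<in>?M. fst (r t) \<in> \<rat> \<and> snd (r t) \<in> \<rat> \<and> C \<inter> {fst (r t)<..<snd (r t)} = {t}" ..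
  note r = this[rule_format]
  have "inj_on r ?M"
  proof (rule inj_onI)
    fix s t assume st: "s \<in> ?M" "t \<in> ?M" "r s = r t"
    have "C \<inter> {fst (r s)<..<snd (r s)} = {s}" "C \<inter> {fst (r t)<..<snd (r t)} = {t}"
      using r[OF st(1)] r[OF st(2)] by blast+
    then show "s = t" unfolding st(3) by blast
  qed
  moreover have "r ` ?M \<subseteq> \<rat> \<times> \<rat>"
  proof
    fix z assume "z \<in> r ` ?M"
    then obtain t where "t \<in> ?M" "z = r t" by blast
    then show "z \<in> \<rat> \<times> \<rat>" using r[of t] by (metis mem_Times_iff)
  qed
  then have "countable (r ` ?M)" 
    by (rule countable_subset) (intro countable_SIGMA countable_rat)
  ultimately show ?thesis by (rule countable_image_inj_on[rotated])
qed

text \<open>Two paths that agree with the identity on a closed set \<open>C\<close> but are never in motion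
simultaneously off \<open>C\<close>. On each complementary interval, from \<open>gap_lo\<close> to \<open>gap_hi\<close>, \<open>early\<close> runs
through the whole interval at double speed in the first half and waits in the second; \<open>late\<close> waits
in the first half. Points of \<open>C\<close> count as degenerate intervals, so that one formula
covers all cases. Where \<open>early\<close> or \<open>late\<close> rests, the product of their derivatives, and
with it the integrand of the matching functional, vanishes.\<close>

definition gap_lo :: "real set \<Rightarrow> real \<Rightarrow> real" where
  "gap_lo C t = Sup {r \<in> C. r \<le> t}"

definition gap_hi :: "real set \<Rightarrow> real \<Rightarrow> real" where
  "gap_hi C t = Inf {r \<in> C. t \<le> r}"

definition early :: "real set \<Rightarrow> real \<Rightarrow> real" where
  "early C t = min (gap_hi C t) (2 * t - gap_lo C t)"

definition late :: "real set \<Rightarrow> real \<Rightarrow> real" where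
  "late C t = max (gap_lo C t) (2 * t - gap_hi C t)"

locale closed_with_endpoints =
  fixes C :: "real set"
  assumes closed_C: "closed C" and C_sub: "C \<subseteq> {0..1}" and C0: "0 \<in> C" and C1: "1 \<in> C"
begin

lemma gap_lo:
  assumes "0 \<le> t" "t \<le> 1"
  shows "gap_lo C t \<in> C" "gap_lo C t \<le> t" "\<And>r. r \<in> C \<Longrightarrow> r \<le> t \<Longrightarrow> r \<le> gap_lo C t"
proof -
  let ?S = "{r \<in> C. r \<le> t}"
  have ne: "?S \<noteq> {}" and bdd: "bdd_above ?S" using C0 assms by auto
  have "?S = C \<inter> {..t}" by auto
  then have "closed ?S" using closed_C by auto
  from closed_contains_Sup[OF ne bdd this] show "gap_lo C t \<in> C" "gap_lo C t \<le> t"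
    by (auto simp: gap_lo_def)
  show "r \<le> gap_lo C t" if "r \<in> C" "r \<le> t" for r
    unfolding gap_lo_def using bdd that by (intro cSup_upper) auto
qed

lemma gap_hi:
  assumes "0 \<le> t" "t \<le> 1"
  shows "gap_hi C t \<in> C" "t \<le> gap_hi C t" "\<And>r. r \<in> C \<Longrightarrow> t \<le> r \<Longrightarrow> gap_hi C t \<le> r"
proof -
  let ?S = "{r \<in> C. t \<le> r}"
  have ne: "?S \<noteq> {}" and bdd: "bdd_below ?S" using C1 assms by auto
  have "?S = C \<inter> {t..}" by auto
  then have "closed ?S" using closed_C by auto
  from closed_contains_Inf[OF ne bdd this] show "gap_hi C t \<in> C" "t \<le> gap_hi C t"
    by (auto simp: gap_hi_def)
  show "gap_hi C t \<le> r" if "r \<in> C" "t \<le> r" for r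
    unfolding gap_hi_def using bdd that by (intro cInf_lower) auto
qed

lemma on_C: assumes "t \<in> C" shows "early C t = t" "late C t = t"
proof -
  have "0 \<le> t" "t \<le> 1" using assms C_sub by auto
  then have "gap_lo C t = t" "gap_hi C t = t"
    using gap_lo(2,3)[of t] gap_hi(2,3)[of t] assms by (auto intro!: antisym)
  then show "early C t = t" "late C t = t" by (auto simp: early_def late_def)
qed

text \<open>The dichotomy behind the monotonicity and the Lipschitz bound: two points lie in one complementary interval,
where the formulas are explicit, or a point of \<open>C\<close> separates them and is fixed by both maps.\<close>

lemma same_gap_or_separated:
  assumes "0 \<le> s" "s \<le> t" "t \<le> 1"
  shows "gap_hi C s \<le> gap_lo C t \<or> (gap_lo C s = gap_lo C t \<and> gap_hi C s = gap_hi C t)"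
proof (cases "gap_hi C s \<le> t")
  case True
  then show ?thesis using gap_lo(3)[of t] gap_hi(1)[of s] assms by auto
next
  case False
  have "gap_lo C t < s"
  proof (rule ccontr)
    assume "\<not> gap_lo C t < s"
    then have "gap_hi C s \<le> gap_lo C t" using gap_hi(3)[of s] gap_lo(1)[of t] assms by auto
    then show False using False gap_lo(2)[of t] assms by auto
  qed
  then have "gap_lo C s = gap_lo C t"
    using gap_lo[of s] gap_lo[of t] assms by (intro antisym) auto
  moreover have "gap_hi C s = gap_hi C t"
    using gap_hi[of s] gap_hi[of t] assms False by (intro antisym) auto
  ultimately show ?thesis by simp
qed

lemma gap_bounds:
  assumes "0 \<le> t" "t \<le> 1"
  shows "gap_lo C t \<le> t" "t \<le> gap_hi C t" "0 \<le> gap_lo C t" "gap_hi C t \<le> 1"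
  using gap_lo[OF assms] gap_hi[OF assms] C_sub by auto

lemma early_late_increment:
  assumes "0 \<le> s" "s \<le> t" "t \<le> 1"
  shows "early C s \<le> early C t" "early C t - early C s \<le> 2 * (t - s)"
    "late C s \<le> late C t" "late C t - late C s \<le> 2 * (t - s)"
proof -
  have s: "0 \<le> s" "s \<le> 1" and t: "0 \<le> t" "t \<le> 1" using assms by auto
  note b = gap_bounds(1,2)[OF s] gap_bounds(1,2)[OF t] \<open>s \<le> t\<close>
  have "early C s \<le> early C t \<and> early C t - early C s \<le> 2 * (t - s) \<and>
    late C s \<le> late C t \<and> late C t - late C s \<le> 2 * (t - s)"
    using same_gap_or_separated[OF assms]
  proof
    assume "gap_hi C s \<le> gap_lo C t"
    then show ?thesis using b unfolding early_def late_def min_def max_def by (intro conjI; auto)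
  next
    assume "gap_lo C s = gap_lo C t \<and> gap_hi C s = gap_hi C t"
    then show ?thesis using b unfolding early_def late_def min_def max_def by (intro conjI; auto)
  qed
  then show "early C s \<le> early C t" "early C t - early C s \<le> 2 * (t - s)"
    "late C s \<le> late C t" "late C t - late C s \<le> 2 * (t - s)" by auto
qed

lemma early_late_mono: "mono_on {0..1} (early C)" "mono_on {0..1} (late C)"
  using early_late_increment by (auto intro!: mono_onI)

lemma early_late_lipschitz: "2-lipschitz_on {0..1} (early C)" "2-lipschitz_on {0..1} (late C)"
proof -
  have *: "2-lipschitz_on {0..1} f" if "\<And>s t. 0 \<le> s \<Longrightarrow> s \<le> t \<Longrightarrow> t \<le> 1 \<Longrightarrow> f s \<le> f t \<and> f t - f s \<le> 2 * (t - s)"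
    for f :: "real \<Rightarrow> real"
  proof (rule lipschitz_onI)
    fix x y :: real assume "x \<in> {0..1}" "y \<in> {0..1}"
    then show "dist (f x) (f y) \<le> 2 * dist x y"
      using that[of x y] that[of y x] by (cases "x \<le> y") (auto simp: dist_real_def)
  qed simp
  show "2-lipschitz_on {0..1} (early C)" "2-lipschitz_on {0..1} (late C)"
    using early_late_increment by (intro *; simp)+
qed

lemma early_late_Gamma_bar: "early C \<in> Gamma_bar" "late C \<in> Gamma_bar"
  by (rule Gamma_barI[OF early_late_mono(1) early_late_lipschitz(1)]
      Gamma_barI[OF early_late_mono(2) early_late_lipschitz(2)]; simp add: on_C C0 C1)+

text \<open>One-sided intervals of constancy suffice, since a derivative that exists is determined by one side.
In this form the midpoint of a complementary interval is no exception.\<close>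

lemma early_or_late_constant:
  assumes "t \<in> {0..1}" "t \<notin> C"
  shows "(\<exists>s>t. s \<le> 1 \<and> (\<forall>r\<in>{t..s}. early C r = early C t)) \<or>
         (\<exists>s<t. 0 \<le> s \<and> (\<forall>r\<in>{s..t}. late C r = late C t))"
proof -
  have t: "0 \<le> t" "t \<le> 1" using assms by auto
  have lt: "gap_lo C t < t" "t < gap_hi C t"
    using gap_lo[OF t] gap_hi[OF t] assms(2) by (auto simp: less_le)
  have same: "gap_lo C r = gap_lo C t \<and> gap_hi C r = gap_hi C t" if r: "gap_lo C t < r" "r < gap_hi C t" for r
  proof -
    have r01: "0 \<le> r" "r \<le> 1" using r gap_bounds[OF t] by auto
    have "\<not> gap_hi C r \<le> gap_lo C t" "\<not> gap_hi C t \<le> gap_lo C r"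
      using r gap_bounds(1,2)[OF r01] by linarith+
    then show ?thesis
      using same_gap_or_separated[of r t] same_gap_or_separated[of t r] r01 t
      by (metis linear)
  qed
  show ?thesis
  proof (cases "gap_lo C t + gap_hi C t \<le> 2 * t")
    case True
    define s where "s = (t + gap_hi C t) / 2"
    have s: "s > t" "s < gap_hi C t" "s \<le> 1" using lt gap_bounds(4)[OF t] by (auto simp: s_def)
    have "early C r = early C t" if "r \<in> {t..s}" for r
    proof -
      have g: "gap_lo C r = gap_lo C t" "gap_hi C r = gap_hi C t" "t \<le> r"
        using same[of r] that lt s by auto
      show ?thesis unfolding early_def g(1,2) using g(3) True by linarith
    qed
    then show ?thesis using s by blast
  next
    case False
    define s where "s = (gap_lo C t + t) / 2"
    have s: "s < t" "gap_lo C t < s" "0 \<le> s" using lt gap_bounds(3)[OF t] by (auto simp: s_def)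
    have "late C r = late C t" if "r \<in> {s..t}" for r
    proof -
      have g: "gap_lo C r = gap_lo C t" "gap_hi C r = gap_hi C t" "r \<le> t"
        using same[of r] that lt s by auto
      show ?thesis unfolding late_def g(1,2) using g(3) False by linarith
    qed
    then show ?thesis using s by blast
  qed
qed

end

lemma derivative_0_if_constant:
  fixes f :: "real \<Rightarrow> real"
  assumes f: "(f has_real_derivative p) (at t within {0..1})" and s: "0 \<le> a" "a < b" "b \<le> 1"
    and t: "t \<in> {a..b}" and const: "\<And>r. r \<in> {a..b} \<Longrightarrow> f r = k"
  shows "p = 0"
proof -
  have "(f has_vector_derivative p) (at t within {a..b})"
    using f s by (auto intro: has_vector_derivative_within_subset simp: has_real_derivative_iff_has_vector_derivative)
  moreover have "(f has_vector_derivative 0) (at t within {a..b})"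
    by (rule has_vector_derivative_transform[OF t _ has_vector_derivative_const[of k]]) (use const in auto)
  moreover have "at t within {a..b} \<noteq> bot" using s t by (simp add: trivial_limit_within islimpt_Icc)
  ultimately show ?thesis using vector_derivative_unique_within by blast
qed

context closed_with_endpoints
begin

lemma derivatives_off_C:
  assumes "ac_derivative (x \<circ> early C) p" "ac_derivative (y \<circ> late C) q"
  shows "AE t in lborel. t \<in> {0..1} - C \<longrightarrow> p t = 0 \<or> q t = 0"
  using ac_derivative_has_derivative[OF assms(1)] ac_derivative_has_derivative[OF assms(2)]
proof eventually_elim
  case (elim t)
  show ?case
  proof
    assume t: "t \<in> {0..1} - C"
    then have t': "t \<in> {0..1}" "t \<notin> C" by auto
    from early_or_late_constant[OF t'] show "p t = 0 \<or> q t = 0"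
    proof (elim disjE exE conjE)
      fix s assume s: "t < s" "s \<le> 1" "\<forall>r\<in>{t..s}. early C r = early C t"
      have "p t = 0"
      proof (rule derivative_0_if_constant)
        show "(x \<circ> early C has_real_derivative p t) (at t within {0..1})" using elim(1) t by blast
        show "0 \<le> t" "t < s" "s \<le> 1" "t \<in> {t..s}" using t s(1,2) by auto
        show "(x \<circ> early C) r = x (early C t)" if "r \<in> {t..s}" for r using s(3) that by (metis comp_apply)
      qed
      then show ?thesis by simp
    next
      fix s assume s: "s < t" "0 \<le> s" "\<forall>r\<in>{s..t}. late C r = late C t"
      have "q t = 0"
      proof (rule derivative_0_if_constant)
        show "(y \<circ> late C has_real_derivative q t) (at t within {0..1})" using elim(2) t by blast
        show "0 \<le> s" "s < t" "t \<le> 1" "t \<in> {s..t}" using t s(1,2) by auto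
        show "(y \<circ> late C) r = y (late C t)" if "r \<in> {s..t}" for r using s(3) that by (metis comp_apply)
      qed
      then show ?thesis by simp
    qed
  qed
qed

text \<open>At an accumulation point of \<open>C\<close> a derivative is determined by the values on \<open>C\<close>, and the isolated
points of \<open>C\<close> are countable.\<close>

lemma derivatives_on_C:
  assumes f: "ac_derivative f p" and g: "ac_derivative g q" and eq: "\<And>t. t \<in> C \<Longrightarrow> f t = g t"
  shows "AE t in lborel. t \<in> C \<longrightarrow> p t = q t"
proof -
  have "{t \<in> C. \<not> t islimpt C} \<in> null_sets lborel"
    by (intro countable_imp_null_set_lborel countable_isolated_points)
  then have "AE t in lborel. t \<notin> {t \<in> C. \<not> t islimpt C}" by (rule AE_not_in)
  then show ?thesis
    using ac_derivative_has_derivative[OF f] ac_derivative_has_derivative[OF g]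
  proof eventually_elim
    case (elim t)
    show ?case
    proof
      assume t: "t \<in> C"
      then have nb: "at t within C \<noteq> bot" using elim(1) by (simp add: trivial_limit_within)
      have "t \<in> {0..1}" using t C_sub by blast
      then have "(f has_vector_derivative p t) (at t within {0..1})" "(g has_vector_derivative q t) (at t within {0..1})"
        using elim(2,3) by (simp_all add: has_real_derivative_iff_has_vector_derivative)
      from this[THEN has_vector_derivative_within_subset, OF C_sub]
      have f': "(f has_vector_derivative p t) (at t within C)" and g': "(g has_vector_derivative q t) (at t within C)" .
      have "(f has_vector_derivative q t) (at t within C)"
        by (rule has_vector_derivative_transform[OF t _ g']) (rule eq)
      with f' show "p t = q t" by (rule vector_derivative_unique_within[OF nb])
    qed
  qed
qed

end

section \<open>Integrals along reparametrisations\<close>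

lemma sqrt_mult_le_mean: "0 \<le> p \<Longrightarrow> 0 \<le> q \<Longrightarrow> sqrt (p * q) \<le> (p + q) / 2"
  using arith_geo_mean_sqrt[of p q] by simp

lemma weighted_sqrt_integrable:
  assumes f: "continuous_on {0..1} f" and p: "ac_derivative \<beta> p" and q: "ac_derivative \<gamma> q"
  shows "integrable lborel (\<lambda>t. indicator {0..1} t *\<^sub>R (f t * sqrt (p t * q t)) :: real)"
proof -
  have "compact (f ` {0..1})" using f by (intro compact_continuous_image) auto
  then obtain B where B: "\<And>t. t \<in> {0..1} \<Longrightarrow> \<bar>f t\<bar> \<le> B"
    by (force dest!: compact_imp_bounded simp: bounded_iff)
  have B0: "0 \<le> B" using B[of 0] by simp
  have [measurable]: "p \<in> borel_measurable borel" "q \<in> borel_measurable borel"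
    using p q by (auto intro: ac_derivative_measurable)
  have fm: "(\<lambda>t. indicator {0..1} t *\<^sub>R f t) \<in> borel_measurable borel"
    using f by (intro borel_measurable_continuous_on_indicator) auto
  have "(\<lambda>t. (indicator {0..1} t *\<^sub>R f t) * sqrt (p t * q t)) \<in> borel_measurable borel"
    by (intro borel_measurable_times fm) measurable
  moreover have "integrable lborel (\<lambda>t. B * (p t + q t))"
    using p q by (intro integrable_mult_right Bochner_Integration.integrable_add ac_derivative_integrable)
  ultimately show ?thesis
  proof (rule_tac Bochner_Integration.integrable_bound)
    show "AE t in lborel. norm (indicator {0..1} t *\<^sub>R (f t * sqrt (p t * q t))) \<le> norm (B * (p t + q t))"
    proof (rule AE_I2)
      fix t
      have pq: "0 \<le> p t" "0 \<le> q t" using p q by (auto simp: ac_derivative_nonneg)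
      have "\<bar>f t\<bar> * sqrt (p t * q t) \<le> B * (p t + q t)" if "t \<in> {0..1}"
        using B[OF that] sqrt_mult_le_mean[OF pq] pq B0 by (intro mult_mono) auto
      then show "norm (indicator {0..1} t *\<^sub>R (f t * sqrt (p t * q t))) \<le> norm (B * (p t + q t))"
        using B0 pq by (auto simp: indicator_def abs_mult)
    qed
  qed (simp_all add: mult.assoc)
qed

text \<open>The optimal \<open>l\<close> is \<open>sqrt (Q / P)\<close>; \<open>P\<close> and \<open>Q\<close> are first enlarged by \<open>e > 0\<close> so that it exists.\<close>

lemma le_geometric_mean:
  fixes X :: real
  assumes P: "0 \<le> P" and Q: "0 \<le> Q" and X: "\<And>l. l > 0 \<Longrightarrow> X \<le> (l * P + Q / l) / 2"
  shows "X \<le> sqrt (P * Q)"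
proof -
  have "X \<le> sqrt ((P + e) * (Q + e))" if e: "e > 0" for e
  proof -
    \<comment> \<open>At this value the two summands are equal.\<close>
    define l where "l = sqrt (Q + e) / sqrt (P + e)"
    have l: "l > 0" using P Q e by (simp add: l_def)
    have "l * P \<le> l * (P + e)" using l e by simp
    also have "\<dots> = sqrt (Q + e) * ((P + e) / sqrt (P + e))" by (simp add: l_def)
    also have "\<dots> = sqrt ((P + e) * (Q + e))"
      using P e by (simp add: real_div_sqrt real_sqrt_mult)
    finally have 1: "l * P \<le> sqrt ((P + e) * (Q + e))" .
    have "Q / l \<le> (Q + e) / l" using l e by (simp add: divide_right_mono)
    also have "\<dots> = sqrt (P + e) * ((Q + e) / sqrt (Q + e))" by (simp add: l_def)
    also have "\<dots> = sqrt ((P + e) * (Q + e))"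
      using Q e by (simp add: real_div_sqrt real_sqrt_mult)
    finally show ?thesis using 1 X[OF l] by simp
  qed
  moreover have "((\<lambda>e. sqrt ((P + e) * (Q + e))) \<longlongrightarrow> sqrt ((P + 0) * (Q + 0))) (at_right 0)"
    by (intro tendsto_intros)
  ultimately show ?thesis
    by (intro tendsto_lowerbound[of "\<lambda>e. sqrt ((P + e) * (Q + e))" _ "at_right 0"])
      (auto simp: eventually_at_right_less intro!: eventually_at_rightI[of 0 1])
qed

text \<open>The Cauchy-Schwarz inequality for \<open>sqrt p\<close> and \<open>sqrt q\<close>, from the arithmetic-geometric mean inequality
applied to \<open>l p\<close> and \<open>q / l\<close>. The bound depends only on the endpoints of the two paths, and this
is what makes the matching functional upper semicontinuous.\<close>

lemma set_integral_sqrt_le: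
  assumes ab: "0 \<le> a" "a \<le> b" "b \<le> 1" and p: "ac_derivative \<beta> p" and q: "ac_derivative \<gamma> q"
  shows "(LINT t:{a..b}|lborel. sqrt (p t * q t)) \<le> sqrt ((\<beta> b - \<beta> a) * (\<gamma> b - \<gamma> a))"
proof (rule le_geometric_mean)
  have nn: "0 \<le> (LINT t:{a..b}|lborel. g t)" if "ac_derivative f g" for f g
    using that by (auto simp: set_lebesgue_integral_def ac_derivative_nonneg intro!: integral_nonneg_AE)
  show "0 \<le> \<beta> b - \<beta> a" "0 \<le> \<gamma> b - \<gamma> a"
    using nn[OF p] nn[OF q] ac_derivative_integral[OF p ab] ac_derivative_integral[OF q ab] by auto
  fix l :: real assume l: "l > 0"
  have ip: "set_integrable lborel {a..b} p" and iq: "set_integrable lborel {a..b} q"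
    by (intro set_integrable_lborel ac_derivative_integrable[OF p] ac_derivative_integrable[OF q])+
  have i1: "set_integrable lborel {a..b} (\<lambda>t. sqrt (p t * q t))"
  proof (rule set_integrable_subset)
    show "set_integrable lborel {0..1} (\<lambda>t. sqrt (p t * q t))"
      using weighted_sqrt_integrable[OF continuous_on_const[of _ 1] p q] by (simp add: set_integrable_def)
  qed (use ab in auto)
  have "(LINT t:{a..b}|lborel. sqrt (p t * q t)) \<le> (LINT t:{a..b}|lborel. (l / 2) * p t + (1 / (2 * l)) * q t)"
  proof (rule set_integral_mono[OF i1 set_integral_add(1)])
    show "set_integrable lborel {a..b} (\<lambda>t. (l / 2) * p t)" "set_integrable lborel {a..b} (\<lambda>t. (1 / (2 * l)) * q t)"
      using ip iq by auto
    fix t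
    have pq: "0 \<le> p t" "0 \<le> q t" using p q by (auto simp: ac_derivative_nonneg)
    have "sqrt (p t * q t) = sqrt ((l * p t) * (q t / l))" using l by simp
    also have "\<dots> \<le> (l * p t + q t / l) / 2" using l pq by (intro sqrt_mult_le_mean) auto
    finally show "sqrt (p t * q t) \<le> (l / 2) * p t + (1 / (2 * l)) * q t" by (simp add: field_simps)
  qed
  also have "\<dots> = (l / 2) * (\<beta> b - \<beta> a) + (1 / (2 * l)) * (\<gamma> b - \<gamma> a)"
    using ip iq ac_derivative_integral[OF p ab] ac_derivative_integral[OF q ab]
    by (subst set_integral_add(2)) auto
  also have "\<dots> = (l * (\<beta> b - \<beta> a) + (\<gamma> b - \<gamma> a) / l) / 2"
    by (simp add: add_divide_distrib)
  finally show "(LINT t:{a..b}|lborel. sqrt (p t * q t)) \<le> \<dots>" .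
qed

lemma set_integral_combine:
  fixes f :: "real \<Rightarrow> real"
  assumes "a \<le> b" "b \<le> c" "set_integrable lborel {a..c} f"
  shows "(LINT t:{a..c}|lborel. f t) = (LINT t:{a..b}|lborel. f t) + (LINT t:{b..c}|lborel. f t)"
proof -
  have 1: "set_integrable lborel {a..b} f" "set_integrable lborel {b..c} f"
    using assms by (auto intro: set_integrable_subset)
  have "integral {a..c} f = integral {a..b} f + integral {b..c} f"
    using Henstock_Kurzweil_Integration.integral_combine[OF assms(1,2)] set_borel_integral_eq_integral(1)[OF assms(3)] by metis
  then show ?thesis using 1 assms(3) by (simp add: set_borel_integral_eq_integral(2))
qed

lemma set_integral_partition:
  fixes f :: "real \<Rightarrow> real"
  assumes "\<And>k. k < N \<Longrightarrow> s k \<le> s (Suc k)" "set_integrable lborel {s 0..s N} f"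
  shows "(LINT t:{s 0..s N}|lborel. f t) = (\<Sum>k<N. LINT t:{s k..s (Suc k)}|lborel. f t)"
  using assms
proof (induction N)
  case 0
  have "(LINT t:{s 0..s 0}|lborel. f t) = 0"
    using set_integral_at_point[of lborel "s 0" f] 0(2) by simp
  then show ?case by simp
next
  case (Suc N)
  have le: "s 0 \<le> s n" if "n \<le> N" for n
    using that by (induction n) (use Suc.prems(1) order_trans in \<open>auto simp: Suc_le_eq intro: order_trans\<close>)
  have "set_integrable lborel {s 0..s N} f"
    using Suc.prems(1)[of N] by (intro set_integrable_subset[OF Suc.prems(2)]) auto
  then show ?case
    using Suc.IH Suc.prems set_integral_combine[of "s 0" "s N" "s (Suc N)" f] le[of N] by simp
qed

text \<open>The antiderivative \<open>F\<close> of \<open>s\<close> is Lipschitz, so \<open>F \<circ> \<beta>\<close> is again absolutely continuous and is the integral of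
its derivative, which is \<open>s (\<beta> t) * p t\<close> wherever \<open>\<beta>\<close> is differentiable. For
the speed of a curve this is the invariance of length under reparametrisation.\<close>

lemma integral_substitution_Gamma_bar:
  assumes s: "continuous_on {0..1} s" and nn: "\<And>x. x \<in> {0..1} \<Longrightarrow> 0 \<le> s x"
    and \<beta>: "\<beta> \<in> Gamma_bar" and p: "ac_derivative \<beta> p"
  shows "set_integrable lborel {0..1} (\<lambda>t. s (\<beta> t) * p t)"
    "(LINT t:{0..1}|lborel. s (\<beta> t) * p t) = integral {0..1} s"
proof -
  define F where "F x = integral {0..x} s" for x
  have "compact (s ` {0..1})" using s by (intro compact_continuous_image) auto
  then obtain B where B: "\<And>t. t \<in> {0..1} \<Longrightarrow> \<bar>s t\<bar> \<le> B"
    by (force dest!: compact_imp_bounded simp: bounded_iff)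
  have F_diff: "F y - F x = integral {x..y} s" if "0 \<le> x" "x \<le> y" "y \<le> 1" for x y
  proof -
    have "s integrable_on {0..y}"
      using that by (intro integrable_continuous_real continuous_on_subset[OF s]) auto
    then show ?thesis
      using Henstock_Kurzweil_Integration.integral_combine[of 0 x y s] that by (simp add: F_def)
  qed
  have F_bd: "0 \<le> F y - F x \<and> F y - F x \<le> B * (y - x)" if "0 \<le> x" "x \<le> y" "y \<le> 1" for x y
  proof -
    have c: "continuous_on {x..y} s" using that by (intro continuous_on_subset[OF s]) auto
    have "norm (integral {x..y} s) \<le> B * (y - x)"
      using that B by (intro integral_bound c) auto
    moreover have "0 \<le> integral {x..y} s"
      using that nn by (intro integral_nonneg integrable_continuous_real c) auto
    ultimately show ?thesis using F_diff[OF that] by auto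
  qed
  have F_mono: "mono_on {0..1} F"
    using F_bd by (intro mono_onI) force
  have F_lip: "B-lipschitz_on {0..1} F"
  proof (rule lipschitz_onI)
    show "0 \<le> B" using B[of 0] by simp
    fix x y :: real assume "x \<in> {0..1}" "y \<in> {0..1}"
    then show "dist (F x) (F y) \<le> B * dist x y"
      using F_bd[of x y] F_bd[of y x] by (cases "x \<le> y") (auto simp: dist_real_def)
  qed
  obtain h where h: "ac_derivative (F \<circ> \<beta>) h"
    using Gamma_bar_compose_ac_derivative[OF \<beta> F_mono F_lip] by blast
  have ae: "AE t in lborel. t \<in> {0..1} \<longrightarrow> h t = s (\<beta> t) * p t"
    using ac_derivative_has_derivative[OF h] ac_derivative_has_derivative[OF p]
  proof eventually_elim
    case (elim t)
    show ?case
    proof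
      assume t: "t \<in> {0..1}"
      then have bt: "\<beta> t \<in> {0..1}" using Gamma_bar_range[OF \<beta>] by auto
      have "(F has_real_derivative s (\<beta> t)) (at (\<beta> t) within \<beta> ` {0..1})"
        using integral_has_vector_derivative[OF s bt] Gamma_bar_image[OF \<beta>]
        by (simp add: F_def[abs_def] has_real_derivative_iff_has_vector_derivative)
      from DERIV_image_chain[OF this] elim(2) t
      have "(F \<circ> \<beta> has_real_derivative s (\<beta> t) * p t) (at t within {0..1})" by blast
      then show "h t = s (\<beta> t) * p t"
        using derivative_unique_unit_interval elim(1) t by blast
    qed
  qed
  have [measurable]: "p \<in> borel_measurable borel" "h \<in> borel_measurable borel"
    using p h by (auto intro: ac_derivative_measurable)
  have "continuous_on {0..1} (\<lambda>t. s (\<beta> t))"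
    using Gamma_bar_image[OF \<beta>] by (intro continuous_on_compose2[OF s Gamma_bar_continuous[OF \<beta>]]) auto
  then have sm: "(\<lambda>t. indicator {0..1} t *\<^sub>R s (\<beta> t)) \<in> borel_measurable borel"
    by (intro borel_measurable_continuous_on_indicator) auto
  have "(\<lambda>t. (indicator {0..1} t *\<^sub>R s (\<beta> t)) * p t) \<in> borel_measurable borel"
    by (intro borel_measurable_times sm) measurable
  then have m: "(\<lambda>t. indicator {0..1} t *\<^sub>R (s (\<beta> t) * p t)) \<in> borel_measurable lborel"
    by (simp add: mult.assoc)
  have hm: "(\<lambda>t. indicator {0..1} t *\<^sub>R h t) \<in> borel_measurable lborel" by measurable
  have ae': "AE t in lborel. indicator {0..1} t *\<^sub>R h t = indicator {0..1} t *\<^sub>R (s (\<beta> t) * p t)"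
    using ae by eventually_elim (auto simp: indicator_def)
  have "set_integrable lborel {0..1} h"
    by (intro set_integrable_lborel ac_derivative_integrable[OF h])
  then show "set_integrable lborel {0..1} (\<lambda>t. s (\<beta> t) * p t)"
    unfolding set_integrable_def using integrable_cong_AE[OF hm m ae'] by blast
  have "(LINT t:{0..1}|lborel. s (\<beta> t) * p t) = (LINT t:{0..1}|lborel. h t)"
    unfolding set_lebesgue_integral_def using integral_cong_AE[OF hm m ae'] by simp
  also have "\<dots> = F 1 - F 0"
    using ac_derivative_integral[OF h, of 0 1] Gamma_bar_0[OF \<beta>] Gamma_bar_1[OF \<beta>] by simp
  also have "\<dots> = integral {0..1} s" by (simp add: F_def)
  finally show "(LINT t:{0..1}|lborel. s (\<beta> t) * p t) = integral {0..1} s" .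
qed

section \<open>Pairs of reparametrisations in normal form\<close>

definition density_of :: "(real \<Rightarrow> real) \<Rightarrow> real \<Rightarrow> real" where
  "density_of \<beta> = (SOME g. ac_derivative \<beta> g)"

lemma density_of: "\<beta> \<in> Gamma_bar \<Longrightarrow> ac_derivative \<beta> (density_of \<beta>)"
  unfolding density_of_def using Gamma_bar_ac_derivative by (rule someI_ex)

text \<open>Pairs parametrised by the mean of their two coordinates. Both coordinates are then 2-Lipschitz, so that
normal pairs form a compact family, and \<open>normalise_pair\<close> says that up to a common change
of parameter there are no others.\<close>

definition normal_pair :: "(real \<Rightarrow> real) \<Rightarrow> (real \<Rightarrow> real) \<Rightarrow> bool" where
  "normal_pair x y \<longleftrightarrow> (\<forall>s t. 0 \<le> s \<and> s \<le> t \<and> t \<le> 1 \<longrightarrow> x s \<le> x t \<and> y s \<le> y t) \<and>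
     (\<forall>t. 0 \<le> t \<and> t \<le> 1 \<longrightarrow> 0 \<le> x t \<and> x t \<le> 1 \<and> 0 \<le> y t \<and> y t \<le> 1 \<and> x t + y t = 2 * t)"

lemma normal_pair_increment:
  assumes "normal_pair x y" "0 \<le> s" "s \<le> t" "t \<le> 1"
  shows "x s \<le> x t" "y s \<le> y t" "(x t - x s) + (y t - y s) = 2 * (t - s)"
proof -
  show "x s \<le> x t" "y s \<le> y t" using assms unfolding normal_pair_def by blast+
  have "x t + y t = 2 * t" "x s + y s = 2 * s" using assms unfolding normal_pair_def by auto
  then show "(x t - x s) + (y t - y s) = 2 * (t - s)" by simp
qed

lemma normal_pair_bounds:
  assumes "normal_pair x y" "0 \<le> t" "t \<le> 1"
  shows "0 \<le> x t" "x t \<le> 1" "0 \<le> y t" "y t \<le> 1" "x t + y t = 2 * t"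
  using assms unfolding normal_pair_def by auto

lemma normal_pair_lipschitz:
  assumes n: "normal_pair x y"
  shows "2-lipschitz_on {0..1} x" "2-lipschitz_on {0..1} y"
proof -
  have "dist (x s) (x t) \<le> 2 * dist s t \<and> dist (y s) (y t) \<le> 2 * dist s t" if "s \<in> {0..1}" "t \<in> {0..1}" for s t
    using normal_pair_increment[OF n, of s t] normal_pair_increment[OF n, of t s] that
    by (cases "s \<le> t") (auto simp: dist_real_def)
  then show "2-lipschitz_on {0..1} x" "2-lipschitz_on {0..1} y"
    by (auto intro!: lipschitz_onI)
qed

lemma normal_pair_Gamma_bar:
  assumes n: "normal_pair x y"
  shows "x \<in> Gamma_bar" "y \<in> Gamma_bar"
proof -
  have m: "mono_on {0..1} x" "mono_on {0..1} y"
    using normal_pair_increment[OF n] by (auto intro!: mono_onI)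
  have "x 0 = 0" "y 0 = 0" "x 1 = 1" "y 1 = 1"
    using normal_pair_bounds[OF n, of 0] normal_pair_bounds[OF n, of 1] by auto
  then show "x \<in> Gamma_bar" "y \<in> Gamma_bar"
    using m normal_pair_lipschitz[OF n] by (auto intro: Gamma_barI)
qed

text \<open>For each \<open>s\<close> choose a time \<open>\<tau> s\<close> at which the mean of \<open>\<beta>\<close> and \<open>\<gamma>\<close> equals \<open>s\<close>. The selection \<open>\<tau>\<close> may
jump, but only across intervals on which both \<open>\<beta>\<close> and \<open>\<gamma>\<close> are constant.
Requiring \<open>\<tau>\<close> to fix 0 and 1 lets its values at a grid partition the whole unit interval.\<close>

lemma normalise_pair:
  assumes \<beta>: "\<beta> \<in> Gamma_bar" and \<gamma>: "\<gamma> \<in> Gamma_bar"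
  obtains \<tau> where "\<tau> 0 = 0" "\<tau> 1 = 1" "\<And>s t. 0 \<le> s \<Longrightarrow> s \<le> t \<Longrightarrow> t \<le> 1 \<Longrightarrow> \<tau> s \<le> \<tau> t"
    "normal_pair (\<beta> \<circ> \<tau>) (\<gamma> \<circ> \<tau>)"
proof -
  define m where "m t = (\<beta> t + \<gamma> t) / 2" for t
  note b01 = Gamma_bar_0[OF \<beta>] Gamma_bar_1[OF \<beta>] Gamma_bar_0[OF \<gamma>] Gamma_bar_1[OF \<gamma>]
  have mc: "continuous_on {0..1} m"
    unfolding m_def by (intro continuous_intros Gamma_bar_continuous \<beta> \<gamma>) simp
  have "\<exists>t. (0 \<le> s \<and> s \<le> 1 \<longrightarrow> 0 \<le> t \<and> t \<le> 1 \<and> m t = s) \<and> (s = 0 \<longrightarrow> t = 0) \<and> (s = 1 \<longrightarrow> t = 1)" for s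
  proof (cases "s = 0 \<or> s = 1")
    case True
    then show ?thesis by (intro exI[of _ s]) (auto simp: m_def b01)
  next
    case False
    show ?thesis
    proof (cases "0 \<le> s \<and> s \<le> 1")
      case True
      then show ?thesis
        using IVT'[of m 0 s 1] mc False by (auto simp: m_def b01)
    qed (use False in auto)
  qed
  then obtain \<tau> where \<tau>: "\<And>s. 0 \<le> s \<Longrightarrow> s \<le> 1 \<Longrightarrow> 0 \<le> \<tau> s \<and> \<tau> s \<le> 1 \<and> m (\<tau> s) = s" "\<tau> 0 = 0" "\<tau> 1 = 1"
    by metis
  have mono: "\<tau> s \<le> \<tau> t" if st: "0 \<le> s" "s \<le> t" "t \<le> 1" for s t
  proof (cases "s = t")
    case False
    show ?thesis
    proof (rule ccontr)
      assume "\<not> \<tau> s \<le> \<tau> t"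
      then have "\<beta> (\<tau> t) \<le> \<beta> (\<tau> s)" "\<gamma> (\<tau> t) \<le> \<gamma> (\<tau> s)"
        using \<tau>(1)[of s] \<tau>(1)[of t] st
        by (auto intro!: mono_onD[OF Gamma_bar_mono[OF \<beta>]] mono_onD[OF Gamma_bar_mono[OF \<gamma>]])
      then have "m (\<tau> t) \<le> m (\<tau> s)" by (simp add: m_def)
      then show False using \<tau>(1)[of s] \<tau>(1)[of t] st False by simp
    qed
  qed simp
  have "normal_pair (\<beta> \<circ> \<tau>) (\<gamma> \<circ> \<tau>)"
    unfolding normal_pair_def
  proof (intro conjI allI impI; (elim conjE)?)
    fix s t :: real assume st: "0 \<le> s" "s \<le> t" "t \<le> 1"
    then have "\<tau> s \<in> {0..1}" "\<tau> t \<in> {0..1}" "\<tau> s \<le> \<tau> t" using \<tau>(1)[of s] \<tau>(1)[of t] mono[OF st] by auto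
    then show "(\<beta> \<circ> \<tau>) s \<le> (\<beta> \<circ> \<tau>) t" "(\<gamma> \<circ> \<tau>) s \<le> (\<gamma> \<circ> \<tau>) t"
      by (auto intro: mono_onD[OF Gamma_bar_mono[OF \<beta>]] mono_onD[OF Gamma_bar_mono[OF \<gamma>]])
  next
    fix t :: real assume t: "0 \<le> t" "t \<le> 1"
    then have "0 \<le> \<tau> t" "\<tau> t \<le> 1" "m (\<tau> t) = t" using \<tau>(1)[of t] by auto
    then show "0 \<le> (\<beta> \<circ> \<tau>) t" "(\<beta> \<circ> \<tau>) t \<le> 1" "0 \<le> (\<gamma> \<circ> \<tau>) t" "(\<gamma> \<circ> \<tau>) t \<le> 1"
      "(\<beta> \<circ> \<tau>) t + (\<gamma> \<circ> \<tau>) t = 2 * t"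
      using Gamma_bar_range[OF \<beta>, of "\<tau> t"] Gamma_bar_range[OF \<gamma>, of "\<tau> t"] by (auto simp: m_def)
  qed
  with that[of \<tau>] \<tau>(2,3) mono show ?thesis by blast
qed

section \<open>The matching functional of a continuous kernel\<close>

locale continuous_kernel =
  fixes \<phi> :: "real \<Rightarrow> real \<Rightarrow> real"
  assumes cont: "continuous_on ({0..1} \<times> {0..1}) (\<lambda>(x, y). \<phi> x y)"
begin

lemma cont_compose:
  assumes "continuous_on S f" "continuous_on S g" "f ` S \<subseteq> {0..1}" "g ` S \<subseteq> {0..1}"
  shows "continuous_on S (\<lambda>t. \<phi> (f t) (g t))"
  using continuous_on_compose2[OF cont, of S "\<lambda>t. (f t, g t)"] assms
  by (auto intro: continuous_on_Pair)

lemma cont_Gamma: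
  assumes "\<beta> \<in> Gamma_bar" "\<gamma> \<in> Gamma_bar"
  shows "continuous_on {0..1} (\<lambda>t. \<phi> (\<beta> t) (\<gamma> t))"
  using assms by (intro cont_compose Gamma_bar_continuous) (auto simp: Gamma_bar_def)

text \<open>The matching functional and its discretisation along a pair of paths. The latter uses only the
positive part of the kernel, samples it at grid points, and depends on finitely many values of the paths, so
that it is continuous under pointwise convergence.\<close>

definition gain :: "(real \<Rightarrow> real) \<Rightarrow> (real \<Rightarrow> real) \<Rightarrow> real" where
  "gain \<beta> \<gamma> = (LINT t:{0..1}|lborel. \<phi> (\<beta> t) (\<gamma> t) * sqrt (density_of \<beta> t * density_of \<gamma> t))"

definition upper_sum :: "nat \<Rightarrow> (real \<Rightarrow> real) \<Rightarrow> (real \<Rightarrow> real) \<Rightarrow> real" where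
  "upper_sum N x y = (\<Sum>k<N. max 0 (\<phi> (x (real k / real N)) (y (real k / real N))) *
     sqrt ((x (real (Suc k) / real N) - x (real k / real N)) * (y (real (Suc k) / real N) - y (real k / real N))))"

lemma gain_integrable:
  assumes "\<beta> \<in> Gamma_bar" "\<gamma> \<in> Gamma_bar"
  shows "set_integrable lborel {0..1} (\<lambda>t. \<phi> (\<beta> t) (\<gamma> t) * sqrt (density_of \<beta> t * density_of \<gamma> t))"
  unfolding set_integrable_def
  by (rule weighted_sqrt_integrable[OF cont_Gamma[OF assms] density_of[OF assms(1)] density_of[OF assms(2)]])

text \<open>On a grid cell the kernel exceeds its value at the lower left corner by at most \<open>e\<close>, by uniform continuity,
and the remaining integral is bounded by \<open>set_integral_sqrt_le\<close>. The threshold \<open>N0\<close> depends only on \<open>e\<close>,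
because consecutive grid values of a normal pair differ by at most \<open>2 / N\<close>. The comparison of \<open>\<beta>\<close>, \<open>\<gamma>\<close> with
their normal form passes through grid values only, so that no chain rule for \<open>\<beta> \<circ> \<tau>\<close> is involved.\<close>

lemma gain_le_upper_sum:
  assumes e: "e > 0"
  shows "\<exists>N0>0. \<forall>N\<ge>N0. \<forall>\<beta> \<gamma> \<tau>. \<beta> \<in> Gamma_bar \<and> \<gamma> \<in> Gamma_bar \<and> \<tau> 0 = 0 \<and> \<tau> 1 = 1 \<and>
    (\<forall>s t. 0 \<le> s \<and> s \<le> t \<and> t \<le> 1 \<longrightarrow> \<tau> s \<le> \<tau> t) \<and> normal_pair (\<beta> \<circ> \<tau>) (\<gamma> \<circ> \<tau>) \<longrightarrow>
    gain \<beta> \<gamma> \<le> upper_sum N (\<beta> \<circ> \<tau>) (\<gamma> \<circ> \<tau>) + e"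
proof -
  have "uniformly_continuous_on ({0..1} \<times> {0..1}) (\<lambda>(x, y). \<phi> x y)"
    using cont by (intro compact_uniformly_continuous compact_Times) auto
  then obtain d where d: "d > 0" "\<And>p q. p \<in> {0..1} \<times> {0..1} \<Longrightarrow> q \<in> {0..1} \<times> {0..1} \<Longrightarrow> dist q p < d \<Longrightarrow>
      dist ((\<lambda>(x, y). \<phi> x y) q) ((\<lambda>(x, y). \<phi> x y) p) < e"
    using e unfolding uniformly_continuous_on_def by meson
  obtain N0 :: nat where N0: "2 / d < real N0" using reals_Archimedean2 by blast
  have N0p: "N0 > 0" using N0 d(1) by (cases "N0 = 0") (auto simp: divide_less_0_iff)
  show ?thesis
  proof (intro exI[of _ N0] conjI N0p allI impI; elim conjE)
    fix N :: nat and \<beta> \<gamma> \<tau> :: "real \<Rightarrow> real"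
    assume N: "N0 \<le> N" and \<beta>: "\<beta> \<in> Gamma_bar" and \<gamma>: "\<gamma> \<in> Gamma_bar" and \<tau>: "\<tau> 0 = 0" "\<tau> 1 = 1"
      and mono: "\<forall>s t. 0 \<le> s \<and> s \<le> t \<and> t \<le> 1 \<longrightarrow> \<tau> s \<le> \<tau> t"
      and n: "normal_pair (\<beta> \<circ> \<tau>) (\<gamma> \<circ> \<tau>)"
    have Np: "N > 0" using N N0p by simp
    have Nd: "2 / real N < d"
    proof -
      have "2 / d < real N" using N0 N by linarith
      then show ?thesis using d(1) Np by (simp add: field_simps)
    qed
    define r where "r k = real k / real N" for k :: nat
    have r: "0 \<le> r k" "r k \<le> r (Suc k)" "r (Suc k) \<le> 1" "r (Suc k) - r k = 1 / real N" if "k < N" for k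
      using that Np by (auto simp: r_def field_simps)
    have r0: "r 0 = 0" "r N = 1" using Np by (auto simp: r_def)
    define s where "s k = \<tau> (r k)" for k
    have s_mono: "s k \<le> s (Suc k)" if "k < N" for k
      using mono r[OF that] by (simp add: s_def)
    have s0: "s 0 = 0" "s N = 1" by (simp_all add: s_def r0 \<tau>)
    have s01: "0 \<le> s k" "s k \<le> 1" if "k \<le> N" for k
    proof -
      have "0 \<le> r k" "r k \<le> 1" using that Np by (auto simp: r_def)
      then show "0 \<le> s k" "s k \<le> 1"
        using mono[rule_format, of 0 "r k"] mono[rule_format, of "r k" 1] by (auto simp: s_def \<tau>)
    qed
    let ?p = "density_of \<beta>" and ?q = "density_of \<gamma>"
    let ?x = "\<beta> \<circ> \<tau>" and ?y = "\<gamma> \<circ> \<tau>"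
    let ?F = "\<lambda>t. \<phi> (\<beta> t) (\<gamma> t) * sqrt (?p t * ?q t)"
    let ?D = "\<lambda>k. sqrt ((?x (r (Suc k)) - ?x (r k)) * (?y (r (Suc k)) - ?y (r k)))"
    have sum1: "(\<Sum>k<N. ?D k) \<le> 1"
    proof -
      have "(\<Sum>k<N. ?D k) \<le> (\<Sum>k<N. 1 / real N)"
      proof (rule sum_mono)
        fix k assume "k \<in> {..<N}"
        then have k: "k < N" by simp
        note i = normal_pair_increment[OF n r(1,2,3)[OF k]]
        have "?D k \<le> ((?x (r (Suc k)) - ?x (r k)) + (?y (r (Suc k)) - ?y (r k))) / 2"
          using i by (intro sqrt_mult_le_mean) auto
        also have "\<dots> = r (Suc k) - r k" unfolding i(3) by simp
        finally show "?D k \<le> 1 / real N" using r(4)[OF k] by simp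
      qed
      then show ?thesis using Np by simp
    qed
    have int: "set_integrable lborel {s 0..s N} ?F"
      unfolding s0 by (rule gain_integrable[OF \<beta> \<gamma>])
    have "gain \<beta> \<gamma> = (LINT t:{s 0..s N}|lborel. ?F t)" by (simp add: gain_def s0)
    also have "\<dots> = (\<Sum>k<N. LINT t:{s k..s (Suc k)}|lborel. ?F t)"
      using s_mono int by (rule set_integral_partition)
    also have "\<dots> \<le> (\<Sum>k<N. (max 0 (\<phi> (?x (r k)) (?y (r k))) + e) * ?D k)"
    proof (rule sum_mono)
      fix k assume "k \<in> {..<N}"
      then have k: "k < N" by simp
      let ?c = "max 0 (\<phi> (?x (r k)) (?y (r k))) + e"
      have sk: "0 \<le> s k" "s k \<le> s (Suc k)" "s (Suc k) \<le> 1" using s01 s_mono k by auto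
      have i1: "set_integrable lborel {s k..s (Suc k)} ?F"
        using sk by (intro set_integrable_subset[OF gain_integrable[OF \<beta> \<gamma>]]) auto
      have "set_integrable lborel {0..1} (\<lambda>t. sqrt (?p t * ?q t))"
        using weighted_sqrt_integrable[OF continuous_on_const[of _ 1] density_of[OF \<beta>] density_of[OF \<gamma>]] by (simp add: set_integrable_def)
      then have "set_integrable lborel {s k..s (Suc k)} (\<lambda>t. sqrt (?p t * ?q t))"
        by (rule set_integrable_subset) (use sk in auto)
      then have i2: "set_integrable lborel {s k..s (Suc k)} (\<lambda>t. ?c * sqrt (?p t * ?q t))" by simp
      have "(LINT t:{s k..s (Suc k)}|lborel. ?F t) \<le> (LINT t:{s k..s (Suc k)}|lborel. ?c * sqrt (?p t * ?q t))"
      proof (rule set_integral_mono[OF i1 i2])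
        fix t assume t: "t \<in> {s k..s (Suc k)}"
        have t01: "t \<in> {0..1}" "s k \<in> {0..1}" "s (Suc k) \<in> {0..1}" using t sk by auto
        have b: "\<beta> (s k) \<le> \<beta> t" "\<beta> t \<le> \<beta> (s (Suc k))" "\<gamma> (s k) \<le> \<gamma> t" "\<gamma> t \<le> \<gamma> (s (Suc k))"
          using t sk by (auto intro!: mono_onD[OF Gamma_bar_mono[OF \<beta>]] mono_onD[OF Gamma_bar_mono[OF \<gamma>]])
        have "dist (\<beta> t, \<gamma> t) (\<beta> (s k), \<gamma> (s k)) \<le> \<bar>\<beta> t - \<beta> (s k)\<bar> + \<bar>\<gamma> t - \<gamma> (s k)\<bar>"
          using sqrt_sum_squares_le_sum_abs[of "\<beta> t - \<beta> (s k)" "\<gamma> t - \<gamma> (s k)"] by (simp add: dist_prod_def dist_real_def)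
        also have "\<dots> \<le> (?x (r (Suc k)) - ?x (r k)) + (?y (r (Suc k)) - ?y (r k))"
          using b by (simp add: s_def)
        also have "\<dots> = 2 / real N" 
          unfolding normal_pair_increment(3)[OF n r(1,2,3)[OF k]] using r(4)[OF k] by simp
        finally have "dist (\<beta> t, \<gamma> t) (\<beta> (s k), \<gamma> (s k)) < d" using Nd by simp
        then have "dist (\<phi> (\<beta> t) (\<gamma> t)) (\<phi> (\<beta> (s k)) (\<gamma> (s k))) < e"
          using d(2)[of "(\<beta> (s k), \<gamma> (s k))" "(\<beta> t, \<gamma> t)"] t01 Gamma_bar_range[OF \<beta>] Gamma_bar_range[OF \<gamma>] by simp
        then have "\<phi> (\<beta> t) (\<gamma> t) \<le> ?c" by (simp add: dist_real_def s_def)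
        then show "?F t \<le> ?c * sqrt (?p t * ?q t)"
          using density_of[OF \<beta>] density_of[OF \<gamma>] by (intro mult_right_mono) (auto simp: ac_derivative_nonneg)
      qed
      also have "\<dots> = ?c * (LINT t:{s k..s (Suc k)}|lborel. sqrt (?p t * ?q t))" by simp
      also have "\<dots> \<le> ?c * ?D k"
        using set_integral_sqrt_le[OF sk density_of[OF \<beta>] density_of[OF \<gamma>]] e
        by (intro mult_left_mono) (auto simp: s_def)
      finally show "(LINT t:{s k..s (Suc k)}|lborel. ?F t) \<le> ?c * ?D k" .
    qed
    also have "\<dots> = upper_sum N ?x ?y + e * (\<Sum>k<N. ?D k)"
      by (simp add: upper_sum_def r_def distrib_right sum.distrib sum_distrib_left)
    also have "\<dots> \<le> upper_sum N ?x ?y + e"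
      using mult_left_mono[OF sum1, of e] e by simp
    finally show "gain \<beta> \<gamma> \<le> upper_sum N ?x ?y + e" .
  qed
qed

end

lemma difference_quotient_tendsto:
  assumes D: "\<forall>\<epsilon>>0. \<exists>\<delta>>0. \<forall>a b. 0 \<le> a \<and> a \<le> t \<and> t \<le> b \<and> b \<le> 1 \<and> a < b \<and> b - a < \<delta> \<longrightarrow>
           \<bar>f b - f a - d * (b - a)\<bar> \<le> \<epsilon> * (b - a)"
    and ab: "\<And>n. 0 \<le> a n" "\<And>n. a n \<le> t" "\<And>n. t \<le> b n" "\<And>n. b n \<le> 1" "\<And>n. b n - a n = 1 / real (Suc n)"
  shows "(\<lambda>n. real (Suc n) * (f (b n) - f (a n))) \<longlonglongrightarrow> d"
proof (rule LIMSEQ_I)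
  fix r :: real assume r: "0 < r"
  then obtain \<delta> where \<delta>: "\<delta> > 0" "\<And>a b. 0 \<le> a \<Longrightarrow> a \<le> t \<Longrightarrow> t \<le> b \<Longrightarrow> b \<le> 1 \<Longrightarrow> a < b \<Longrightarrow> b - a < \<delta> \<Longrightarrow>
           \<bar>f b - f a - d * (b - a)\<bar> \<le> (r / 2) * (b - a)"
    using D[rule_format, of "r / 2"] by (auto simp del: times_divide_eq_left)
  obtain n0 where n0: "1 / real (Suc n0) < \<delta>" using nat_approx_posE[OF \<delta>(1)] by auto
  show "\<exists>no. \<forall>n\<ge>no. norm (real (Suc n) * (f (b n) - f (a n)) - d) < r"
  proof (intro exI[of _ n0] allI impI)
    fix n assume n: "n0 \<le> n"
    have "1 / real (Suc n) \<le> 1 / real (Suc n0)" using n by (intro divide_left_mono) auto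
    then have small: "b n - a n < \<delta>" using n0 ab(5)[of n] by simp
    have pos: "a n < b n" using ab(5)[of n] by (metis diff_gt_0_iff_gt of_nat_0_less_iff zero_less_Suc zero_less_divide_1_iff)
    have "\<bar>f (b n) - f (a n) - d * (1 / real (Suc n))\<bar> \<le> (r / 2) * (1 / real (Suc n))"
      using \<delta>(2)[OF ab(1-4)[of n] pos small] unfolding ab(5) .
    then have "real (Suc n) * \<bar>f (b n) - f (a n) - d * (1 / real (Suc n))\<bar> \<le> real (Suc n) * ((r / 2) * (1 / real (Suc n)))"
      by (rule mult_left_mono) simp
    also have "\<dots> = r / 2" by (simp add: field_simps del: of_nat_Suc)
    also have "real (Suc n) * \<bar>f (b n) - f (a n) - d * (1 / real (Suc n))\<bar> =
       \<bar>real (Suc n) * (f (b n) - f (a n) - d * (1 / real (Suc n)))\<bar>" by (simp add: abs_mult)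
    also have "real (Suc n) * (f (b n) - f (a n) - d * (1 / real (Suc n))) = real (Suc n) * (f (b n) - f (a n)) - d"
      by (simp add: right_diff_distrib)
    finally show "norm (real (Suc n) * (f (b n) - f (a n)) - d) < r" using r by simp
  qed
qed

lemma cell_sum:
  fixes c :: "nat \<Rightarrow> real"
  assumes t: "0 \<le> t" "t < 1" and N: "N > 0"
  shows "(\<Sum>k<N. indicator {real k / real N..<real (Suc k) / real N} t * c k) = c (nat \<lfloor>real N * t\<rfloor>)"
proof -
  let ?m = "nat \<lfloor>real N * t\<rfloor>"
  have nn: "0 \<le> real N * t" using t by simp
  have m1: "real ?m \<le> real N * t" "real N * t < real (Suc ?m)"
    using nn by (auto simp: of_nat_nat) linarith
  have "real N * t < real N" using t N by simp
  then have mN: "?m < N" using m1(1) by linarith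
  have *: "t \<in> {real k / real N..<real (Suc k) / real N} \<longleftrightarrow> k = ?m" for k
  proof -
    have "t \<in> {real k / real N..<real (Suc k) / real N} \<longleftrightarrow> real k \<le> real N * t \<and> real N * t < real (Suc k)"
      using N by (simp add: field_simps)
    also have "\<dots> \<longleftrightarrow> k = ?m"
    proof
      assume "real k \<le> real N * t \<and> real N * t < real (Suc k)"
      then have "real k < real (Suc ?m)" "real ?m < real (Suc k)" using m1 by linarith+
      then show "k = ?m" by (simp only: of_nat_less_iff)
    qed (use m1 in blast)
    finally show ?thesis .
  qed
  have "(\<Sum>k<N. indicator {real k / real N..<real (Suc k) / real N} t * c k) = (\<Sum>k<N. if k = ?m then c k else 0)"
  proof (rule sum.cong[OF refl])
    fix k
    have "indicator {real k / real N..<real (Suc k) / real N} t = (if k = ?m then 1 else 0 :: real)"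
      unfolding indicator_def of_bool_def *[of k] ..
    then show "indicator {real k / real N..<real (Suc k) / real N} t * c k = (if k = ?m then c k else 0)"
      by (simp only: mult_1_left mult_zero_left split: if_splits) auto
  qed
  also have "\<dots> = c ?m" using mN by simp
  finally show ?thesis .
qed

context continuous_kernel
begin

lemma kernel_bound: "\<exists>B\<ge>0. \<forall>x\<in>{0..1}. \<forall>y\<in>{0..1}. \<bar>\<phi> x y\<bar> \<le> B"
proof -
  have "compact ((\<lambda>(x, y). \<phi> x y) ` ({0..1} \<times> {0..1}))"
    using cont by (intro compact_continuous_image compact_Times) auto
  then obtain B where B: "\<And>p. p \<in> {0..1} \<times> {0..1} \<Longrightarrow> \<bar>(\<lambda>(x, y). \<phi> x y) p\<bar> \<le> B"
    by (force dest!: compact_imp_bounded simp: bounded_iff)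
  show ?thesis
  proof (intro exI[of _ B] conjI ballI)
    show "0 \<le> B" using B[of "(0, 0)"] by simp
    show "\<bar>\<phi> x y\<bar> \<le> B" if "x \<in> {0..1}" "y \<in> {0..1}" for x y using B[of "(x, y)"] that by simp
  qed
qed

text \<open>The upper sums are integrals of step functions built from difference quotients of \<open>x\<close> and \<open>y\<close>. Along
shrinking cells these quotients converge almost everywhere, and they are bounded since
\<open>x\<close> and \<open>y\<close> are Lipschitz.\<close>

lemma upper_sum_tendsto:
  assumes n: "normal_pair x y"
  shows "(\<lambda>n. upper_sum (Suc n) x y) \<longlonglongrightarrow>
    (LINT t:{0..1}|lborel. max 0 (\<phi> (x t) (y t)) * sqrt (density_of x t * density_of y t))"
proof -
  note xG = normal_pair_Gamma_bar(1)[OF n] and yG = normal_pair_Gamma_bar(2)[OF n]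
  let ?p = "density_of x" and ?q = "density_of y"
  obtain B where B: "0 \<le> B" "\<And>x y. x \<in> {0..1} \<Longrightarrow> y \<in> {0..1} \<Longrightarrow> \<bar>\<phi> x y\<bar> \<le> B"
    using kernel_bound by blast
  define r where "r n k = real k / real (Suc n)" for n k :: nat
  define c where "c n k = max 0 (\<phi> (x (r n k)) (y (r n k))) *
    sqrt ((real (Suc n) * (x (r n (Suc k)) - x (r n k))) * (real (Suc n) * (y (r n (Suc k)) - y (r n k))))" for n k
  define f where "f n t = (\<Sum>k<Suc n. indicator {r n k..<r n (Suc k)} t * c n k)" for n t
  have r01: "0 \<le> r n k" "r n k \<le> r n (Suc k)" "r n (Suc k) \<le> 1" "r n (Suc k) - r n k = 1 / real (Suc n)"
    if "k < Suc n" for n k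
    using that by (auto simp: r_def field_simps)
  have c_bound: "\<bar>c n k\<bar> \<le> B * 2" if k: "k < Suc n" for n k
  proof -
    note i = normal_pair_increment[OF n r01(1,2,3)[OF k]]
    have N: "real (Suc n) > 0" by simp
    have "sqrt ((real (Suc n) * (x (r n (Suc k)) - x (r n k))) * (real (Suc n) * (y (r n (Suc k)) - y (r n k))))
       \<le> (real (Suc n) * (x (r n (Suc k)) - x (r n k)) + real (Suc n) * (y (r n (Suc k)) - y (r n k))) / 2"
      using i(1,2) by (intro sqrt_mult_le_mean mult_nonneg_nonneg) auto
    also have "\<dots> = real (Suc n) * ((x (r n (Suc k)) - x (r n k)) + (y (r n (Suc k)) - y (r n k))) / 2"
      by (simp only: distrib_left)
    also have "\<dots> = 1" unfolding i(3) r01(4)[OF k] by simp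
    finally have 1: "sqrt ((real (Suc n) * (x (r n (Suc k)) - x (r n k))) * (real (Suc n) * (y (r n (Suc k)) - y (r n k)))) \<le> 1" .
    have 0: "0 \<le> sqrt ((real (Suc n) * (x (r n (Suc k)) - x (r n k))) * (real (Suc n) * (y (r n (Suc k)) - y (r n k))))"
      using i(1,2) by simp
    have "r n k \<le> 1" using r01[OF k] by linarith
    then have "max 0 (\<phi> (x (r n k)) (y (r n k))) \<le> B"
      using B(2)[of "x (r n k)" "y (r n k)"] B(1) normal_pair_bounds[OF n r01(1)[OF k]] by simp
    then have "c n k \<le> B * 1" unfolding c_def using 0 1 B(1) by (intro mult_mono) auto
    moreover have "0 \<le> c n k" unfolding c_def using 0 by (intro mult_nonneg_nonneg) auto
    ultimately show ?thesis using B(1) by simp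
  qed
  have int_ind: "integrable lborel (\<lambda>t. indicator {r n k..<r n (Suc k)} t * c n k)" if "k < Suc n" for n k
    using r01[OF that] by (cases "c n k = 0") auto
  have int_f: "(LINT t|lborel. f n t) = upper_sum (Suc n) x y" for n
  proof -
    have "(LINT t|lborel. f n t) = (\<Sum>k<Suc n. LINT t|lborel. indicator {r n k..<r n (Suc k)} t * c n k)"
      unfolding f_def by (rule Bochner_Integration.integral_sum) (use int_ind in auto)
    also have "\<dots> = (\<Sum>k<Suc n. max 0 (\<phi> (x (r n k)) (y (r n k))) * sqrt ((x (r n (Suc k)) - x (r n k)) * (y (r n (Suc k)) - y (r n k))))"
    proof (rule sum.cong[OF refl])
      fix k assume "k \<in> {..<Suc n}"
      then have k: "k < Suc n" by simp
      have "(LINT t|lborel. indicator {r n k..<r n (Suc k)} t * c n k) = (r n (Suc k) - r n k) * c n k"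
        using r01(2)[OF k] by simp
      also have "\<dots> = max 0 (\<phi> (x (r n k)) (y (r n k))) * 
         (sqrt ((real (Suc n) * (x (r n (Suc k)) - x (r n k))) * (real (Suc n) * (y (r n (Suc k)) - y (r n k)))) / real (Suc n))"
        unfolding r01(4)[OF k] c_def by simp
      also have "(real (Suc n) * (x (r n (Suc k)) - x (r n k))) * (real (Suc n) * (y (r n (Suc k)) - y (r n k))) =
        (real (Suc n))\<^sup>2 * ((x (r n (Suc k)) - x (r n k)) * (y (r n (Suc k)) - y (r n k)))" by (simp only: power2_eq_square ac_simps)
      also have "sqrt \<dots> / real (Suc n) = sqrt ((x (r n (Suc k)) - x (r n k)) * (y (r n (Suc k)) - y (r n k)))"
        by (simp only: real_sqrt_mult[of "(real (Suc n))\<^sup>2"] real_sqrt_abs) simp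
      finally show "(LINT t|lborel. indicator {r n k..<r n (Suc k)} t * c n k) =
        max 0 (\<phi> (x (r n k)) (y (r n k))) * sqrt ((x (r n (Suc k)) - x (r n k)) * (y (r n (Suc k)) - y (r n k)))" .
    qed
    also have "\<dots> = upper_sum (Suc n) x y" by (simp only: upper_sum_def r_def)
    finally show ?thesis .
  qed
  have f_val: "f n t = c n (nat \<lfloor>real (Suc n) * t\<rfloor>)" if "0 \<le> t" "t < 1" for n t
    unfolding f_def r_def using cell_sum[OF that, of "Suc n" "c n"] by simp
  have floor: "nat \<lfloor>real (Suc n) * t\<rfloor> < Suc n" "r n (nat \<lfloor>real (Suc n) * t\<rfloor>) \<le> t" "t \<le> r n (Suc (nat \<lfloor>real (Suc n) * t\<rfloor>))"
    if t: "0 \<le> t" "t < 1" for n t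
  proof -
    let ?m = "nat \<lfloor>real (Suc n) * t\<rfloor>"
    have nn: "0 \<le> real (Suc n) * t" using t by simp
    have m1: "real ?m \<le> real (Suc n) * t" "real (Suc n) * t < real (Suc ?m)"
      using nn by (auto simp: of_nat_nat simp del: of_nat_Suc) linarith
    have "real (Suc n) * t < real (Suc n)" using t by simp
    then show "?m < Suc n" using m1(1) by linarith
    show "r n ?m \<le> t" "t \<le> r n (Suc ?m)" using m1 by (simp_all add: r_def field_simps del: of_nat_Suc)
  qed
  have f_out: "f n t = 0" if "\<not> (0 \<le> t \<and> t < 1)" for n t
    unfolding f_def
  proof (rule sum.neutral, rule ballI)
    fix k assume "k \<in> {..<Suc n}"
    then have "k < Suc n" by simp
    from r01[OF this] that have "t \<notin> {r n k..<r n (Suc k)}" by auto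
    then show "indicator {r n k..<r n (Suc k)} t * c n k = 0" by simp
  qed
  let ?lim = "\<lambda>t. indicator {0..1} t *\<^sub>R (max 0 (\<phi> (x t) (y t)) * sqrt (?p t * ?q t))"
  have "(\<lambda>n. LINT t|lborel. f n t) \<longlonglongrightarrow> (LINT t|lborel. ?lim t)"
  proof (rule integral_dominated_convergence)
    have "continuous_on {0..1} (\<lambda>t. max 0 (\<phi> (x t) (y t)))"
      by (intro continuous_intros cont_Gamma xG yG)
    from weighted_sqrt_integrable[OF this density_of[OF xG] density_of[OF yG]]
    show "?lim \<in> borel_measurable lborel" by (rule borel_measurable_integrable)
    show "f n \<in> borel_measurable lborel" for n unfolding f_def[abs_def] by measurable
    show "integrable lborel (\<lambda>t. indicator {0..1::real} t * (B * 2))" by simp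
    show "AE t in lborel. norm (f n t) \<le> indicator {0..1} t * (B * 2)" for n
    proof (rule AE_I2)
      fix t :: real
      show "norm (f n t) \<le> indicator {0..1} t * (B * 2)"
      proof (cases "0 \<le> t \<and> t < 1")
        case True
        then have t: "0 \<le> t" "t < 1" by auto
        show ?thesis unfolding f_val[OF t] using c_bound[OF floor(1)[OF t, of n]] t by simp
      next
        case False
        show ?thesis unfolding f_out[OF False] using B(1) by simp
      qed
    qed
    have "AE t in lborel. t \<noteq> (1::real)" by (rule AE_lborel_singleton)
    then show "AE t in lborel. (\<lambda>n. f n t) \<longlonglongrightarrow> ?lim t"
      using ac_derivative_interval[OF density_of[OF xG]] ac_derivative_interval[OF density_of[OF yG]]
    proof eventually_elim
      case (elim t)
      show ?case
      proof (cases "0 \<le> t \<and> t < 1")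
        case False
        then have "t \<notin> {0..1}" using elim(1) by auto
        then show ?thesis unfolding f_out[OF False] by simp
      next
        case True
        then have t: "0 \<le> t" "t < 1" by auto
        then have tI: "t \<in> {0..1}" by simp
        define a where "a n = r n (nat \<lfloor>real (Suc n) * t\<rfloor>)" for n
        define b where "b n = r n (Suc (nat \<lfloor>real (Suc n) * t\<rfloor>))" for n
        have ab: "0 \<le> a n" "a n \<le> t" "t \<le> b n" "b n \<le> 1" "b n - a n = 1 / real (Suc n)" for n
          using floor[OF t, of n] r01[OF floor(1)[OF t, of n]] by (auto simp: a_def b_def)
        have dx: "(\<lambda>n. real (Suc n) * (x (b n) - x (a n))) \<longlonglongrightarrow> ?p t"
          by (rule difference_quotient_tendsto[OF _ ab]) (use elim(2) tI in blast)
        have dy: "(\<lambda>n. real (Suc n) * (y (b n) - y (a n))) \<longlonglongrightarrow> ?q t"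
          by (rule difference_quotient_tendsto[OF _ ab]) (use elim(3) tI in blast)
        have at: "a \<longlonglongrightarrow> t"
        proof (rule tendsto_sandwich[of "\<lambda>n. t - 1 / real (Suc n)" _ _ "\<lambda>n. t"])
          show "\<forall>\<^sub>F n in sequentially. t - 1 / real (Suc n) \<le> a n"
            using ab(3,5) by (intro always_eventually allI) (metis add.commute diff_le_eq le_diff_eq diff_diff_eq2 add_diff_cancel_left')
          have "(\<lambda>n. t - 1 / real (Suc n)) \<longlonglongrightarrow> t - 0"
            using LIMSEQ_inverse_real_of_nat by (intro tendsto_diff tendsto_const) (simp add: inverse_eq_divide)
          then show "(\<lambda>n. t - 1 / real (Suc n)) \<longlonglongrightarrow> t" by simp
        qed (use ab(2) in auto)
        have aI: "a n \<in> {0..1}" for n using ab(1,2)[of n] t by simp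
        have "(\<lambda>n. \<phi> (x (a n)) (y (a n))) \<longlonglongrightarrow> \<phi> (x t) (y t)"
          by (rule continuous_on_tendsto_compose[OF cont_Gamma[OF xG yG] at tI]) (use aI in simp)
        then have "(\<lambda>n. max 0 (\<phi> (x (a n)) (y (a n))) * sqrt ((real (Suc n) * (x (b n) - x (a n))) * (real (Suc n) * (y (b n) - y (a n)))))
            \<longlonglongrightarrow> max 0 (\<phi> (x t) (y t)) * sqrt (?p t * ?q t)"
          by (intro tendsto_intros dx dy)
        then show ?thesis unfolding f_val[OF t] c_def a_def b_def using tI by simp
      qed
    qed
  qed
  then show ?thesis unfolding int_f set_lebesgue_integral_def .
qed

end

lemma Gamma_bar_compose_lipschitz:
  assumes x: "x \<in> Gamma_bar" "L-lipschitz_on {0..1} x" and s: "s \<in> Gamma_bar" "K-lipschitz_on {0..1} s"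
  shows "x \<circ> s \<in> Gamma_bar"
proof (rule Gamma_barI)
  show "mono_on {0..1} (x \<circ> s)"
    using Gamma_bar_range[OF s(1)] mono_onD[OF Gamma_bar_mono[OF s(1)]]
    by (intro mono_onI) (auto intro!: mono_onD[OF Gamma_bar_mono[OF x(1)]])
  show "(L * K)-lipschitz_on {0..1} (x \<circ> s)"
    using x(2) s(2) Gamma_bar_image[OF s(1)] by (intro lipschitz_on_compose) auto
  show "(x \<circ> s) 0 = 0" "(x \<circ> s) 1 = 1"
    using Gamma_bar_0[OF x(1)] Gamma_bar_1[OF x(1)] Gamma_bar_0[OF s(1)] Gamma_bar_1[OF s(1)] by simp_all
qed

context continuous_kernel
begin

lemma gain_bounded: "\<exists>B. \<forall>\<beta>\<in>Gamma_bar. \<forall>\<gamma>\<in>Gamma_bar. gain \<beta> \<gamma> \<le> B"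
proof -
  obtain B where B: "0 \<le> B" "\<And>x y. x \<in> {0..1} \<Longrightarrow> y \<in> {0..1} \<Longrightarrow> \<bar>\<phi> x y\<bar> \<le> B"
    using kernel_bound by blast
  have "gain \<beta> \<gamma> \<le> B" if \<beta>: "\<beta> \<in> Gamma_bar" and \<gamma>: "\<gamma> \<in> Gamma_bar" for \<beta> \<gamma>
  proof -
    let ?s = "\<lambda>t. sqrt (density_of \<beta> t * density_of \<gamma> t)"
    have is1: "set_integrable lborel {0..1} ?s"
      using weighted_sqrt_integrable[OF continuous_on_const[of _ 1] density_of[OF \<beta>] density_of[OF \<gamma>]] by (simp add: set_integrable_def)
    then have iB: "set_integrable lborel {0..1} (\<lambda>t. B * ?s t)" by simp
    have "gain \<beta> \<gamma> \<le> (LINT t:{0..1}|lborel. B * ?s t)"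
      unfolding gain_def
    proof (rule set_integral_mono[OF gain_integrable[OF \<beta> \<gamma>] iB])
      fix t :: real assume "t \<in> {0..1}"
      then have "\<beta> t \<in> {0..1}" "\<gamma> t \<in> {0..1}" using Gamma_bar_range[OF \<beta>] Gamma_bar_range[OF \<gamma>] by auto
      then have "\<phi> (\<beta> t) (\<gamma> t) \<le> B" using B(2)[of "\<beta> t" "\<gamma> t"] by simp
      then show "\<phi> (\<beta> t) (\<gamma> t) * ?s t \<le> B * ?s t"
        using density_of[OF \<beta>] density_of[OF \<gamma>] by (intro mult_right_mono) (auto simp: ac_derivative_nonneg)
    qed
    also have "\<dots> = B * (LINT t:{0..1}|lborel. ?s t)" by simp
    also have "\<dots> \<le> B * sqrt ((\<beta> 1 - \<beta> 0) * (\<gamma> 1 - \<gamma> 0))"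
      using set_integral_sqrt_le[of 0 1, OF _ _ _ density_of[OF \<beta>] density_of[OF \<gamma>]] B(1) by (intro mult_left_mono) auto
    also have "\<dots> = B" by (simp add: Gamma_bar_0 Gamma_bar_1 \<beta> \<gamma>)
    finally show ?thesis .
  qed
  then show ?thesis by blast
qed

text \<open>Where the kernel is negative along the pair, \<open>x\<close> and \<open>y\<close> are made to move one after the other and
collect nothing instead of a loss; elsewhere nothing changes almost everywhere.
The modified path may run through any values of the kernel during such a detour,
which is harmless because one of the two derivatives vanishes there.\<close>

lemma gain_remove_negative:
  assumes n: "normal_pair x y"
  shows "\<exists>\<beta>\<in>Gamma_bar. \<exists>\<gamma>\<in>Gamma_bar.
    gain \<beta> \<gamma> = (LINT t:{0..1}|lborel. max 0 (\<phi> (x t) (y t)) * sqrt (density_of x t * density_of y t))"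
proof -
  note xG = normal_pair_Gamma_bar(1)[OF n] and yG = normal_pair_Gamma_bar(2)[OF n]
  note xL = normal_pair_lipschitz(1)[OF n] and yL = normal_pair_lipschitz(2)[OF n]
  define C where "C = {t \<in> {0..1}. 0 \<le> \<phi> (x t) (y t)} \<union> {0, 1}"
  have "closed {t \<in> {0..1}. \<phi> (x t) (y t) \<in> {0..}}"
    using continuous_closed_preimage[OF cont_Gamma[OF xG yG], of "{0..}"] by (simp add: vimage_def Int_def)
  then have closedC: "closed C" unfolding C_def by (intro closed_Un) auto
  interpret closed_with_endpoints C
    using closedC by unfold_locales (auto simp: C_def)
  let ?\<beta> = "x \<circ> early C" and ?\<gamma> = "y \<circ> late C"
  have \<beta>: "?\<beta> \<in> Gamma_bar" and \<gamma>: "?\<gamma> \<in> Gamma_bar"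
    by (rule Gamma_bar_compose_lipschitz[OF xG xL early_late_Gamma_bar(1) early_late_lipschitz(1)]
        Gamma_bar_compose_lipschitz[OF yG yL early_late_Gamma_bar(2) early_late_lipschitz(2)])+
  let ?p = "density_of x" and ?q = "density_of y" and ?p1 = "density_of ?\<beta>" and ?q1 = "density_of ?\<gamma>"
  note Dp = density_of[OF xG] and Dq = density_of[OF yG] and Dp1 = density_of[OF \<beta>] and Dq1 = density_of[OF \<gamma>]
  have onp: "AE t in lborel. t \<in> C \<longrightarrow> ?p1 t = ?p t"
    by (rule derivatives_on_C[OF Dp1 Dp]) (simp add: on_C)
  have onq: "AE t in lborel. t \<in> C \<longrightarrow> ?q1 t = ?q t"
    by (rule derivatives_on_C[OF Dq1 Dq]) (simp add: on_C)
  have ends: "AE t in lborel. t \<noteq> (0::real)" "AE t in lborel. t \<noteq> (1::real)"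
    by (rule AE_lborel_singleton)+
  have ae: "AE t in lborel. indicator {0..1} t *\<^sub>R (\<phi> (?\<beta> t) (?\<gamma> t) * sqrt (?p1 t * ?q1 t)) =
      indicator {0..1} t *\<^sub>R (max 0 (\<phi> (x t) (y t)) * sqrt (?p t * ?q t))"
    using onp onq derivatives_off_C[OF Dp1 Dq1] ends
  proof eventually_elim
    case (elim t)
    show ?case
    proof (cases "t \<in> {0..1}")
      case tI: True
      show ?thesis
      proof (cases "t \<in> C")
        case True
        then have "0 \<le> \<phi> (x t) (y t)" using elim(4,5) by (auto simp: C_def)
        moreover have "?p1 t = ?p t" "?q1 t = ?q t" using elim(1,2) True by blast+
        ultimately show ?thesis using on_C[OF True] by simp
      next
        case False
        then have "\<phi> (x t) (y t) < 0" using tI by (auto simp: C_def)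
        moreover have "?p1 t = 0 \<or> ?q1 t = 0" using elim(3) False tI by blast
        then have "?p1 t * ?q1 t = 0" by (simp only: mult_eq_0_iff)
        ultimately show ?thesis by simp
      qed
    qed simp
  qed
  have "continuous_on {0..1} (\<lambda>t. max 0 (\<phi> (x t) (y t)))"
    by (intro continuous_intros cont_Gamma xG yG)
  from weighted_sqrt_integrable[OF this Dp Dq]
  have "(LINT t:{0..1}|lborel. \<phi> (?\<beta> t) (?\<gamma> t) * sqrt (?p1 t * ?q1 t)) =
    (LINT t:{0..1}|lborel. max 0 (\<phi> (x t) (y t)) * sqrt (?p t * ?q t))"
    unfolding set_lebesgue_integral_def
    by (intro integral_cong_AE ae borel_measurable_integrable
        weighted_sqrt_integrable[OF cont_Gamma[OF \<beta> \<gamma>] Dp1 Dq1])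
  then have "gain ?\<beta> ?\<gamma> = (LINT t:{0..1}|lborel. max 0 (\<phi> (x t) (y t)) * sqrt (?p t * ?q t))"
    unfolding gain_def .
  with \<beta> \<gamma> show ?thesis by blast
qed

text \<open>A maximising sequence, put into normal form, has a uniformly convergent subsequence by
Arzela-Ascoli. The supremum is bounded by the upper sums of the limit pair up to \<open>e\<close>,
hence by the integral of the positive part of the kernel along it, and that value is attained after removing
the negative part.\<close>

theorem gain_attains_maximum: "\<exists>\<beta>\<in>Gamma_bar. \<exists>\<gamma>\<in>Gamma_bar. \<forall>\<beta>'\<in>Gamma_bar. \<forall>\<gamma>'\<in>Gamma_bar. gain \<beta>' \<gamma>' \<le> gain \<beta> \<gamma>"
proof -
  obtain B where B: "\<And>\<beta> \<gamma>. \<beta> \<in> Gamma_bar \<Longrightarrow> \<gamma> \<in> Gamma_bar \<Longrightarrow> gain \<beta> \<gamma> \<le> B" using gain_bounded by blast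
  define S where "S = (SUP z\<in>Gamma_bar \<times> Gamma_bar. gain (fst z) (snd z))"
  have bdd: "bdd_above ((\<lambda>z. gain (fst z) (snd z)) ` (Gamma_bar \<times> Gamma_bar))"
    using B by (intro bdd_aboveI2[of _ _ B]) auto
  have ne: "Gamma_bar \<times> Gamma_bar \<noteq> {}" using id_in_Gamma_bar by blast
  have upper: "gain \<beta> \<gamma> \<le> S" if "\<beta> \<in> Gamma_bar" "\<gamma> \<in> Gamma_bar" for \<beta> \<gamma>
    using cSUP_upper[OF _ bdd, of "(\<beta>, \<gamma>)"] that by (simp add: S_def)
  have "\<exists>\<beta> \<gamma> \<tau>. \<beta> \<in> Gamma_bar \<and> \<gamma> \<in> Gamma_bar \<and> S - 1 / real (Suc n) < gain \<beta> \<gamma> \<and> \<tau> 0 = 0 \<and> \<tau> 1 = 1 \<and>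
    (\<forall>s t. 0 \<le> s \<and> s \<le> t \<and> t \<le> 1 \<longrightarrow> \<tau> s \<le> \<tau> t) \<and> normal_pair (\<beta> \<circ> \<tau>) (\<gamma> \<circ> \<tau>)" for n
  proof -
    have "S - 1 / real (Suc n) < S" by simp
    then obtain z where z: "z \<in> Gamma_bar \<times> Gamma_bar" "S - 1 / real (Suc n) < gain (fst z) (snd z)"
      using less_cSUP_iff[OF ne bdd] unfolding S_def by blast
    then have G: "fst z \<in> Gamma_bar" "snd z \<in> Gamma_bar" by auto
    obtain \<tau> where "\<tau> 0 = 0" "\<tau> 1 = 1" "\<And>s t. 0 \<le> s \<Longrightarrow> s \<le> t \<Longrightarrow> t \<le> 1 \<Longrightarrow> \<tau> s \<le> \<tau> t"
      "normal_pair (fst z \<circ> \<tau>) (snd z \<circ> \<tau>)"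
      using normalise_pair[OF G] by blast
    with G z(2) show ?thesis by blast
  qed
  then obtain b c \<tau> where bc: "\<And>n. b n \<in> Gamma_bar \<and> c n \<in> Gamma_bar \<and> S - 1 / real (Suc n) < gain (b n) (c n) \<and> \<tau> n 0 = 0 \<and> \<tau> n 1 = 1 \<and>
    (\<forall>s t. 0 \<le> s \<and> s \<le> t \<and> t \<le> 1 \<longrightarrow> \<tau> n s \<le> \<tau> n t) \<and> normal_pair (b n \<circ> \<tau> n) (c n \<circ> \<tau> n)"
    by metis
  define X where "X n = b n \<circ> \<tau> n" for n
  define Y where "Y n = c n \<circ> \<tau> n" for n
  have XY: "normal_pair (X n) (Y n)" for n using bc[of n] by (simp add: X_def Y_def)
  obtain x k where k: "strict_mono (k :: nat \<Rightarrow> nat)"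
    and conv: "\<And>e. 0 < e \<Longrightarrow> \<exists>N. \<forall>n t. n \<ge> N \<and> t \<in> {0..1} \<longrightarrow> norm (X (k n) t - x t) < e"
  proof (rule Arzela_Ascoli[of "{0..1::real}" X 1])
    show "norm (X n t) \<le> 1" if "t \<in> {0..1}" for n t
      using normal_pair_bounds[OF XY[of n], of t] that by simp
    show "\<exists>d>0. \<forall>n s. s \<in> {0..1} \<and> norm (t - s) < d \<longrightarrow> norm (X n t - X n s) < e"
      if t: "t \<in> {0..1}" and e: "0 < e" for t e :: real
    proof (intro exI[of _ "e / 2"] conjI allI impI)
      fix n s assume s: "s \<in> {0..1} \<and> norm (t - s) < e / 2"
      have "dist (X n t) (X n s) \<le> 2 * dist t s"
        using lipschitz_onD[OF normal_pair_lipschitz(1)[OF XY[of n]]] t s by blast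
      then show "norm (X n t - X n s) < e" using s by (simp add: dist_norm)
    qed (use e in simp)
  qed auto
  define y where "y t = 2 * t - x t" for t
  have Xx: "(\<lambda>n. X (k n) t) \<longlonglongrightarrow> x t" if t: "t \<in> {0..1}" for t
  proof (rule LIMSEQ_I)
    fix r :: real assume "0 < r"
    from conv[OF this] t show "\<exists>no. \<forall>n\<ge>no. norm (X (k n) t - x t) < r" by blast
  qed
  have Yy: "(\<lambda>n. Y (k n) t) \<longlonglongrightarrow> y t" if t: "t \<in> {0..1}" for t
  proof -
    have "Y (k n) t = 2 * t - X (k n) t" for n
      using normal_pair_bounds(5)[OF XY[of "k n"], of t] t by simp
    then show ?thesis unfolding y_def using Xx[OF t] by (simp add: tendsto_diff)
  qed
  have n: "normal_pair x y"
    unfolding normal_pair_def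
  proof (intro conjI allI impI; (elim conjE)?)
    fix s t :: real assume st: "0 \<le> s" "s \<le> t" "t \<le> 1"
    then have I: "s \<in> {0..1}" "t \<in> {0..1}" by auto
    show "x s \<le> x t"
      by (rule LIMSEQ_le[OF Xx[OF I(1)] Xx[OF I(2)]]) (use normal_pair_increment(1)[OF XY st] in blast)
    show "y s \<le> y t"
      by (rule LIMSEQ_le[OF Yy[OF I(1)] Yy[OF I(2)]]) (use normal_pair_increment(2)[OF XY st] in blast)
  next
    fix t :: real assume t: "0 \<le> t" "t \<le> 1"
    then have I: "t \<in> {0..1}" by auto
    show "0 \<le> x t" "0 \<le> y t"
      by (rule LIMSEQ_le_const[OF Xx[OF I]] LIMSEQ_le_const[OF Yy[OF I]]; use normal_pair_bounds[OF XY t] in blast)+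
    show "x t \<le> 1" "y t \<le> 1"
      by (rule LIMSEQ_le_const2[OF Xx[OF I]] LIMSEQ_le_const2[OF Yy[OF I]]; use normal_pair_bounds[OF XY t] in blast)+
    show "x t + y t = 2 * t" by (simp add: y_def)
  qed
  have upper_sum_conv: "(\<lambda>n. upper_sum (Suc N) (X (k n)) (Y (k n))) \<longlonglongrightarrow> upper_sum (Suc N) x y" for N
    unfolding upper_sum_def
  proof (rule tendsto_sum)
    fix j assume "j \<in> {..<Suc N}"
    then have I: "real j / real (Suc N) \<in> {0..1}" "real (Suc j) / real (Suc N) \<in> {0..1}"
      by (auto simp: field_simps)
    let ?r = "real j / real (Suc N)"
    have "(\<lambda>n. (X (k n) ?r, Y (k n) ?r)) \<longlonglongrightarrow> (x ?r, y ?r)"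
      by (intro tendsto_Pair Xx Yy I)
    moreover have "(x ?r, y ?r) \<in> {0..1} \<times> {0..1}"
      using normal_pair_bounds[OF n, of ?r] I(1) by auto
    moreover have "\<forall>\<^sub>F m in sequentially. (X (k m) ?r, Y (k m) ?r) \<in> {0..1} \<times> {0..1}"
      using normal_pair_bounds[OF XY, of ?r] I(1) by (intro always_eventually) auto
    ultimately have "(\<lambda>n. (\<lambda>(x, y). \<phi> x y) (X (k n) ?r, Y (k n) ?r)) \<longlonglongrightarrow> (\<lambda>(x, y). \<phi> x y) (x ?r, y ?r)"
      by (rule continuous_on_tendsto_compose[OF cont])
    then have "(\<lambda>n. \<phi> (X (k n) ?r) (Y (k n) ?r)) \<longlonglongrightarrow> \<phi> (x ?r) (y ?r)" by simp
    then show "(\<lambda>n. max 0 (\<phi> (X (k n) (real j / real (Suc N))) (Y (k n) (real j / real (Suc N)))) *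
        sqrt ((X (k n) (real (Suc j) / real (Suc N)) - X (k n) (real j / real (Suc N))) *
              (Y (k n) (real (Suc j) / real (Suc N)) - Y (k n) (real j / real (Suc N)))))
       \<longlonglongrightarrow> max 0 (\<phi> (x (real j / real (Suc N))) (y (real j / real (Suc N)))) *
        sqrt ((x (real (Suc j) / real (Suc N)) - x (real j / real (Suc N))) *
              (y (real (Suc j) / real (Suc N)) - y (real j / real (Suc N))))"
      by (intro tendsto_intros Xx Yy I)
  qed
  let ?J = "LINT t:{0..1}|lborel. max 0 (\<phi> (x t) (y t)) * sqrt (density_of x t * density_of y t)"
  have "S \<le> ?J + e" if e: "e > 0" for e
  proof -
    obtain N0 where N0: "\<And>N \<beta> \<gamma> \<tau>. N0 \<le> N \<Longrightarrow> \<beta> \<in> Gamma_bar \<Longrightarrow> \<gamma> \<in> Gamma_bar \<Longrightarrow> \<tau> 0 = 0 \<Longrightarrow> \<tau> 1 = 1 \<Longrightarrow>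
      (\<forall>s t. 0 \<le> s \<and> s \<le> t \<and> t \<le> 1 \<longrightarrow> \<tau> s \<le> \<tau> t) \<Longrightarrow> normal_pair (\<beta> \<circ> \<tau>) (\<gamma> \<circ> \<tau>) \<Longrightarrow>
      gain \<beta> \<gamma> \<le> upper_sum N (\<beta> \<circ> \<tau>) (\<gamma> \<circ> \<tau>) + e"
      using gain_le_upper_sum[OF e] by blast
    have "S \<le> upper_sum (Suc N) x y + e" if N: "N0 \<le> N" for N
    proof (rule LIMSEQ_le)
      have "(\<lambda>n. S - inverse (real (Suc (k n)))) \<longlonglongrightarrow> S - 0"
        using LIMSEQ_subseq_LIMSEQ[OF LIMSEQ_inverse_real_of_nat k] by (intro tendsto_diff tendsto_const) (simp add: o_def)
      then show "(\<lambda>n. S - inverse (real (Suc (k n)))) \<longlonglongrightarrow> S" by simp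
      show "(\<lambda>n. upper_sum (Suc N) (X (k n)) (Y (k n)) + e) \<longlonglongrightarrow> upper_sum (Suc N) x y + e"
        by (intro tendsto_add upper_sum_conv tendsto_const)
      have "S - inverse (real (Suc (k n))) \<le> upper_sum (Suc N) (X (k n)) (Y (k n)) + e" for n
      proof -
        have "gain (b (k n)) (c (k n)) \<le> upper_sum (Suc N) (b (k n) \<circ> \<tau> (k n)) (c (k n) \<circ> \<tau> (k n)) + e"
          using bc[of "k n"] N by (intro N0) auto
        moreover have "S - inverse (real (Suc (k n))) < gain (b (k n)) (c (k n))"
          using bc[of "k n"] by (simp add: inverse_eq_divide)
        ultimately show ?thesis unfolding X_def Y_def by linarith
      qed
      then show "\<exists>m. \<forall>n\<ge>m. S - inverse (real (Suc (k n))) \<le> upper_sum (Suc N) (X (k n)) (Y (k n)) + e" by blast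
    qed
    then show ?thesis
      by (intro LIMSEQ_le_const[OF tendsto_add[OF upper_sum_tendsto[OF n] tendsto_const]]) blast
  qed
  then have "S \<le> ?J" by (rule field_le_epsilon)
  moreover obtain \<beta> \<gamma> where "\<beta> \<in> Gamma_bar" "\<gamma> \<in> Gamma_bar" "gain \<beta> \<gamma> = ?J"
    using gain_remove_negative[OF n] by blast
  ultimately show ?thesis using upper by (metis order_trans)
qed

end

section \<open>Continuously differentiable curves\<close>

text \<open>Expanding the square gives \<open>dist\<^sup>2 = length b + length c - 2 gain\<close>, where the kernel is
the inner product of the two square root velocities. It is continuous because the curves are \<open>C\<^sup>1\<close>.\<close>

theorem C1_infimum_attained:
  fixes b c :: "real \<Rightarrow> 'a::euclidean_space"
  assumes b: "C1_curve b" and c: "C1_curve c"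
  shows "\<exists>\<beta>\<in>Gamma_bar. \<exists>\<gamma>\<in>Gamma_bar.
     srv_dist (b \<circ> \<beta>) (c \<circ> \<gamma>) =
       (INF (\<beta>', \<gamma>') \<in> Gamma_bar \<times> Gamma_bar. srv_dist (b \<circ> \<beta>') (c \<circ> \<gamma>'))"
proof -
  obtain b' where b': "\<And>t. t \<in> {0..1} \<Longrightarrow> (b has_vector_derivative b' t) (at t within {0..1})"
    "continuous_on {0..1} b'" using b unfolding C1_curve_def by blast
  obtain c' where c': "\<And>t. t \<in> {0..1} \<Longrightarrow> (c has_vector_derivative c' t) (at t within {0..1})"
    "continuous_on {0..1} c'" using c unfolding C1_curve_def by blast
  define \<phi> where "\<phi> x y = sqrt_vec (b' x) \<bullet> sqrt_vec (c' y)" for x y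
  have cs: "continuous_on {0..1} (\<lambda>x. sqrt_vec (b' x))" "continuous_on {0..1} (\<lambda>x. sqrt_vec (c' x))"
    using b'(2) c'(2) by (auto intro: continuous_on_compose2[OF continuous_sqrt_vec])
  interpret continuous_kernel \<phi>
  proof
    have "continuous_on ({0..1} \<times> {0..1}) (\<lambda>z. sqrt_vec (b' (fst z)) \<bullet> sqrt_vec (c' (snd z)))"
      by (intro continuous_on_inner continuous_on_compose2[OF cs(1)] continuous_on_compose2[OF cs(2)]
          continuous_on_fst continuous_on_snd continuous_on_id) auto
    then show "continuous_on ({0..1} \<times> {0..1}) (\<lambda>(x, y). \<phi> x y)"
      by (simp add: \<phi>_def case_prod_beta)
  qed
  define \<Lambda> where "\<Lambda> = integral {0..1} (\<lambda>x. norm (b' x)) + integral {0..1} (\<lambda>x. norm (c' x))"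
  have dist: "srv_dist (b \<circ> \<beta>) (c \<circ> \<gamma>) = sqrt (\<Lambda> - 2 * gain \<beta> \<gamma>)"
    if \<beta>: "\<beta> \<in> Gamma_bar" and \<gamma>: "\<gamma> \<in> Gamma_bar" for \<beta> \<gamma>
  proof -
    let ?p = "density_of \<beta>" and ?q = "density_of \<gamma>"
    note Dp = density_of[OF \<beta>] and Dq = density_of[OF \<gamma>]
    let ?k1 = "\<lambda>t. norm (b' (\<beta> t)) * ?p t" and ?k2 = "\<lambda>t. norm (c' (\<gamma> t)) * ?q t"
      and ?k3 = "\<lambda>t. \<phi> (\<beta> t) (\<gamma> t) * sqrt (?p t * ?q t)"
    have nb: "continuous_on {0..1} (\<lambda>x. norm (b' x))" "continuous_on {0..1} (\<lambda>x. norm (c' x))"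
      using b'(2) c'(2) by (auto intro: continuous_on_norm)
    have 1: "set_integrable lborel {0..1} ?k1" "(LINT t:{0..1}|lborel. ?k1 t) = integral {0..1} (\<lambda>x. norm (b' x))"
      by (rule integral_substitution_Gamma_bar[OF nb(1) _ \<beta> Dp]; simp)+
    have 2: "set_integrable lborel {0..1} ?k2" "(LINT t:{0..1}|lborel. ?k2 t) = integral {0..1} (\<lambda>x. norm (c' x))"
      by (rule integral_substitution_Gamma_bar[OF nb(2) _ \<gamma> Dq]; simp)+
    have 3: "set_integrable lborel {0..1} ?k3" by (rule gain_integrable[OF \<beta> \<gamma>])
    have 12: "set_integrable lborel {0..1} (\<lambda>t. ?k1 t + ?k2 t)" by (rule set_integral_add(1)[OF 1(1) 2(1)])
    have 33: "set_integrable lborel {0..1} (\<lambda>t. 2 * ?k3 t)" using 3 by simp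
    have k: "set_integrable lborel {0..1} (\<lambda>t. ?k1 t + ?k2 t - 2 * ?k3 t)"
      by (rule set_integral_diff(1)[OF 12 33])
    have "(LINT t:{0..1}|lborel. ?k1 t + ?k2 t - 2 * ?k3 t) = \<Lambda> - 2 * gain \<beta> \<gamma>"
      unfolding set_integral_diff(2)[OF 12 33] set_integral_add(2)[OF 1(1) 2(1)] 1(2) 2(2) \<Lambda>_def gain_def
      by simp
    moreover have "srv_dist (b \<circ> \<beta>) (c \<circ> \<gamma>) = sqrt (LINT t:{0..1}|lborel. ?k1 t + ?k2 t - 2 * ?k3 t)"
    proof (rule srv_dist_eq)
      show "(\<lambda>t. indicator {0..1} t * (?k1 t + ?k2 t - 2 * ?k3 t)) \<in> borel_measurable borel"
        using borel_measurable_integrable[OF k[unfolded set_integrable_def]] by simp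
      show "AE t in lborel. t \<in> {0..1} \<longrightarrow> (norm (srv (b \<circ> \<beta>) t - srv (c \<circ> \<gamma>) t))\<^sup>2 = ?k1 t + ?k2 t - 2 * ?k3 t"
        using ac_derivative_has_derivative[OF Dp] ac_derivative_has_derivative[OF Dq]
      proof eventually_elim
        case (elim t)
        have chain: "srv (f \<circ> \<alpha>) t = sqrt g *\<^sub>R sqrt_vec (f' (\<alpha> t))"
          if t: "t \<in> {0..1}" and \<alpha>: "\<alpha> \<in> Gamma_bar" "(\<alpha> has_real_derivative g) (at t within {0..1})" "0 \<le> g"
            and f: "\<And>s. s \<in> {0..1} \<Longrightarrow> (f has_vector_derivative f' s) (at s within {0..1})"
          for f f' :: "real \<Rightarrow> 'a" and \<alpha> :: "real \<Rightarrow> real" and g :: real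
        proof -
          have "\<alpha> t \<in> {0..1}" using Gamma_bar_range[OF \<alpha>(1)] t by auto
          from f[OF this] have "(f has_derivative (\<lambda>h. h *\<^sub>R f' (\<alpha> t))) (at (\<alpha> t) within \<alpha> ` {0..1})"
            unfolding Gamma_bar_image[OF \<alpha>(1)] has_vector_derivative_def .
          with \<alpha>(2) have "(f \<circ> \<alpha> has_vector_derivative g *\<^sub>R f' (\<alpha> t)) (at t within {0..1})"
            unfolding has_real_derivative_iff_has_vector_derivative by (rule vector_derivative_diff_chain_within)
          from srv_eq_sqrt_vec[OF this t] show ?thesis by (simp add: sqrt_vec_scaleR \<alpha>(3))
        qed
        show ?case
        proof
          assume t: "t \<in> {0..1}"
          have pq: "0 \<le> ?p t" "0 \<le> ?q t" using Dp Dq by (auto simp: ac_derivative_nonneg)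
          let ?u = "sqrt_vec (b' (\<beta> t))" and ?v = "sqrt_vec (c' (\<gamma> t))"
          have e1: "srv (b \<circ> \<beta>) t = sqrt (?p t) *\<^sub>R ?u"
            using elim(1) t by (intro chain \<beta> pq b'(1)) auto
          have e2: "srv (c \<circ> \<gamma>) t = sqrt (?q t) *\<^sub>R ?v"
            using elim(2) t by (intro chain \<gamma> pq c'(1)) auto
          have n: "?u \<bullet> ?u = norm (b' (\<beta> t))" "?v \<bullet> ?v = norm (c' (\<gamma> t))"
            by (simp_all add: dot_square_norm norm_sqrt_vec)
          have expand: "(norm (a *\<^sub>R u - d *\<^sub>R v))\<^sup>2 = (a * a) * (u \<bullet> u) + (d * d) * (v \<bullet> v) - 2 * (a * d * (u \<bullet> v))"
            for a d and u v :: 'a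
            unfolding power2_norm_eq_inner
            by (simp add: inner_diff_left inner_diff_right inner_commute algebra_simps)
          have s: "sqrt (?p t) * sqrt (?p t) = ?p t" "sqrt (?q t) * sqrt (?q t) = ?q t" using pq by simp_all
          have "(norm (srv (b \<circ> \<beta>) t - srv (c \<circ> \<gamma>) t))\<^sup>2 =
             (sqrt (?p t) * sqrt (?p t)) * (?u \<bullet> ?u) + (sqrt (?q t) * sqrt (?q t)) * (?v \<bullet> ?v) - 2 * (sqrt (?p t) * sqrt (?q t) * (?u \<bullet> ?v))"
            unfolding e1 e2 by (rule expand)
          also have "\<dots> = ?k1 t + ?k2 t - 2 * ?k3 t"
            unfolding n s by (simp add: \<phi>_def real_sqrt_mult mult_ac)
          finally show "(norm (srv (b \<circ> \<beta>) t - srv (c \<circ> \<gamma>) t))\<^sup>2 = ?k1 t + ?k2 t - 2 * ?k3 t" .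
        qed
      qed
    qed
    ultimately show ?thesis by simp
  qed
  obtain \<beta> \<gamma> where m: "\<beta> \<in> Gamma_bar" "\<gamma> \<in> Gamma_bar"
    "\<And>\<beta>' \<gamma>'. \<beta>' \<in> Gamma_bar \<Longrightarrow> \<gamma>' \<in> Gamma_bar \<Longrightarrow> gain \<beta>' \<gamma>' \<le> gain \<beta> \<gamma>"
    using gain_attains_maximum by blast
  have "srv_dist (b \<circ> \<beta>) (c \<circ> \<gamma>) = (INF (\<beta>', \<gamma>') \<in> Gamma_bar \<times> Gamma_bar. srv_dist (b \<circ> \<beta>') (c \<circ> \<gamma>'))"
  proof (rule antisym)
    show "srv_dist (b \<circ> \<beta>) (c \<circ> \<gamma>) \<le> (INF (\<beta>', \<gamma>') \<in> Gamma_bar \<times> Gamma_bar. srv_dist (b \<circ> \<beta>') (c \<circ> \<gamma>'))"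
    proof (rule cINF_greatest)
      fix z assume "z \<in> Gamma_bar \<times> Gamma_bar"
      then have z: "fst z \<in> Gamma_bar" "snd z \<in> Gamma_bar" by auto
      show "srv_dist (b \<circ> \<beta>) (c \<circ> \<gamma>) \<le> (case z of (\<beta>', \<gamma>') \<Rightarrow> srv_dist (b \<circ> \<beta>') (c \<circ> \<gamma>'))"
        unfolding case_prod_beta dist[OF m(1,2)] dist[OF z] using m(3)[OF z] by simp
    qed (use m in blast)
    show "(INF (\<beta>', \<gamma>') \<in> Gamma_bar \<times> Gamma_bar. srv_dist (b \<circ> \<beta>') (c \<circ> \<gamma>')) \<le> srv_dist (b \<circ> \<beta>) (c \<circ> \<gamma>)"
      using cINF_lower[OF bdd_below_srv_dist, of "(\<beta>, \<gamma>)" "Gamma_bar \<times> Gamma_bar" b c] m by simp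
  qed
  with m show ?thesis by blast
qed

section \<open>Lipschitz curves without an optimal pair\<close>

definition cumul :: "real set \<Rightarrow> real \<Rightarrow> real" where
  "cumul E x = measure lborel (E \<inter> {0..x})"

lemma emeasure_Int_Icc_finite: "emeasure lborel (E \<inter> {a..b::real}) \<noteq> \<infinity>"
proof -
  have "emeasure lborel (E \<inter> {a..b}) \<le> emeasure lborel {a..b}" by (intro emeasure_mono) auto
  also have "\<dots> < \<infinity>" by (simp add: emeasure_lborel_Icc_eq)
  finally show ?thesis by simp
qed

lemma cumul_diff:
  assumes E: "E \<in> sets borel" and x: "0 \<le> x" "x \<le> y"
  shows "cumul E y - cumul E x = measure lborel (E \<inter> {x<..y})"
proof -
  have "emeasure lborel (E \<inter> {x<..y}) \<le> emeasure lborel (E \<inter> {x..y})" using E by (intro emeasure_mono) auto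
  then have fin: "emeasure lborel (E \<inter> {x<..y}) \<noteq> \<infinity>"
    using emeasure_Int_Icc_finite[of E x y] by (auto simp: top_unique)
  have "E \<inter> {0..y} = (E \<inter> {0..x}) \<union> (E \<inter> {x<..y})" using x by auto
  then have "cumul E y = measure lborel ((E \<inter> {0..x}) \<union> (E \<inter> {x<..y}))" by (simp add: cumul_def)
  also have "\<dots> = cumul E x + measure lborel (E \<inter> {x<..y})"
    unfolding cumul_def using E fin emeasure_Int_Icc_finite[of E 0 x] by (intro measure_Union) auto
  finally show ?thesis by simp
qed

lemma cumul_0: "cumul E 0 = 0"
proof -
  have "E \<inter> {0..0} = (if 0 \<in> E then {0} else {})" by auto
  then show ?thesis by (simp add: cumul_def)
qed

lemma cumul_Un:
  assumes "A \<in> sets borel" "B \<in> sets borel" "A \<inter> B = {}"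
  shows "cumul (A \<union> B) x = cumul A x + cumul B x"
proof -
  have "(A \<union> B) \<inter> {0..x} = (A \<inter> {0..x}) \<union> (B \<inter> {0..x})" by auto
  then show ?thesis
    unfolding cumul_def using assms emeasure_Int_Icc_finite by (simp add: measure_Union disjoint_iff)
qed

lemma cumul_UNIV: "0 \<le> x \<Longrightarrow> cumul UNIV x = x"
  by (simp add: cumul_def)

lemma cumul_increment:
  assumes E: "E \<in> sets borel" and x: "0 \<le> x" "x \<le> y"
  shows "0 \<le> cumul E y - cumul E x" "cumul E y - cumul E x \<le> y - x"
proof -
  show "0 \<le> cumul E y - cumul E x" unfolding cumul_diff[OF assms] by simp
  have "measure lborel (E \<inter> {x<..y}) \<le> measure lborel {x..y}"
    using E by (intro measure_mono_fmeasurable) (auto intro: fmeasurable_compact)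
  then show "cumul E y - cumul E x \<le> y - x" unfolding cumul_diff[OF assms] using x by simp
qed

lemma cumul_mono: "E \<in> sets borel \<Longrightarrow> mono_on {0..1} (cumul E)"
  using cumul_increment(1) by (intro mono_onI) force

lemma cumul_lipschitz:
  assumes E: "E \<in> sets borel"
  shows "1-lipschitz_on {0..1} (cumul E)"
proof (rule lipschitz_onI)
  fix x y :: real assume "x \<in> {0..1}" "y \<in> {0..1}"
  then show "dist (cumul E x) (cumul E y) \<le> 1 * dist x y"
    using cumul_increment[OF E, of x y] cumul_increment[OF E, of y x]
    by (cases "x \<le> y") (auto simp: dist_real_def)
qed simp

lemma cumul_ac_derivative:
  "E \<in> sets borel \<Longrightarrow> \<beta> \<in> Gamma_bar \<Longrightarrow> \<exists>g. ac_derivative (cumul E \<circ> \<beta>) g"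
  by (rule Gamma_bar_compose_ac_derivative[OF _ cumul_mono cumul_lipschitz])

lemma cumul_ac_derivative_indicator:
  assumes E: "E \<in> sets borel" and fin: "emeasure lborel E < \<infinity>"
  shows "ac_derivative (cumul E) (indicator E)"
  unfolding ac_derivative_def
proof (intro conjI allI impI)
  show "integrable lborel (indicator E :: real \<Rightarrow> real)" using E fin by simp
  fix a b :: real assume ab: "0 \<le> a \<and> a \<le> b \<and> b \<le> 1"
  have "(LINT t:{a..b}|lborel. indicator E t) = (LINT t|lborel. indicator (E \<inter> {a..b}) t :: real)"
    unfolding set_lebesgue_integral_def
    by (intro Bochner_Integration.integral_cong) (auto simp: indicator_def)
  also have "\<dots> = measure lborel (E \<inter> {a..b})" by simp
  also have "\<dots> = measure lborel (E \<inter> {a<..b})"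
  proof (rule measure_eq_AE)
    have "AE x in lborel. x \<noteq> a" by (rule AE_lborel_singleton)
    then show "AE x in lborel. x \<in> E \<inter> {a..b} \<longleftrightarrow> x \<in> E \<inter> {a<..b}" by eventually_elim auto
  qed (use E in auto)
  also have "\<dots> = cumul E b - cumul E a" using cumul_diff[OF E, of a b] ab by simp
  finally show "(LINT t:{a..b}|lborel. indicator E t) = cumul E b - cumul E a" .
qed simp

lemma derivative_0_outside:
  assumes E: "E \<in> sets borel" and \<beta>: "\<beta> \<in> Gamma_bar" and t: "t \<in> {0..1}"
    and d: "(cumul E \<circ> \<beta> has_real_derivative d) (at t within {0..1})"
    and W: "open W" "\<beta> t \<in> W" "W \<inter> E = {}"
  shows "d = 0"
proof -
  obtain e where e: "e > 0" "ball (\<beta> t) e \<subseteq> W" using W by (meson openE)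
  have const: "cumul E y = cumul E (\<beta> t)" if y: "0 \<le> y" "dist y (\<beta> t) < e" for y
  proof -
    have b: "0 \<le> \<beta> t" using Gamma_bar_range[OF \<beta>] t by auto
    have *: "cumul E v = cumul E u" if "0 \<le> u" "u \<le> v" "{u<..v} \<subseteq> ball (\<beta> t) e" for u v
    proof -
      have "E \<inter> {u<..v} = {}" using that(3) e(2) W(3) by blast
      then show ?thesis using cumul_diff[OF E that(1,2)] by simp
    qed
    show ?thesis
    proof (cases "y \<le> \<beta> t")
      case True
      then show ?thesis using y b by (intro *[symmetric]) (auto simp: dist_real_def)
    next
      case False
      then show ?thesis using y b by (intro *) (auto simp: dist_real_def)
    qed
  qed
  obtain r where r: "r > 0" "\<And>s. s \<in> {0..1} \<Longrightarrow> dist s t < r \<Longrightarrow> dist (\<beta> s) (\<beta> t) < e"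
    using Gamma_bar_continuous[OF \<beta>] t e(1) unfolding continuous_on_iff by meson
  have "(cumul E \<circ> \<beta> has_real_derivative 0) (at t within {0..1})"
  proof (rule has_field_derivative_transform_within[OF _ r(1) t])
    show "((\<lambda>s. cumul E (\<beta> t)) has_real_derivative 0) (at t within {0..1})" by simp
    show "cumul E (\<beta> t) = (cumul E \<circ> \<beta>) s" if "s \<in> {0..1}" "dist s t < r" for s
    proof -
      have "0 \<le> \<beta> s" using Gamma_bar_range[OF \<beta>] that(1) by auto
      then show ?thesis using const[of "\<beta> s"] r(2)[OF that] by simp
    qed
  qed
  with d show ?thesis using derivative_unique_unit_interval t by blast
qed

lemma inner_closed:
  assumes V: "open V" and e: "e > 0"
  obtains K where "closed K" "K \<subseteq> V \<inter> {0..1}" "cumul (V - K) 1 < e" "K \<in> sets borel"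
proof -
  have "V \<inter> {0..1::real} \<in> sets borel" using borel_open[OF V] by (intro sets.Int) auto
  then have "V \<inter> {0..1::real} \<in> sets lebesgue" by simp
  from sets_lebesgue_inner_closed[OF this e] obtain K where K: "closed K" "K \<subseteq> V \<inter> {0..1}"
    "emeasure lebesgue (V \<inter> {0..1} - K) < ennreal e"
    by metis
  have Kb: "K \<in> sets borel" using K(1) by (rule borel_closed)
  have eq: "V \<inter> {0..1} - K = (V - K) \<inter> {0..1}" by blast
  have bor: "(V - K) \<inter> {0..1} \<in> sets borel" using borel_open[OF V] Kb by (intro sets.Int sets.Diff) auto
  have "emeasure lborel ((V - K) \<inter> {0..1}) < ennreal e"
    using K(3) bor unfolding eq by simp
  moreover have "emeasure lborel ((V - K) \<inter> {0..1}) = ennreal (cumul (V - K) 1)"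
    unfolding cumul_def using emeasure_Int_Icc_finite by (intro emeasure_eq_ennreal_measure) simp
  moreover have "0 \<le> cumul (V - K) 1" by (simp add: cumul_def)
  ultimately have "cumul (V - K) 1 < e" by (simp only: ennreal_less_iff)
  from that[OF K(1,2) this Kb] show ?thesis .
qed

text \<open>Whenever \<open>\<beta> t\<close> lies in the open set \<open>V\<close>, the measure of the complement is locally constant at \<open>\<beta> t\<close> and
\<open>f t = 0\<close>. For \<open>\<beta> t\<close> outside \<open>V\<close>, approximate \<open>V\<close> from inside by closed sets \<open>K n\<close>: their contribution
to \<open>g t\<close> vanishes for the same reason, and the rest, from \<open>V - K n\<close>, has a small integral. This takes the
place of a chain rule at points where the measure of \<open>V\<close> is not differentiable.\<close>

lemma derivatives_complementary:
  assumes V: "open V" and \<beta>: "\<beta> \<in> Gamma_bar"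
    and g: "ac_derivative (cumul V \<circ> \<beta>) g" and f: "ac_derivative (cumul (- V) \<circ> \<beta>) f"
  shows "AE t in lborel. t \<in> {0..1} \<longrightarrow> f t = 0 \<or> g t = 0"
proof -
  have V_borel: "V \<in> sets borel" "- V \<in> sets borel" using V by auto
  have "\<exists>K. closed K \<and> K \<subseteq> V \<inter> {0..1} \<and> cumul (V - K) 1 < 1 / real (Suc n) \<and> K \<in> sets borel" for n
    using inner_closed[OF V, of "1 / real (Suc n)"] by (metis of_nat_0_less_iff zero_less_Suc zero_less_divide_1_iff)
  then obtain K where K: "\<And>n. closed (K n)" "\<And>n. K n \<subseteq> V \<inter> {0..1}" "\<And>n. cumul (V - K n) 1 < 1 / real (Suc n)"
    "\<And>n. K n \<in> sets borel" by metis
  have "\<forall>n. \<exists>h k. ac_derivative (cumul (V - K n) \<circ> \<beta>) h \<and> ac_derivative (cumul (K n) \<circ> \<beta>) k"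
    using cumul_ac_derivative[OF _ \<beta>] K(4) V_borel by (metis sets.Diff)
  then obtain h k where h: "\<And>n. ac_derivative (cumul (V - K n) \<circ> \<beta>) (h n)"
    and k: "\<And>n. ac_derivative (cumul (K n) \<circ> \<beta>) (k n)" by metis
  have split: "cumul V x = cumul (K n) x + cumul (V - K n) x" for n x
  proof -
    have "V = K n \<union> (V - K n)" using K(2) by blast
    then show ?thesis using cumul_Un[of "K n" "V - K n" x] K(4) V_borel by auto
  qed
  define S where "S = {t \<in> {0..1}. \<beta> t \<in> - V}"
  have "closed S"
    using continuous_closed_preimage[OF Gamma_bar_continuous[OF \<beta>], of "- V"] V
    by (simp add: S_def vimage_def Int_def closed_Compl)
  then have Sb: "S \<in> sets borel" by auto
  have AEh: "AE t in lborel. \<forall>n. t \<in> {0..1} \<longrightarrow> (cumul (V - K n) \<circ> \<beta> has_real_derivative h n t) (at t within {0..1})"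
    unfolding AE_all_countable using ac_derivative_has_derivative[OF h] by blast
  have AEk: "AE t in lborel. \<forall>n. t \<in> {0..1} \<longrightarrow> (cumul (K n) \<circ> \<beta> has_real_derivative k n t) (at t within {0..1})"
    unfolding AE_all_countable using ac_derivative_has_derivative[OF k] by blast
  have gh: "AE t in lborel. t \<in> S \<longrightarrow> (\<forall>n. g t = h n t)"
    using AEh AEk ac_derivative_has_derivative[OF g]
  proof eventually_elim
    case (elim t)
    show ?case
    proof (intro impI allI)
      fix n assume t: "t \<in> S"
      then have tI: "t \<in> {0..1}" and tV: "\<beta> t \<in> - V" by (auto simp: S_def)
      have dk: "(cumul (K n) \<circ> \<beta> has_real_derivative k n t) (at t within {0..1})" 
        and dh: "(cumul (V - K n) \<circ> \<beta> has_real_derivative h n t) (at t within {0..1})"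
        using elim(1,2) tI by blast+
      have "k n t = 0"
        by (rule derivative_0_outside[OF K(4) \<beta> tI dk, of "- K n"]) (use tV K(1,2) in \<open>auto simp: open_Compl\<close>)
      moreover have "(cumul V \<circ> \<beta> has_real_derivative k n t + h n t) (at t within {0..1})"
        using DERIV_add[OF dk dh] by (simp add: o_def split[of _ n])
      ultimately show "g t = h n t"
        using derivative_unique_unit_interval[OF _ _ tI] elim(3) tI by fastforce
    qed
  qed
  have gi: "integrable lborel (\<lambda>t. indicator S t *\<^sub>R g t)"
    using Sb by (intro integrable_mult_indicator ac_derivative_integrable[OF g]) auto
  have "(LINT t|lborel. indicator S t *\<^sub>R g t) \<le> 1 / real (Suc n)" for n
  proof -
    have "(LINT t|lborel. indicator S t *\<^sub>R g t) \<le> (LINT t|lborel. indicator {0..1} t *\<^sub>R h n t)"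
    proof (rule integral_mono_AE[OF gi])
      show "integrable lborel (\<lambda>t. indicator {0..1} t *\<^sub>R h n t)"
        by (intro integrable_mult_indicator ac_derivative_integrable[OF h]) auto
      show "AE t in lborel. indicator S t *\<^sub>R g t \<le> indicator {0..1} t *\<^sub>R h n t"
        using gh by eventually_elim (auto simp: S_def indicator_def ac_derivative_nonneg[OF h])
    qed
    also have "\<dots> = cumul (V - K n) 1"
      using ac_derivative_integral[OF h, of 0 1] by (simp add: set_lebesgue_integral_def Gamma_bar_0 Gamma_bar_1 \<beta> cumul_0)
    also have "\<dots> \<le> 1 / real (Suc n)" using K(3)[of n] by simp
    finally show ?thesis .
  qed
  then have "(LINT t|lborel. indicator S t *\<^sub>R g t) \<le> 0"
    using LIMSEQ_le_const[OF LIMSEQ_inverse_real_of_nat, of "LINT t|lborel. indicator S t *\<^sub>R g t"]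
    by (simp add: inverse_eq_divide)
  moreover have nn: "AE t in lborel. 0 \<le> indicator S t *\<^sub>R g t" by (simp add: ac_derivative_nonneg[OF g])
  then have "0 \<le> (LINT t|lborel. indicator S t *\<^sub>R g t)" by (rule integral_nonneg_AE)
  ultimately have "AE t in lborel. indicator S t *\<^sub>R g t = 0"
    using integral_nonneg_eq_0_iff_AE[OF gi nn] by simp
  then show ?thesis
    using ac_derivative_has_derivative[OF f]
  proof eventually_elim
    case (elim t)
    show ?case
    proof
      assume t: "t \<in> {0..1}"
      show "f t = 0 \<or> g t = 0"
      proof (cases "\<beta> t \<in> V")
        case True
        have "f t = 0"
          by (rule derivative_0_outside[OF V_borel(2) \<beta> t _ V True]) (use elim(2) t in auto)
        then show ?thesis by simp
      next
        case False
        then have "t \<in> S" using t by (simp add: S_def)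
        then show ?thesis using elim(1) by simp
      qed
    qed
  qed
qed

lemma sqrt_vec_orthogonal:
  fixes u v :: "'a::real_inner"
  assumes "norm u = 1" "norm v = 1" "0 \<le> g" "0 \<le> f" "f = 0 \<or> g = 0"
  shows "sqrt_vec (g *\<^sub>R u + f *\<^sub>R v) = sqrt g *\<^sub>R u + sqrt f *\<^sub>R v"
proof -
  have unit: "sqrt_vec w = w" if "norm w = 1" for w :: 'a
    using that by (auto simp: sqrt_vec_def)
  from assms(5) show ?thesis
    using assms(1-4) by (auto simp: sqrt_vec_scaleR unit)
qed

text \<open>Both curves move in direction \<open>u\<close> on \<open>V\<close>, while on the complement of \<open>V\<close> they move in the opposite
directions \<open>v\<close> and \<open>-v\<close>. Since \<open>V\<close> contains the rationals, matching the \<open>V\<close>-parts perfectly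
forces \<open>\<beta> = \<gamma>\<close>; since the complement has positive measure, \<open>\<beta> = \<gamma>\<close> incurs the penalty of
matching \<open>v\<close> with \<open>-v\<close>.\<close>

locale counterexample =
  fixes V :: "real set" and u v :: "'a::euclidean_space"
  assumes V: "open V" and VQ: "\<rat> \<subseteq> V" and V_small: "emeasure lborel V < ennreal (1/2)"
    and uv: "norm u = 1" "norm v = 1" "u \<bullet> v = 0"
begin

definition b :: "real \<Rightarrow> 'a" where "b x = cumul V x *\<^sub>R u + cumul (- V) x *\<^sub>R v"
definition c :: "real \<Rightarrow> 'a" where "c x = cumul V x *\<^sub>R u - cumul (- V) x *\<^sub>R v"

lemma V_borel: "V \<in> sets borel" "- V \<in> sets borel"
  using borel_open[OF V] by auto

lemma cumul_complement: "0 \<le> x \<Longrightarrow> cumul V x + cumul (- V) x = x"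
  using cumul_Un[OF V_borel, of x] cumul_UNIV[of x] by simp

lemma cumul_V_less: "cumul V 1 < 1"
proof -
  have "emeasure lborel (V \<inter> {0..1}) \<le> emeasure lborel V" using V_borel by (intro emeasure_mono) auto
  then have "emeasure lborel (V \<inter> {0..1}) < ennreal (1/2)" using V_small by (rule le_less_trans)
  moreover have "emeasure lborel (V \<inter> {0..1}) = ennreal (cumul V 1)"
    unfolding cumul_def using emeasure_Int_Icc_finite by (intro emeasure_eq_ennreal_measure) simp
  moreover have "0 \<le> cumul V 1" by (simp add: cumul_def)
  ultimately have "cumul V 1 < 1/2" by (simp only: ennreal_less_iff)
  then show ?thesis by simp
qed

lemma cumul_V_strict:
  assumes "0 \<le> x" "x < y"
  shows "cumul V x < cumul V y"
proof -
  obtain q where q: "q \<in> \<rat>" "x < q" "q < y" using Rats_dense_in_real[OF assms(2)] by blast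
  then have "q \<in> V \<inter> {x<..<y}" using VQ by auto
  moreover have "open (V \<inter> {x<..<y})" using V by auto
  ultimately obtain e where e: "e > 0" "cball q e \<subseteq> V \<inter> {x<..<y}" by (meson open_contains_cball)
  have "2 * e = measure lborel (cball q e)" using e(1) by (simp add: cball_eq_atLeastAtMost)
  also have "\<dots> \<le> measure lborel (V \<inter> {x<..y})"
  proof (rule measure_mono_fmeasurable)
    show "cball q e \<subseteq> V \<inter> {x<..y}" using e(2) by auto
    have "emeasure lborel (V \<inter> {x<..y}) \<le> emeasure lborel V" using V_borel by (intro emeasure_mono) auto
    then have "emeasure lborel (V \<inter> {x<..y}) < \<infinity>" using V_small by (simp add: le_less_trans less_top order_less_le_trans)
    then show "V \<inter> {x<..y} \<in> fmeasurable lborel" using V_borel by (intro fmeasurableI) auto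
  qed auto
  also have "\<dots> = cumul V y - cumul V x" using cumul_diff[OF V_borel(1), of x y] assms by simp
  finally show ?thesis using e(1) by simp
qed

lemma Lipschitz_b: "Lipschitz_curve b" and Lipschitz_c: "Lipschitz_curve c"
proof -
  have *: "norm (p *\<^sub>R u + q *\<^sub>R v) \<le> \<bar>p\<bar> + \<bar>q\<bar>" "norm (p *\<^sub>R u - q *\<^sub>R v) \<le> \<bar>p\<bar> + \<bar>q\<bar>" for p q
    using norm_triangle_ineq[of "p *\<^sub>R u" "q *\<^sub>R v"] norm_triangle_ineq4[of "p *\<^sub>R u" "q *\<^sub>R v"] uv by auto
  have d: "\<bar>cumul V x - cumul V y\<bar> + \<bar>cumul (- V) x - cumul (- V) y\<bar> \<le> 2 * dist x y" if "x \<in> {0..1}" "y \<in> {0..1}" for x y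
    using lipschitz_onD[OF cumul_lipschitz[OF V_borel(1)] that] lipschitz_onD[OF cumul_lipschitz[OF V_borel(2)] that]
    by (simp add: dist_real_def)
  have "2-lipschitz_on {0..1} b"
  proof (rule lipschitz_onI)
    fix x y :: real assume xy: "x \<in> {0..1}" "y \<in> {0..1}"
    have "b x - b y = (cumul V x - cumul V y) *\<^sub>R u + (cumul (- V) x - cumul (- V) y) *\<^sub>R v"
      by (simp add: b_def algebra_simps)
    then show "dist (b x) (b y) \<le> 2 * dist x y"
      unfolding dist_norm[of "b x"] using *(1) d[OF xy] by (metis order_trans)
  qed simp
  then show "Lipschitz_curve b" unfolding Lipschitz_curve_def by blast
  have "2-lipschitz_on {0..1} c"
  proof (rule lipschitz_onI)
    fix x y :: real assume xy: "x \<in> {0..1}" "y \<in> {0..1}"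
    have "c x - c y = (cumul V x - cumul V y) *\<^sub>R u - (cumul (- V) x - cumul (- V) y) *\<^sub>R v"
      by (simp add: c_def algebra_simps)
    then show "dist (c x) (c y) \<le> 2 * dist x y"
      unfolding dist_norm[of "c x"] using *(2) d[OF xy] by (metis order_trans)
  qed simp
  then show "Lipschitz_curve c" unfolding Lipschitz_curve_def by blast
qed

lemma srv_dist_bc:
  assumes \<beta>: "\<beta> \<in> Gamma_bar" and \<gamma>: "\<gamma> \<in> Gamma_bar"
    and g: "ac_derivative (cumul V \<circ> \<beta>) g" and f: "ac_derivative (cumul (- V) \<circ> \<beta>) f"
    and g': "ac_derivative (cumul V \<circ> \<gamma>) g'" and f': "ac_derivative (cumul (- V) \<circ> \<gamma>) f'"
  shows "srv_dist (b \<circ> \<beta>) (c \<circ> \<gamma>) =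
    sqrt (2 - 2 * (LINT t:{0..1}|lborel. sqrt (g t * g' t)) + 2 * (LINT t:{0..1}|lborel. sqrt (f t * f' t)))"
proof -
  note nn = ac_derivative_nonneg[OF g] ac_derivative_nonneg[OF f] ac_derivative_nonneg[OF g'] ac_derivative_nonneg[OF f']
  let ?k1 = "\<lambda>t. g t + f t" and ?k2 = "\<lambda>t. g' t + f' t" and ?k3 = "\<lambda>t. 2 * sqrt (g t * g' t)" and ?k4 = "\<lambda>t. 2 * sqrt (f t * f' t)"
  have i: "set_integrable lborel {0..1} g" "set_integrable lborel {0..1} f" "set_integrable lborel {0..1} g'" "set_integrable lborel {0..1} f'"
    by (intro set_integrable_lborel ac_derivative_integrable[OF g] ac_derivative_integrable[OF f] ac_derivative_integrable[OF g'] ac_derivative_integrable[OF f'])+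
  have L: "(LINT t:{0..1}|lborel. g t) + (LINT t:{0..1}|lborel. f t) = 1" "(LINT t:{0..1}|lborel. g' t) + (LINT t:{0..1}|lborel. f' t) = 1"
    using ac_derivative_integral[OF g, of 0 1] ac_derivative_integral[OF f, of 0 1] ac_derivative_integral[OF g', of 0 1] ac_derivative_integral[OF f', of 0 1]
      cumul_complement[of 1] by (simp_all add: Gamma_bar_0 Gamma_bar_1 \<beta> \<gamma> cumul_0)
  have i3: "set_integrable lborel {0..1} ?k3"
    using weighted_sqrt_integrable[OF continuous_on_const[of _ 2] g g'] by (simp add: set_integrable_def)
  have i4: "set_integrable lborel {0..1} ?k4"
    using weighted_sqrt_integrable[OF continuous_on_const[of _ 2] f f'] by (simp add: set_integrable_def)
  have i1: "set_integrable lborel {0..1} ?k1" and i2: "set_integrable lborel {0..1} ?k2"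
    by (rule set_integral_add(1)[OF i(1,2)] set_integral_add(1)[OF i(3,4)])+
  note i12 = set_integral_add(1)[OF i1 i2]
  note i123 = set_integral_diff(1)[OF i12 i3]
  note i1234 = set_integral_add(1)[OF i123 i4]
  have "(LINT t:{0..1}|lborel. ?k1 t + ?k2 t - ?k3 t + ?k4 t) =
     2 - 2 * (LINT t:{0..1}|lborel. sqrt (g t * g' t)) + 2 * (LINT t:{0..1}|lborel. sqrt (f t * f' t))"
    unfolding set_integral_add(2)[OF i123 i4] set_integral_diff(2)[OF i12 i3] set_integral_add(2)[OF i1 i2]
      set_integral_add(2)[OF i(1,2)] set_integral_add(2)[OF i(3,4)] L by simp
  moreover have "srv_dist (b \<circ> \<beta>) (c \<circ> \<gamma>) = sqrt (LINT t:{0..1}|lborel. ?k1 t + ?k2 t - ?k3 t + ?k4 t)"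
  proof (rule srv_dist_eq)
    show "(\<lambda>t. indicator {0..1} t * (?k1 t + ?k2 t - ?k3 t + ?k4 t)) \<in> borel_measurable borel"
      using borel_measurable_integrable[OF i1234[unfolded set_integrable_def]] by simp
    show "AE t in lborel. t \<in> {0..1} \<longrightarrow> (norm (srv (b \<circ> \<beta>) t - srv (c \<circ> \<gamma>) t))\<^sup>2 = ?k1 t + ?k2 t - ?k3 t + ?k4 t"
      using ac_derivative_has_derivative[OF g] ac_derivative_has_derivative[OF f]
        ac_derivative_has_derivative[OF g'] ac_derivative_has_derivative[OF f']
        derivatives_complementary[OF V \<beta> g f] derivatives_complementary[OF V \<gamma> g' f']
    proof eventually_elim
      case (elim t)
      show ?case
      proof
        assume t: "t \<in> {0..1}"
        have hv: "((\<lambda>s. h s *\<^sub>R w) has_vector_derivative d *\<^sub>R w) (at t within {0..1})"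
          if "(h has_real_derivative d) (at t within {0..1})" for h d and w :: 'a
          using has_vector_derivative_scaleR[OF that has_vector_derivative_const[of w]] by simp
        have "(b \<circ> \<beta> has_vector_derivative (g t *\<^sub>R u + f t *\<^sub>R v)) (at t within {0..1})"
          using has_vector_derivative_add[OF hv[OF elim(1)[rule_format, OF t], of u] hv[OF elim(2)[rule_format, OF t], of v]]
          by (simp add: o_def b_def)
        from srv_eq_sqrt_vec[OF this t] have e1: "srv (b \<circ> \<beta>) t = sqrt (g t) *\<^sub>R u + sqrt (f t) *\<^sub>R v"
          using sqrt_vec_orthogonal[OF uv(1,2), of "g t" "f t"] nn elim(5) t by simp
        have "(c \<circ> \<gamma> has_vector_derivative (g' t *\<^sub>R u + f' t *\<^sub>R (- v))) (at t within {0..1})"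
          using has_vector_derivative_add[OF hv[OF elim(3)[rule_format, OF t], of u] hv[OF elim(4)[rule_format, OF t], of "- v"]]
          by (simp add: o_def c_def)
        from srv_eq_sqrt_vec[OF this t] have e2: "srv (c \<circ> \<gamma>) t = sqrt (g' t) *\<^sub>R u + sqrt (f' t) *\<^sub>R (- v)"
          using sqrt_vec_orthogonal[of u "- v" "g' t" "f' t"] uv nn elim(6) t by simp
        have "srv (b \<circ> \<beta>) t - srv (c \<circ> \<gamma>) t = (sqrt (g t) - sqrt (g' t)) *\<^sub>R u + (sqrt (f t) + sqrt (f' t)) *\<^sub>R v"
          unfolding e1 e2 by (simp add: algebra_simps)
        also have "(norm \<dots>)\<^sup>2 = (sqrt (g t) - sqrt (g' t))\<^sup>2 + (sqrt (f t) + sqrt (f' t))\<^sup>2"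
        proof -
          have "u \<bullet> u = 1" "v \<bullet> v = 1" using uv by (simp_all add: dot_square_norm)
          then show ?thesis using uv(3)
            unfolding power2_norm_eq_inner
            by (simp add: inner_add_left inner_add_right inner_commute power2_eq_square)
        qed
        also have "\<dots> = ?k1 t + ?k2 t - ?k3 t + ?k4 t"
          using nn by (simp add: power2_diff power2_sum real_sqrt_mult)
        finally show "(norm (srv (b \<circ> \<beta>) t - srv (c \<circ> \<gamma>) t))\<^sup>2 = ?k1 t + ?k2 t - ?k3 t + ?k4 t" .
      qed
    qed
  qed
  ultimately show ?thesis by simp
qed

text \<open>Match the curves along the diagonal on a closed subset \<open>K\<close> of \<open>V\<close> of almost full measure, and let the
two parameters move one after the other elsewhere. The gain is then the measure of \<open>K\<close>, and \<open>v\<close> and \<open>-v\<close> never meet.\<close>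

lemma almost_optimal:
  assumes e: "e > 0"
  shows "\<exists>\<beta>\<in>Gamma_bar. \<exists>\<gamma>\<in>Gamma_bar. srv_dist (b \<circ> \<beta>) (c \<circ> \<gamma>) \<le> sqrt (2 - 2 * (cumul V 1 - e))"
proof -
  obtain K where K: "closed K" "K \<subseteq> V \<inter> {0..1}" "cumul (V - K) 1 < e" "K \<in> sets borel"
    using inner_closed[OF V e] by blast
  define C where "C = K \<union> {0, 1}"
  have C01: "C \<subseteq> V \<inter> {0..1}" using K(2) VQ by (auto simp: C_def)
  interpret closed_with_endpoints C
    using K(1) C01 by unfold_locales (auto simp: C_def)
  let ?\<beta> = "early C" and ?\<gamma> = "late C"
  note \<beta> = early_late_Gamma_bar(1) and \<gamma> = early_late_Gamma_bar(2)
  obtain g f g' f' where d: "ac_derivative (cumul V \<circ> ?\<beta>) g" "ac_derivative (cumul (- V) \<circ> ?\<beta>) f"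
    "ac_derivative (cumul V \<circ> ?\<gamma>) g'" "ac_derivative (cumul (- V) \<circ> ?\<gamma>) f'"
    using cumul_ac_derivative[OF V_borel(1) \<beta>] cumul_ac_derivative[OF V_borel(2) \<beta>] cumul_ac_derivative[OF V_borel(1) \<gamma>] cumul_ac_derivative[OF V_borel(2) \<gamma>]
    by blast
  have dV: "ac_derivative (cumul V) (indicator V)"
    using V_small by (intro cumul_ac_derivative_indicator V_borel) (simp add: less_top order_less_le_trans)
  have gC: "AE t in lborel. t \<in> C \<longrightarrow> g t = indicator V t"
    by (rule derivatives_on_C[OF d(1) dV]) (simp add: on_C)
  have g'C: "AE t in lborel. t \<in> C \<longrightarrow> g' t = indicator V t"
    by (rule derivatives_on_C[OF d(3) dV]) (simp add: on_C)
  have i: "integrable lborel (\<lambda>t. indicator {0..1} t *\<^sub>R sqrt (g t * g' t))" "integrable lborel (\<lambda>t. indicator {0..1} t *\<^sub>R sqrt (f t * f' t))"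
    using weighted_sqrt_integrable[OF continuous_on_const[of _ 1] d(1) d(3)] weighted_sqrt_integrable[OF continuous_on_const[of _ 1] d(2) d(4)] by simp_all
  have "AE t in lborel. indicator {0..1} t *\<^sub>R sqrt (f t * f' t) = 0"
    using derivatives_off_C[OF d(2) d(4)] derivatives_complementary[OF V \<beta> d(1,2)] gC
  proof eventually_elim
    case (elim t)
    show ?case
    proof (cases "t \<in> C")
      case True
      then have "g t = 1" "t \<in> {0..1}" using elim(3) C01 by auto
      then have "f t = 0" using elim(2) by auto
      then show ?thesis by simp
    next
      case False
      then show ?thesis using elim(1) by (cases "t \<in> {0..1}") auto
    qed
  qed
  then have F0: "(LINT t:{0..1}|lborel. sqrt (f t * f' t)) = 0"
    unfolding set_lebesgue_integral_def by (rule integral_eq_zero_AE)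
  have "cumul V 1 - e \<le> cumul K 1"
  proof -
    have "V = K \<union> (V - K)" using K(2) by blast
    then have "cumul V 1 = cumul K 1 + cumul (V - K) 1" using cumul_Un[of K "V - K" 1] K(4) V_borel by auto
    then show ?thesis using K(3) by simp
  qed
  also have "cumul K 1 = (LINT t|lborel. indicator K t)"
    using K(2) by (simp add: cumul_def Int_absorb2)
  also have "\<dots> \<le> (LINT t:{0..1}|lborel. sqrt (g t * g' t))"
    unfolding set_lebesgue_integral_def
  proof (rule integral_mono_AE[OF _ i(1)])
    have "emeasure lborel (K \<inter> {0..1}) \<noteq> \<infinity>" by (rule emeasure_Int_Icc_finite)
    moreover have "K \<inter> {0..1} = K" using K(2) by blast
    ultimately show "integrable lborel (indicator K :: real \<Rightarrow> real)" using K(4) by (simp add: less_top)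
    show "AE t in lborel. indicator K t \<le> indicator {0..1} t *\<^sub>R sqrt (g t * g' t)"
      using gC g'C
    proof eventually_elim
      case (elim t)
      have nn: "0 \<le> sqrt (g t * g' t)" using d by (simp add: ac_derivative_nonneg)
      show ?case
      proof (cases "t \<in> K")
        case True
        then have "t \<in> C" "t \<in> V" "t \<in> {0..1}" using K(2) by (auto simp: C_def)
        then show ?thesis using elim True by simp
      next
        case False
        then show ?thesis using nn by (simp add: indicator_def)
      qed
    qed
  qed
  finally have "cumul V 1 - e \<le> (LINT t:{0..1}|lborel. sqrt (g t * g' t))" .
  then have "srv_dist (b \<circ> ?\<beta>) (c \<circ> ?\<gamma>) \<le> sqrt (2 - 2 * (cumul V 1 - e))"
    unfolding srv_dist_bc[OF \<beta> \<gamma> d] F0 by simp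
  with \<beta> \<gamma> show ?thesis by blast
qed

text \<open>Optimality and \<open>almost_optimal\<close> force equality in the arithmetic-geometric mean inequality for \<open>g\<close> and \<open>g'\<close>
and the vanishing of \<open>f f'\<close>. The former gives \<open>cumul V \<circ> \<beta> = cumul V \<circ> \<gamma>\<close>, hence \<open>\<beta> = \<gamma>\<close> by strict monotonicity,
then \<open>f = f'\<close> and so \<open>f = 0\<close>: the complement of \<open>V\<close> would be a null set.\<close>

lemma not_attained:
  assumes \<beta>: "\<beta> \<in> Gamma_bar" and \<gamma>: "\<gamma> \<in> Gamma_bar"
    and opt: "srv_dist (b \<circ> \<beta>) (c \<circ> \<gamma>) = (INF (\<beta>', \<gamma>') \<in> Gamma_bar \<times> Gamma_bar. srv_dist (b \<circ> \<beta>') (c \<circ> \<gamma>'))"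
  shows False
proof -
  obtain g f g' f' where d: "ac_derivative (cumul V \<circ> \<beta>) g" "ac_derivative (cumul (- V) \<circ> \<beta>) f"
    "ac_derivative (cumul V \<circ> \<gamma>) g'" "ac_derivative (cumul (- V) \<circ> \<gamma>) f'"
    using cumul_ac_derivative[OF V_borel(1) \<beta>] cumul_ac_derivative[OF V_borel(2) \<beta>] cumul_ac_derivative[OF V_borel(1) \<gamma>] cumul_ac_derivative[OF V_borel(2) \<gamma>]
    by blast
  note nn = ac_derivative_nonneg[OF d(1)] ac_derivative_nonneg[OF d(2)] ac_derivative_nonneg[OF d(3)] ac_derivative_nonneg[OF d(4)]
  define G where "G = (LINT t:{0..1}|lborel. sqrt (g t * g' t))"
  define F where "F = (LINT t:{0..1}|lborel. sqrt (f t * f' t))"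
  have "2 - 2 * G + 2 * F \<le> 2 - 2 * (cumul V 1 - e)" if e: "e > 0" for e
  proof -
    obtain \<beta>' \<gamma>' where p: "\<beta>' \<in> Gamma_bar" "\<gamma>' \<in> Gamma_bar"
      "srv_dist (b \<circ> \<beta>') (c \<circ> \<gamma>') \<le> sqrt (2 - 2 * (cumul V 1 - e))"
      using almost_optimal[OF e] by blast
    have "srv_dist (b \<circ> \<beta>) (c \<circ> \<gamma>) \<le> srv_dist (b \<circ> \<beta>') (c \<circ> \<gamma>')"
      unfolding opt using cINF_lower[OF bdd_below_srv_dist, of "(\<beta>', \<gamma>')" "Gamma_bar \<times> Gamma_bar" b c] p by simp
    also note p(3)
    finally show ?thesis
      unfolding srv_dist_bc[OF \<beta> \<gamma> d] G_def F_def real_sqrt_le_iff .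
  qed
  then have "cumul V 1 + F \<le> G + e" if "e > 0" for e using that by (simp add: field_simps) force
  then have le: "cumul V 1 + F \<le> G" by (rule field_le_epsilon)
  have i: "integrable lborel (\<lambda>t. indicator {0..1} t *\<^sub>R g t)" "integrable lborel (\<lambda>t. indicator {0..1} t *\<^sub>R g' t)"
    by (intro integrable_mult_indicator ac_derivative_integrable[OF d(1)] ac_derivative_integrable[OF d(3)]; simp)+
  have iG: "integrable lborel (\<lambda>t. indicator {0..1} t *\<^sub>R sqrt (g t * g' t))" and iF: "integrable lborel (\<lambda>t. indicator {0..1} t *\<^sub>R sqrt (f t * f' t))"
    using weighted_sqrt_integrable[OF continuous_on_const[of _ 1] d(1) d(3)] weighted_sqrt_integrable[OF continuous_on_const[of _ 1] d(2) d(4)] by simp_all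
  have cumI: "(LINT t:{0..1}|lborel. g t) = cumul V 1" "(LINT t:{0..1}|lborel. g' t) = cumul V 1" 
    "(LINT t:{0..1}|lborel. f t) = cumul (- V) 1"
    using ac_derivative_integral[OF d(1), of 0 1] ac_derivative_integral[OF d(2), of 0 1] ac_derivative_integral[OF d(3), of 0 1]
    by (simp_all add: Gamma_bar_0 Gamma_bar_1 \<beta> \<gamma> cumul_0)
  let ?D = "\<lambda>t. indicator {0..1} t *\<^sub>R g t + indicator {0..1} t *\<^sub>R g' t - 2 * (indicator {0..1} t *\<^sub>R sqrt (g t * g' t)) +
      2 * (indicator {0..1} t *\<^sub>R sqrt (f t * f' t))"
  have iD: "integrable lborel ?D" using i iG iF by simp
  have D_val: "(LINT t|lborel. ?D t) = 2 * cumul V 1 - 2 * G + 2 * F"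
    using i iG iF cumI by (simp add: set_lebesgue_integral_def G_def F_def)
  \<comment> \<open>The integrand of the squared distance minus the part that every pair has to pay.\<close>
  have D_eq: "?D t = (if t \<in> {0..1} then (sqrt (g t) - sqrt (g' t))\<^sup>2 + 2 * sqrt (f t * f' t) else 0)" for t
    using nn by (auto simp: power2_diff real_sqrt_mult)
  have D_nn: "AE t in lborel. 0 \<le> ?D t"
    unfolding D_eq using nn by auto
  have "(LINT t|lborel. ?D t) = 0"
    using D_val le integral_nonneg_AE[OF D_nn] by simp
  then have D0: "AE t in lborel. ?D t = 0"
    using integral_nonneg_eq_0_iff_AE[OF iD D_nn] by simp
  then have ae: "AE t in lborel. t \<in> {0..1} \<longrightarrow> g t = g' t \<and> f t * f' t = 0"
  proof eventually_elim
    case (elim t)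
    show ?case
    proof
      assume t: "t \<in> {0..1}"
      have "(sqrt (g t) - sqrt (g' t))\<^sup>2 + 2 * sqrt (f t * f' t) = 0" using elim D_eq[of t] t by simp
      moreover have "0 \<le> sqrt (f t * f' t)" using nn by simp
      ultimately have "(sqrt (g t) - sqrt (g' t))\<^sup>2 = 0" "sqrt (f t * f' t) = 0"
        by (smt (verit) zero_le_power2)+
      then show "g t = g' t \<and> f t * f' t = 0" by simp
    qed
  qed
  have eqV: "cumul V (\<beta> t) = cumul V (\<gamma> t)" if t: "t \<in> {0..1}" for t
  proof -
    have "(LINT s:{0..t}|lborel. g s) = (LINT s:{0..t}|lborel. g' s)"
      unfolding set_lebesgue_integral_def
    proof (rule integral_cong_AE)
      show "AE s in lborel. indicator {0..t} s *\<^sub>R g s = indicator {0..t} s *\<^sub>R g' s"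
        using ae by eventually_elim (use t in \<open>auto simp: indicator_def\<close>)
    qed (use ac_derivative_measurable[OF d(1)] ac_derivative_measurable[OF d(3)] in measurable)
    then show ?thesis
      using ac_derivative_integral[OF d(1), of 0 t] ac_derivative_integral[OF d(3), of 0 t] t
      by (simp add: Gamma_bar_0 \<beta> \<gamma> cumul_0)
  qed
  \<comment> \<open>Strict monotonicity holds because every interval contains a rational, hence a part of V of positive measure.\<close>
  have eq: "\<beta> t = \<gamma> t" if t: "t \<in> {0..1}" for t
    using eqV[OF t] cumul_V_strict[of "\<beta> t" "\<gamma> t"] cumul_V_strict[of "\<gamma> t" "\<beta> t"]
      Gamma_bar_range[OF \<beta>, of t] Gamma_bar_range[OF \<gamma>, of t] t
    by (cases "\<beta> t" "\<gamma> t" rule: linorder_cases) auto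
  have "AE t in lborel. indicator {0..1} t *\<^sub>R f t = 0"
    using ae ac_derivative_has_derivative[OF d(2)] ac_derivative_has_derivative[OF d(4)]
  proof eventually_elim
    case (elim t)
    show ?case
    proof (cases "t \<in> {0..1}")
      case True
      have "(cumul (- V) \<circ> \<beta> has_real_derivative f' t) (at t within {0..1})"
      proof (rule has_field_derivative_transform_within[OF _ zero_less_one True])
        show "(cumul (- V) \<circ> \<gamma> has_real_derivative f' t) (at t within {0..1})" using elim(3) True by blast
      qed (simp add: eq)
      then have "f t = f' t" using derivative_unique_unit_interval True elim(2) by blast
      then show ?thesis using elim(1) True by simp
    qed simp
  qed
  then have "(LINT t:{0..1}|lborel. f t) = 0"
    unfolding set_lebesgue_integral_def by (rule integral_eq_zero_AE)
  then show False using cumI(3) cumul_complement[of 1] cumul_V_less by simp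
qed

end

lemma small_open_superset_Rats:
  obtains V :: "real set" where "open V" "\<rat> \<subseteq> V" "emeasure lborel V < ennreal (1/2)"
proof -
  have null: "(\<rat> :: real set) \<in> null_sets lborel" by (intro countable_imp_null_set_lborel countable_rat)
  then have Q: "(\<rat> :: real set) \<in> sets borel" by auto
  have "0 < (1/2 :: real)" by simp
  from outer_regular_lborel[OF Q this] obtain V :: "real set"
    where V: "open V" "\<rat> \<subseteq> V" "emeasure lborel (V - \<rat>) < ennreal (1/2)" by blast
  then have "emeasure lborel V < ennreal (1/2)"
    using emeasure_Diff_null_set[OF null, of V] by simp
  with V that show ?thesis by blast
qed

theorem mainTheorem1:
  shows
    "(\<forall>b c :: real \<Rightarrow> real ^ 'd. C1_curve b \<and> C1_curve c \<longrightarrow>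
        (\<exists>\<beta>\<in>Gamma_bar. \<exists>\<gamma>\<in>Gamma_bar.
           srv_dist (b \<circ> \<beta>) (c \<circ> \<gamma>) =
             (INF (\<beta>', \<gamma>') \<in> Gamma_bar \<times> Gamma_bar. srv_dist (b \<circ> \<beta>') (c \<circ> \<gamma>')))) \<and>
     (CARD('d) \<ge> 2 \<longrightarrow>
        (\<exists>b c :: real \<Rightarrow> real ^ 'd. Lipschitz_curve b \<and> Lipschitz_curve c \<and>
           \<not> (\<exists>\<beta>\<in>Gamma_bar. \<exists>\<gamma>\<in>Gamma_bar.
                srv_dist (b \<circ> \<beta>) (c \<circ> \<gamma>) =
                  (INF (\<beta>', \<gamma>') \<in> Gamma_bar \<times> Gamma_bar. srv_dist (b \<circ> \<beta>') (c \<circ> \<gamma>')))))"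
proof (intro conjI allI impI)
  fix b c :: "real \<Rightarrow> real ^ 'd"
  assume "C1_curve b \<and> C1_curve c"
  then show "\<exists>\<beta>\<in>Gamma_bar. \<exists>\<gamma>\<in>Gamma_bar. srv_dist (b \<circ> \<beta>) (c \<circ> \<gamma>) =
      (INF (\<beta>', \<gamma>') \<in> Gamma_bar \<times> Gamma_bar. srv_dist (b \<circ> \<beta>') (c \<circ> \<gamma>'))"
    by (intro C1_infimum_attained) auto
next
  assume "CARD('d) \<ge> 2"
  then obtain i j :: 'd where ij: "i \<noteq> j"
    by (metis card_2_iff' card_le_Suc0_iff_eq finite not_less_eq_eq numeral_2_eq_2 UNIV_I)
  obtain V :: "real set" where V: "open V" "\<rat> \<subseteq> V" "emeasure lborel V < ennreal (1/2)"
    by (rule small_open_superset_Rats)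
  interpret counterexample V "axis i 1 :: real ^ 'd" "axis j 1"
    using V ij by unfold_locales (auto simp: inner_axis_axis)
  show "\<exists>b c :: real \<Rightarrow> real ^ 'd. Lipschitz_curve b \<and> Lipschitz_curve c \<and>
           \<not> (\<exists>\<beta>\<in>Gamma_bar. \<exists>\<gamma>\<in>Gamma_bar. srv_dist (b \<circ> \<beta>) (c \<circ> \<gamma>) =
                  (INF (\<beta>', \<gamma>') \<in> Gamma_bar \<times> Gamma_bar. srv_dist (b \<circ> \<beta>') (c \<circ> \<gamma>')))"
    using Lipschitz_b Lipschitz_c not_attained by blast
qed

end
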